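(* Let $D=D_1\cup\cdots\cup D_m$ and $D'=D'_1\cup\cdots\cup D'_m$ be twisted link diagrams such that $D_i$ and $D'_i$ are of even type for some $i$. Let $C_i$ and $C'_i$ be twisted intersection colorings mod $d_i(D)$ and mod $d_i(D')$ on $D_i$ and $D'_i$, respectively. If $D$ and $D'$ are equivalent as twisted links, then $$\psi^{(D_i,C_i)}(t)=\psi^{(D'_i,C'_i)}(t)$$ and the pairs $$\bigl(\psi_{+1}^{(D_i,C_i)}(t),\ \psi_{-1}^{(D_i,C_i)}(t)\bigr)\quad\text{and}\quad\bigl(\psi_{+1}^{(D'_i,C'_i)}(t),\ \psi_{-1}^{(D'_i,C'_i)}(t)\bigr)$$ are $2$-equivalent.
   Context: **Twisted link diagrams.** A twisted link diagram $D=D_1\cup\cdots\cup D_m$ is a finite collection of oriented closed curves (components) generically immersed in the oriented plane $\mathbb{R}^2$, whose only multiple points are finitely many transverse double points. Each double point is either a classical crossing (with over/under information, and with the usual sign $\mathrm{sign}(\tau)=\pm1$) or a virtual crossing (no over/under information). In addition there are finitely many bars, a bar being a short segment crossing an arc of the diagram transversally at a point that is not a crossing. Diagrams are ordered: components are numbered $1,\dots,m$. A component $D_i$ is of even type if the number of bars on $D_i$ is even. **Equivalence.** The extended Reidemeister moves (with all orientations of strands) are: the classical Reidemeister moves R1, R2, R3; the moves V1, V2, V3, which are R1, R2, R3 with all crossings virtual; V4, in which an arc having two consecutive virtual crossings is moved across a classical crossing; T1, sliding a bar along its arc through a virtual crossing; T2, deleting or inserting two consecutive bars on an arc; T3, relating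 the following two tangles in a disk with four boundary ends NW, NE, SW, SE: (i) a single classical crossing of a strand SW–NE and a strand SE–NW, with one bar on each of the four ends and the strand SW–NE over (resp. under); (ii) no bars, and, stacked vertically, a virtual crossing of the two upper ends, one classical crossing, and a virtual crossing of the two lower ends, so that the strands again join SW to NE and SE to NW, with the strand SW–NE now under (resp. over) at the classical crossing. Two ordered diagrams are equivalent as twisted links if related by a finite sequence of isotopies of $\mathbb{R}^2$ and extended Reidemeister moves, respecting the numbering of components. **Semiarcs and colorings.** A semiarc of $D$ is an arc or loop obtained by dividing the components of $D$ at all classical crossings (both the over and the under strand are divided) and at all bars; virtual crossings do not divide. $\mathcal{A}(D_i)$ is the set of semiarcs on $D_i$. Write $\mathbb{Z}_n=\mathbb{Z}/n\mathbb{Z}$ for $n\ge0$ (so $\mathbb{Z}_0=\mathbb{Z}$). A twisted intersection coloring mod $n$ on $D_i$ is a map $C:\mathcal{A}(D_i)\to\mathbb{Z}_n\times\{\pm1\}$ such that, when one travels along $D_i$ in the direction of its orientation: (1) on passing through a classical crossing (on the over or the under strand, the other strand belonging to $D_i$ or to any other component), the value $(a,e)$ changes to $(a+1,e)$ if the other strand crosses from left to right, and to $(a-1,e)$ if it crosses from right to left; (2) on passing through a bar, $(a,e)$ changes to $(-a,-e)$. **Twisted defect.** Let $D_i$ be of even type. Fix one of the two assignments of signs $e\in\{\pm1\}$ to the semiarcs of $D_i$ that are unchanged at classical crossings and negated at bars. Let $S_{L,e}(D_i)$ (resp. $S_{R,e}(D_i)$) be the set of classical crossings on $D_i$ at which a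 strand of $D_i$ with sign $e$ is crossed by the other strand from left to right (resp. from right to left); a self-crossing of $D_i$ belongs to one set of each type. The $i$th twisted defect is $d_i(D)=|\#S_{L,+1}(D_i)-\#S_{L,-1}(D_i)-\#S_{R,+1}(D_i)+\#S_{R,-1}(D_i)|$, independent of the choice of signs. Equivalent diagrams with $i$th components of even type satisfy $d_i(D)=d_i(D')$, so the polynomials compared lie in the same ring. **Weights and index polynomials.** Let $C_i$ be a twisted intersection coloring mod $d_i(D)$ on $D_i$ (of even type) and $\tau$ a classical self-crossing of $D_i$. Rotate the picture so that both strands at $\tau$ point upwards, and consider the two semiarc ends on the left-hand side of $\tau$: one belongs to the over strand, the other to the under strand. Let $a$ be the first factor of the color of the one on the over strand and $b$ that of the one on the under strand. The weight is $W_{(D_i,C_i)}(\tau)=a-b\in\mathbb{Z}_{d_i(D)}$ (using the two right-hand ends gives the same value). The second factor of the color is constant along each strand at $\tau$. Let $T^{(D_i,C_i)}$ be the set of classical self-crossings of $D_i$ at which the second factors of the over and under strands are equal; $T_{+1}^{(D_i,C_i)}$ the set of those where the over strand has second factor $+1$ and the under strand $-1$; $T_{-1}^{(D_i,C_i)}$ the set of those where the over strand has $-1$ and the under strand $+1$. The index polynomials are the following elements of $\mathbb{Z}[t^{\pm1}]/(t^{d_i(D)}-1)$: $$\psi^{(D_i,C_i)}(t)=\sum_{\tau\in T^{(D_i,C_i)}}\mathrm{sign}(\tau)\bigl(t^{W_{(D_i,C_i)}(\tau)}-1\bigr),\qquad \psi_{\pm1}^{(D_i,C_i)}(t)=\sum_{\tau\in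 T_{\pm1}^{(D_i,C_i)}}\mathrm{sign}(\tau)\,t^{W_{(D_i,C_i)}(\tau)}.$$ **2-equivalence.** For $f_1,f_2,g_1,g_2\in\mathbb{Z}[t^{\pm1}]/(t^n-1)$, $n\ge0$, the pairs $(f_1,f_2)$ and $(g_1,g_2)$ are $2$-equivalent if, for some integer $k$, $(f_1,f_2)=(g_1t^{2k},g_2t^{-2k})$ or $(f_1,f_2)=(g_2t^{2k},g_1t^{-2k})$. *)

theory Defs
  imports "HOL-Analysis.Analysis" "HOL-Library.Poly_Mapping" "HOL-Number_Theory.Cong"
begin

section \<open>Twisted link diagrams\<close>

text \<open>
  The oriented plane is \<open>complex\<close>. Component \<open>i \<in> {1..ncomp D}\<close> is the closed
  curve \<open>crv D i\<close>, whose parameter circle is \<open>sphere 0 1\<close> with its counterclockwise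
  orientation; the values of \<open>crv D i\<close> off that circle are irrelevant. A point of the diagram
  on a given strand is a pair \<open>(i, z)\<close> of a component and a parameter, so a double point of the
  plane curve is a pair of such points. \<open>overs D\<close> consists of the points that lie on the over
  strand of a classical crossing; a double point neither of whose two points is in
  \<open>overs D\<close> is a virtual crossing.
\<close>

type_synonym pt = "nat \<times> complex"

record diagram =
  ncomp :: nat
  crv :: "nat \<Rightarrow> complex \<Rightarrow> complex"
  overs :: "pt set"
  bars :: "pt set"

definition points :: "diagram \<Rightarrow> pt set" where
  "points D = {1..ncomp D} \<times> sphere 0 1"

definition pos :: "diagram \<Rightarrow> pt \<Rightarrow> complex" where
  "pos D p = crv D (fst p) (snd p)"

definition vel :: "diagram \<Rightarrow> pt \<Rightarrow> complex" where
  "vel D p = vector_derivative (\<lambda>\<theta>. crv D (fst p) (snd p * cis \<theta>)) (at 0)"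

text \<open>The determinant of \<open>(u, v)\<close>: positive iff \<open>v\<close> points to the left of \<open>u\<close>.\<close>

definition det2 :: "complex \<Rightarrow> complex \<Rightarrow> real" where
  "det2 u v = Re u * Im v - Im u * Re v"

definition double :: "diagram \<Rightarrow> pt \<Rightarrow> pt \<Rightarrow> bool" where
  "double D p q \<longleftrightarrow> p \<in> points D \<and> q \<in> points D \<and> p \<noteq> q \<and> pos D p = pos D q"

definition classical :: "diagram \<Rightarrow> pt \<Rightarrow> pt \<Rightarrow> bool" where
  "classical D p q \<longleftrightarrow> double D p q \<and> (p \<in> overs D \<or> q \<in> overs D)"

definition immersed :: "diagram \<Rightarrow> bool" where
  "immersed D \<longleftrightarrow>
    (\<forall>i\<in>{1..ncomp D}.
      (\<forall>z\<in>sphere 0 1. (\<lambda>\<theta>. crv D i (z * cis \<theta>)) differentiable at 0 \<and> vel D (i, z) \<noteq> 0) \<and>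
      continuous_on (sphere 0 1) (\<lambda>z. vel D (i, z)))"

definition generic :: "diagram \<Rightarrow> bool" where
  "generic D \<longleftrightarrow>
    finite {(p, q). double D p q} \<and>
    (\<forall>p q. double D p q \<longrightarrow> det2 (vel D p) (vel D q) \<noteq> 0) \<and>
    (\<forall>p q r. double D p q \<and> double D p r \<longrightarrow> q = r)"

definition twisted_diagram :: "diagram \<Rightarrow> bool" where
  "twisted_diagram D \<longleftrightarrow>
    immersed D \<and> generic D \<and>
    overs D \<subseteq> {p. \<exists>q. double D p q \<and> q \<notin> overs D} \<and>
    finite (bars D) \<and> bars D \<subseteq> points D - {p. \<exists>q. double D p q}"

definition even_type :: "diagram \<Rightarrow> nat \<Rightarrow> bool" where
  "even_type D i \<longleftrightarrow> even (card {z. (i, z) \<in> bars D})"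


section \<open>Isotopies of the plane\<close>

definition plane_isotopy :: "(real \<Rightarrow> complex \<Rightarrow> complex) \<Rightarrow> bool" where
  "plane_isotopy H \<longleftrightarrow>
    H 0 = id \<and>
    continuous_on ({0..1} \<times> UNIV) (\<lambda>(t, z). H t z) \<and>
    (\<forall>t\<in>{0..1}. bij (H t)) \<and>
    (\<exists>H'. (\<forall>t\<in>{0..1}. \<forall>z. (H t has_derivative H' t z) (at z) \<and> inj (H' t z)) \<and>
      (\<forall>v. continuous_on ({0..1} \<times> UNIV) (\<lambda>(t, z). H' t z v)))"

text \<open>
  An oriented closed curve is unchanged by an orientation preserving reparametrization;
  \<open>\<phi> i\<close> is the lift to \<open>\<real>\<close> of such a reparametrization of the \<open>i\<close>th parameter circle.
\<close>

definition circle_reparam :: "(real \<Rightarrow> real) \<Rightarrow> bool" where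
  "circle_reparam \<phi> \<longleftrightarrow>
    (\<forall>\<theta>. \<phi> (\<theta> + 2 * pi) = \<phi> \<theta> + 2 * pi) \<and>
    (\<forall>\<theta>. \<exists>d>0. (\<phi> has_real_derivative d) (at \<theta>))"

definition isotopic :: "diagram \<Rightarrow> diagram \<Rightarrow> bool" where
  "isotopic D D' \<longleftrightarrow>
    ncomp D' = ncomp D \<and>
    (\<exists>H \<phi>. plane_isotopy H \<and>
      (\<forall>i\<in>{1..ncomp D}. circle_reparam (\<phi> i) \<and>
        (\<forall>\<theta>. crv D' i (cis \<theta>) = H 1 (crv D i (cis (\<phi> i \<theta>))) \<and>
          ((i, cis \<theta>) \<in> overs D' \<longleftrightarrow> (i, cis (\<phi> i \<theta>)) \<in> overs D) \<and>
          ((i, cis \<theta>) \<in> bars D' \<longleftrightarrow> (i, cis (\<phi> i \<theta>)) \<in> bars D))))"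


section \<open>Extended Reidemeister moves\<close>

text \<open>
  A move replaces one tangle by another in a disk. As isotopies of the plane are available
  separately, the disk is a fixed rectangle and the tangles are explicit. Each strand is
  parametrized by \<open>{-1..1}\<close>, starts on the left edge of the rectangle and ends on the right edge;
  the tangles of a move are parametrized with the same values and the same derivatives at
  \<open>-1\<close> and \<open>1\<close>, so that exchanging them keeps the components continuously differentiable.
  The pair \<open>(k, t)\<close> denotes the point with parameter \<open>t\<close> on strand \<open>k\<close>.
\<close>

record tangle =
  strands :: "(real \<Rightarrow> complex) list"
  tovers :: "(nat \<times> real) set"
  tbars :: "(nat \<times> real) set"

definition rect :: "complex set" where
  "rect = {w. \<bar>Re w\<bar> \<le> 1 \<and> \<bar>Im w\<bar> \<le> 2}"

text \<open>
  A strand is located on the diagram by a triple \<open>(i, \<alpha>, \<rho>)\<close>: it is the arc of component \<open>i\<close>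
  centred at angle \<open>\<alpha>\<close> with half-width \<open>\<bar>\<rho>\<bar>\<close>. The sign of \<open>\<rho>\<close> says whether the component runs
  along the strand from left to right or from right to left, so all orientations of the strands
  are covered.
\<close>

type_synonym location = "nat \<times> real \<times> real"

fun loc_pt :: "location \<Rightarrow> real \<Rightarrow> pt" where
  "loc_pt (i, \<alpha>, \<rho>) t = (i, cis (\<alpha> + \<rho> * t))"

fun valid_loc :: "diagram \<Rightarrow> location \<Rightarrow> bool" where
  "valid_loc D (i, \<alpha>, \<rho>) \<longleftrightarrow> i \<in> {1..ncomp D} \<and> 0 < \<bar>\<rho>\<bar> \<and> \<bar>\<rho>\<bar> < pi"

definition inside :: "location list \<Rightarrow> pt set" where
  "inside L = {loc_pt (L ! k) t |k t. k < length L \<and> t \<in> {-1..1}}"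

definition contains_tangle :: "diagram \<Rightarrow> tangle \<Rightarrow> location list \<Rightarrow> bool" where
  "contains_tangle D T L \<longleftrightarrow>
    length L = length (strands T) \<and>
    (\<forall>l\<in>set L. valid_loc D l) \<and>
    inj_on (\<lambda>(k, t). loc_pt (L ! k) t) ({..<length L} \<times> {-1..1}) \<and>
    (\<forall>k<length L. \<forall>t\<in>{-1..1}.
      pos D (loc_pt (L ! k) t) = (strands T ! k) t \<and>
      (loc_pt (L ! k) t \<in> overs D \<longleftrightarrow> (k, t) \<in> tovers T) \<and>
      (loc_pt (L ! k) t \<in> bars D \<longleftrightarrow> (k, t) \<in> tbars T)) \<and>
    (\<forall>p\<in>points D - inside L. pos D p \<notin> rect)"

definition replaces :: "tangle \<Rightarrow> tangle \<Rightarrow> diagram \<Rightarrow> diagram \<Rightarrow> bool" where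
  "replaces T T' D D' \<longleftrightarrow>
    ncomp D' = ncomp D \<and>
    (\<exists>L. contains_tangle D T L \<and> contains_tangle D' T' L \<and>
      (\<forall>p\<in>points D - inside L. pos D' p = pos D p \<and>
        (p \<in> overs D' \<longleftrightarrow> p \<in> overs D) \<and> (p \<in> bars D' \<longleftrightarrow> p \<in> bars D)))"

text \<open>
  The function \<open>bump\<close> vanishes to second order at \<open>-1\<close> and \<open>1\<close>, and \<open>bump (1/2) = 9/16\<close>. The
  function \<open>wave\<close> agrees to first order with the identity at \<open>-1\<close> and \<open>1\<close>, and has on \<open>{-1..1}\<close>
  the simple zeros \<open>-1/2\<close>, \<open>0\<close>, \<open>1/2\<close>, with \<open>wave t < 0\<close> for \<open>0 < t < 1/2\<close>.
\<close>

definition bump :: "real \<Rightarrow> real" where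
  "bump t = (1 - t\<^sup>2)\<^sup>2"

definition wave :: "real \<Rightarrow> real" where
  "wave t = t - 16 / 9 * t * bump t"

definition straight :: "real \<Rightarrow> complex" where
  "straight t = Complex t 0"

text \<open>The loop lies to the left or right of the strand according to the sign \<open>\<sigma>\<close>;
  its double point has the parameters \<open>-1/2\<close> and \<open>1/2\<close>.\<close>

definition kink :: "real \<Rightarrow> real \<Rightarrow> complex" where
  "kink \<sigma> t = Complex (wave t) (\<sigma> * bump t)"

text \<open>The second strand dips below the first one between the parameters \<open>-1/2\<close> and \<open>1/2\<close>.\<close>

definition parallel2 :: "(real \<Rightarrow> complex) list" where
  "parallel2 = [straight, \<lambda>t. Complex t (9 / 16)]"

definition bigon2 :: "(real \<Rightarrow> complex) list" where
  "bigon2 = [straight, \<lambda>t. Complex t (9 / 16 - bump t)]"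

definition cross2 :: "(real \<Rightarrow> complex) list" where
  "cross2 = [\<lambda>t. Complex t t, \<lambda>t. Complex t (- t)]"

text \<open>Strands \<open>0\<close> and \<open>1\<close> cross at the origin; strand \<open>2\<close> crosses each of them once and passes
  above (\<open>\<sigma> = 1\<close>) or below (\<open>\<sigma> = -1\<close>) the origin.\<close>

definition triple3 :: "real \<Rightarrow> (real \<Rightarrow> complex) list" where
  "triple3 \<sigma> = [\<lambda>t. Complex t t, \<lambda>t. Complex t (- t), \<lambda>t. Complex t (\<sigma> * (8 / 9) * bump t)]"

text \<open>The over points of \<open>triple3 \<sigma>\<close> when strand \<open>k\<close> has height \<open>h k\<close>.\<close>

definition height_overs :: "(nat \<Rightarrow> nat) \<Rightarrow> real \<Rightarrow> (nat \<times> real) set" where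
  "height_overs h \<sigma> = {(k, t). k < 3 \<and> t \<in> {-1..1} \<and>
    (\<exists>l<3. h l < h k \<and> (triple3 \<sigma> ! l) t = (triple3 \<sigma> ! k) t)}"

text \<open>The crossings at \<open>-1/2\<close> and \<open>1/2\<close> will be virtual, the one at \<open>0\<close> classical.\<close>

definition braid2 :: "(real \<Rightarrow> complex) list" where
  "braid2 = [\<lambda>t. Complex t (wave t), \<lambda>t. Complex t (- wave t)]"

text \<open>
  In \<open>T3\<close> the usual pictures are turned by a quarter: the two virtual crossings are those of the
  two left and of the two right ends.
\<close>

inductive ext_move :: "tangle \<Rightarrow> tangle \<Rightarrow> bool" where
  R1: "\<sigma> \<in> {1, -1} \<Longrightarrow> s \<in> {1/2, -1/2} \<Longrightarrow>
    ext_move \<lparr>strands = [straight], tovers = {}, tbars = {}\<rparr>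
             \<lparr>strands = [kink \<sigma>], tovers = {(0, s)}, tbars = {}\<rparr>"
| R2: "k \<in> {0, 1} \<Longrightarrow>
    ext_move \<lparr>strands = parallel2, tovers = {}, tbars = {}\<rparr>
             \<lparr>strands = bigon2, tovers = {(k, -1/2), (k, 1/2)}, tbars = {}\<rparr>"
| R3: "inj_on h {..<3} \<Longrightarrow>
    ext_move \<lparr>strands = triple3 1, tovers = height_overs h 1, tbars = {}\<rparr>
             \<lparr>strands = triple3 (-1), tovers = height_overs h (-1), tbars = {}\<rparr>"
| V1: "\<sigma> \<in> {1, -1} \<Longrightarrow>
    ext_move \<lparr>strands = [straight], tovers = {}, tbars = {}\<rparr>
             \<lparr>strands = [kink \<sigma>], tovers = {}, tbars = {}\<rparr>"
| V2:
   "ext_move \<lparr>strands = parallel2, tovers = {}, tbars = {}\<rparr>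
             \<lparr>strands = bigon2, tovers = {}, tbars = {}\<rparr>"
| V3:
   "ext_move \<lparr>strands = triple3 1, tovers = {}, tbars = {}\<rparr>
             \<lparr>strands = triple3 (-1), tovers = {}, tbars = {}\<rparr>"
| V4: "k \<in> {0, 1} \<Longrightarrow>
    ext_move \<lparr>strands = triple3 1, tovers = {(k, 0)}, tbars = {}\<rparr>
             \<lparr>strands = triple3 (-1), tovers = {(k, 0)}, tbars = {}\<rparr>"
| T1:
   "ext_move \<lparr>strands = cross2, tovers = {}, tbars = {(0, -1/2)}\<rparr>
             \<lparr>strands = cross2, tovers = {}, tbars = {(0, 1/2)}\<rparr>"
| T2:
   "ext_move \<lparr>strands = [straight], tovers = {}, tbars = {(0, -1/2), (0, 1/2)}\<rparr>
             \<lparr>strands = [straight], tovers = {}, tbars = {}\<rparr>"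
| T3: "k \<in> {0, 1} \<Longrightarrow>
    ext_move \<lparr>strands = cross2, tovers = {(k, 0)},
               tbars = {(0, -1/2), (0, 1/2), (1, -1/2), (1, 1/2)}\<rparr>
             \<lparr>strands = braid2, tovers = {(1 - k, 0)}, tbars = {}\<rparr>"

definition twisted_step :: "diagram \<Rightarrow> diagram \<Rightarrow> bool" where
  "twisted_step D D' \<longleftrightarrow>
    twisted_diagram D \<and> twisted_diagram D' \<and>
    (isotopic D D' \<or> (\<exists>T T'. ext_move T T' \<and> replaces T T' D D'))"

definition twisted_equivalent :: "diagram \<Rightarrow> diagram \<Rightarrow> bool" where
  "twisted_equivalent = equivclp twisted_step"


section \<open>Semiarcs and colorings\<close>

definition cuts :: "diagram \<Rightarrow> nat \<Rightarrow> complex set" where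
  "cuts D i = {z. (\<exists>q. classical D (i, z) q) \<or> (i, z) \<in> bars D}"

text \<open>Semiarcs are taken in the parameter circle, as sets of parameters.\<close>

definition semiarcs :: "diagram \<Rightarrow> nat \<Rightarrow> complex set set" where
  "semiarcs D i = components (sphere 0 1 - cuts D i)"

text \<open>The semiarcs on which one arrives at, and leaves, a point of the diagram.\<close>

definition arc_in :: "diagram \<Rightarrow> pt \<Rightarrow> complex set" where
  "arc_in D p = (THE A. A \<in> semiarcs D (fst p) \<and>
    (\<forall>\<^sub>F \<epsilon> in at_right 0. snd p * cis (- \<epsilon>) \<in> A))"

definition arc_out :: "diagram \<Rightarrow> pt \<Rightarrow> complex set" where
  "arc_out D p = (THE A. A \<in> semiarcs D (fst p) \<and>
    (\<forall>\<^sub>F \<epsilon> in at_right 0. snd p * cis \<epsilon> \<in> A))"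

text \<open>The strand of \<open>q\<close> crosses the strand of \<open>p\<close> from its left to its right, or from its right
  to its left.\<close>

definition crosses_left_to_right :: "diagram \<Rightarrow> pt \<Rightarrow> pt \<Rightarrow> bool" where
  "crosses_left_to_right D q p \<longleftrightarrow> det2 (vel D p) (vel D q) < 0"

definition crosses_right_to_left :: "diagram \<Rightarrow> pt \<Rightarrow> pt \<Rightarrow> bool" where
  "crosses_right_to_left D q p \<longleftrightarrow> det2 (vel D p) (vel D q) > 0"

text \<open>
  Elements of \<open>\<int>/n\<int>\<close> are represented by integers; congruence modulo \<open>0\<close> is equality.
\<close>

type_synonym coloring = "complex set \<Rightarrow> int \<times> int"

definition twisted_coloring :: "nat \<Rightarrow> diagram \<Rightarrow> nat \<Rightarrow> coloring \<Rightarrow> bool" where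
  "twisted_coloring n D i C \<longleftrightarrow>
    (\<forall>A\<in>semiarcs D i. snd (C A) \<in> {1, -1}) \<and>
    (\<forall>z q. classical D (i, z) q \<longrightarrow>
      snd (C (arc_out D (i, z))) = snd (C (arc_in D (i, z))) \<and>
      (crosses_left_to_right D q (i, z) \<longrightarrow>
        [fst (C (arc_out D (i, z))) = fst (C (arc_in D (i, z))) + 1] (mod int n)) \<and>
      (crosses_right_to_left D q (i, z) \<longrightarrow>
        [fst (C (arc_out D (i, z))) = fst (C (arc_in D (i, z))) - 1] (mod int n))) \<and>
    (\<forall>z. (i, z) \<in> bars D \<longrightarrow>
      snd (C (arc_out D (i, z))) = - snd (C (arc_in D (i, z))) \<and>
      [fst (C (arc_out D (i, z))) = - fst (C (arc_in D (i, z)))] (mod int n))"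


section \<open>The twisted defect\<close>

definition sign_assignment :: "diagram \<Rightarrow> nat \<Rightarrow> (complex set \<Rightarrow> int) \<Rightarrow> bool" where
  "sign_assignment D i e \<longleftrightarrow>
    (\<forall>A\<in>semiarcs D i. e A \<in> {1, -1}) \<and>
    (\<forall>z q. classical D (i, z) q \<longrightarrow> e (arc_out D (i, z)) = e (arc_in D (i, z))) \<and>
    (\<forall>z. (i, z) \<in> bars D \<longrightarrow> e (arc_out D (i, z)) = - e (arc_in D (i, z)))"

text \<open>A classical crossing is represented by the pair of its over and its under point.\<close>

definition crossings :: "diagram \<Rightarrow> (pt \<times> pt) set" where
  "crossings D = {(p, q). double D p q \<and> p \<in> overs D}"

definition S_L :: "diagram \<Rightarrow> nat \<Rightarrow> (complex set \<Rightarrow> int) \<Rightarrow> int \<Rightarrow> (pt \<times> pt) set" where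
  "S_L D i e s = {(p, q) \<in> crossings D.
    (fst p = i \<and> e (arc_in D p) = s \<and> crosses_left_to_right D q p) \<or>
    (fst q = i \<and> e (arc_in D q) = s \<and> crosses_left_to_right D p q)}"

definition S_R :: "diagram \<Rightarrow> nat \<Rightarrow> (complex set \<Rightarrow> int) \<Rightarrow> int \<Rightarrow> (pt \<times> pt) set" where
  "S_R D i e s = {(p, q) \<in> crossings D.
    (fst p = i \<and> e (arc_in D p) = s \<and> crosses_right_to_left D q p) \<or>
    (fst q = i \<and> e (arc_in D q) = s \<and> crosses_right_to_left D p q)}"

text \<open>The value does not depend on which of the two sign assignments is chosen.\<close>

definition twisted_defect :: "diagram \<Rightarrow> nat \<Rightarrow> nat" where
  "twisted_defect D i = (let e = (SOME e. sign_assignment D i e) in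
    nat \<bar>int (card (S_L D i e 1)) - int (card (S_L D i e (-1)))
       - int (card (S_R D i e 1)) + int (card (S_R D i e (-1)))\<bar>)"


section \<open>Laurent polynomials modulo \<open>t\<^sup>n - 1\<close>\<close>

type_synonym laurent = "(int, int) poly_mapping"

definition tpow :: "int \<Rightarrow> laurent" where
  "tpow k = Poly_Mapping.single k 1"

text \<open>An element of the quotient ring is a residue class, that is, a set of Laurent polynomials.\<close>

definition residue_class :: "nat \<Rightarrow> laurent \<Rightarrow> laurent set" where
  "residue_class n f = {g. tpow (int n) - 1 dvd g - f}"

text \<open>As \<open>tpow k\<close> is a unit, this maps a residue class to a residue class.\<close>

definition times_tpow :: "laurent set \<Rightarrow> int \<Rightarrow> laurent set" where
  "times_tpow F k = (\<lambda>f. f * tpow k) ` F"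

definition two_equivalent :: "laurent set \<times> laurent set \<Rightarrow> laurent set \<times> laurent set \<Rightarrow> bool" where
  "two_equivalent F G \<longleftrightarrow> (\<exists>k.
    F = (times_tpow (fst G) (2 * k), times_tpow (snd G) (- 2 * k)) \<or>
    F = (times_tpow (snd G) (2 * k), times_tpow (fst G) (- 2 * k)))"


section \<open>Index polynomials\<close>

text \<open>
  When the strands of the points \<open>p\<close> and \<open>q\<close> of a crossing point upwards, the left-hand end at
  \<open>p\<close> is the incoming one iff the strand of \<open>p\<close> runs from bottom left to top right, that is, iff
  the strand of \<open>q\<close> crosses it from right to left.
\<close>

definition left_arc :: "diagram \<Rightarrow> pt \<Rightarrow> pt \<Rightarrow> complex set" where
  "left_arc D p q = (if crosses_right_to_left D q p then arc_in D p else arc_out D p)"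

definition crossing_sign :: "diagram \<Rightarrow> pt \<times> pt \<Rightarrow> int" where
  "crossing_sign D = (\<lambda>(p, q). if det2 (vel D p) (vel D q) > 0 then 1 else -1)"

definition self_crossings :: "diagram \<Rightarrow> nat \<Rightarrow> (pt \<times> pt) set" where
  "self_crossings D i = {(p, q) \<in> crossings D. fst p = i \<and> fst q = i}"

definition over_color :: "diagram \<Rightarrow> coloring \<Rightarrow> pt \<times> pt \<Rightarrow> int \<times> int" where
  "over_color D C = (\<lambda>(p, q). C (left_arc D p q))"

definition under_color :: "diagram \<Rightarrow> coloring \<Rightarrow> pt \<times> pt \<Rightarrow> int \<times> int" where
  "under_color D C = (\<lambda>(p, q). C (left_arc D q p))"

definition weight :: "diagram \<Rightarrow> coloring \<Rightarrow> pt \<times> pt \<Rightarrow> int" where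
  "weight D C \<tau> = fst (over_color D C \<tau>) - fst (under_color D C \<tau>)"

definition T_same :: "diagram \<Rightarrow> nat \<Rightarrow> coloring \<Rightarrow> (pt \<times> pt) set" where
  "T_same D i C = {\<tau> \<in> self_crossings D i. snd (over_color D C \<tau>) = snd (under_color D C \<tau>)}"

definition T_signed :: "int \<Rightarrow> diagram \<Rightarrow> nat \<Rightarrow> coloring \<Rightarrow> (pt \<times> pt) set" where
  "T_signed s D i C =
    {\<tau> \<in> self_crossings D i. snd (over_color D C \<tau>) = s \<and> snd (under_color D C \<tau>) = - s}"

definition index_poly :: "diagram \<Rightarrow> nat \<Rightarrow> coloring \<Rightarrow> laurent set" where
  "index_poly D i C = residue_class (twisted_defect D i)
    (\<Sum>\<tau>\<in>T_same D i C. of_int (crossing_sign D \<tau>) * (tpow (weight D C \<tau>) - 1))"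

definition signed_index_poly :: "int \<Rightarrow> diagram \<Rightarrow> nat \<Rightarrow> coloring \<Rightarrow> laurent set" where
  "signed_index_poly s D i C = residue_class (twisted_defect D i)
    (\<Sum>\<tau>\<in>T_signed s D i C. of_int (crossing_sign D \<tau>) * tpow (weight D C \<tau>))"

end

(*
  Write a coloring of a component as a function z -> (a, e) on its parameter circle with one-sided
  limits at every point. The product a * e is locally constant except for a jump at each classical
  crossing, so two colorings of the same component differ by (a, e) -> (a + k e, +-e); this changes
  the weights at crossings of type T by 0 and those of type T_{+1}, T_{-1} by 2k, -2k, up to
  exchanging the two types, which is 2-equivalence.

  A move changes the diagram only inside a rectangle. Along each strand of the tangle the coloring is
  determined by its value (a, e) at the left end, namely a becomes sigma (a + S), where sigma is the
  parity of the bars passed and S is a signed count of the crossings passed. Hence a coloring of one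
  diagram extends over the other tangle as soon as sigma and S agree at the right ends of the strands,
  and the polynomials agree if the contributions of the crossings inside the two tangles do. Both
  are finite computations for each of the moves.
*)
theory Submission
  imports Defs
begin

section \<open>Colors as one-sided germs on the parameter circle\<close>

text \<open>The obstacle is that a coloring is a function on sets of semiarcs, and a cut that
  appears or disappears in the rectangle alters semiarcs reaching far outside it. As functions of
  the parameter, with separate values on arrival and departure, colorings can be altered inside the
  rectangle alone. Transported colorings are never turned back into functions on semiarcs: the
  coloring of D travels as a pair of germs, and the last comparison is between two such pairs on D'.

  The modulus is itself an invariant of the diagram. It stays equal to the defect of D along the
  whole chain of moves, while the signed defect sum is transported as well and identifies the two
  defects at the end.

  The three polynomials are treated at once through a function \<phi> of the weight and the two
  second factors. The moves use only that \<phi> depends on the weight mod n, vanishes for weight 0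
  with equal signs, and is unchanged when two equal signs are negated together.

  Residues are represented by integers, so colors glued at the edge of the rectangle agree only up
  to congruence, whereas germs ask for equality; hence the reduction mod n of the glued
  coloring.\<close>

lemma locally_const_imp_const:
  fixes f :: "real \<Rightarrow> 'a"
  assumes "connected S" and "\<And>t. t \<in> S \<Longrightarrow> \<forall>\<^sub>F x in nhds t. f x = f t"
    and "a \<in> S" "b \<in> S"
  shows "f a = f b"
proof -
  have "f constant_on S"
  proof (rule locally_constant_imp_constant[OF assms(1)])
    fix t assume t: "t \<in> S"
    obtain U where U: "open U" "t \<in> U" "\<And>x. x \<in> U \<Longrightarrow> f x = f t"
      using assms(2)[OF t] unfolding eventually_nhds by blast
    show "\<exists>T. openin (top_of_set S) T \<and> t \<in> T \<and> (\<forall>x\<in>T. f x = f t)"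
      using U t openin_open_Int[OF U(1), of S] by blast
  qed
  then show ?thesis using assms(3,4) by (auto simp: constant_on_def)
qed

lemma eventually_nhds_split:
  fixes t :: real
  shows "eventually P (nhds t) \<longleftrightarrow> eventually P (at_left t) \<and> eventually P (at_right t) \<and> P t"
  by (auto simp: eventually_nhds_conv_at eventually_at_split)

lemma sphere_cis: "z \<in> sphere 0 1 \<longleftrightarrow> (\<exists>\<theta>. z = cis \<theta>)"
  by (metis dist_0_norm mem_sphere norm_cis cis_Arg sgn_div_norm norm_one div_by_1 scaleR_one inverse_1 norm_zero zero_neq_one)

lemma sphere_cisE:
  assumes "z \<in> sphere 0 1" obtains \<theta> where "z = cis \<theta>"
  using assms unfolding sphere_cis by blast

lemma cis_eq_iff: "cis a = cis b \<longleftrightarrow> (\<exists>k::int. a = b + 2 * pi * k)"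
  using sin_cos_eq_iff[of a b] by (auto simp: complex_eq_iff)

lemma cis_inj_close:
  assumes "cis a = cis b" "\<bar>a - b\<bar> < 2 * pi" shows "a = b"
proof -
  obtain k :: int where k: "a = b + 2 * pi * k" using assms(1) unfolding cis_eq_iff by blast
  then have "2 * pi * \<bar>real_of_int k\<bar> < 2 * pi * 1" using assms(2) by (simp add: abs_mult)
  then have "\<bar>real_of_int k\<bar> < 1" using mult_less_cancel_left_pos[of "2 * pi"] pi_gt_zero by simp
  then show ?thesis using k by simp
qed

text \<open>At a point \<open>z\<close> of the parameter circle, \<open>l z\<close> and \<open>r z\<close> are the values on arrival and on
  departure.\<close>

definition germs :: "complex set \<Rightarrow> (complex \<Rightarrow> 'a) \<Rightarrow> (complex \<Rightarrow> 'a) \<Rightarrow> bool" where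
  "germs X l r \<longleftrightarrow> (\<forall>\<theta>.
    (\<forall>\<^sub>F x in at_right \<theta>. l (cis x) = r (cis \<theta>) \<and> r (cis x) = r (cis \<theta>)) \<and>
    (\<forall>\<^sub>F x in at_left \<theta>. l (cis x) = l (cis \<theta>) \<and> r (cis x) = l (cis \<theta>)) \<and>
    (cis \<theta> \<notin> X \<longrightarrow> l (cis \<theta>) = r (cis \<theta>)))"

lemma germsD:
  assumes "germs X l r"
  shows "\<forall>\<^sub>F x in at_right \<theta>. l (cis x) = r (cis \<theta>) \<and> r (cis x) = r (cis \<theta>)"
    and "\<forall>\<^sub>F x in at_left \<theta>. l (cis x) = l (cis \<theta>) \<and> r (cis x) = l (cis \<theta>)"
    and "cis \<theta> \<notin> X \<Longrightarrow> l (cis \<theta>) = r (cis \<theta>)"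
  using assms unfolding germs_def by blast+

text \<open>Invariants built from two colorings, such as the product of their signs, are again
  germs, so that \<open>germs_const\<close> can be applied to them.\<close>

lemma germs_compose:
  assumes "germs X l r" "germs X l2 r2"
  shows "germs X (\<lambda>z. f (l z) (l2 z)) (\<lambda>z. f (r z) (r2 z))"
  unfolding germs_def
proof (intro allI conjI impI)
  fix \<theta>
  show "\<forall>\<^sub>F x in at_right \<theta>. f (l (cis x)) (l2 (cis x)) = f (r (cis \<theta>)) (r2 (cis \<theta>)) \<and>
      f (r (cis x)) (r2 (cis x)) = f (r (cis \<theta>)) (r2 (cis \<theta>))"
    using germsD(1)[OF assms(1), of \<theta>] germsD(1)[OF assms(2), of \<theta>] by eventually_elim simp
  show "\<forall>\<^sub>F x in at_left \<theta>. f (l (cis x)) (l2 (cis x)) = f (l (cis \<theta>)) (l2 (cis \<theta>)) \<and>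
      f (r (cis x)) (r2 (cis x)) = f (l (cis \<theta>)) (l2 (cis \<theta>))"
    using germsD(2)[OF assms(1), of \<theta>] germsD(2)[OF assms(2), of \<theta>] by eventually_elim simp
  show "f (l (cis \<theta>)) (l2 (cis \<theta>)) = f (r (cis \<theta>)) (r2 (cis \<theta>))" if "cis \<theta> \<notin> X"
    using germsD(3)[OF assms(1) that] germsD(3)[OF assms(2) that] by simp
qed

text \<open>If arrival and departure agree everywhere, the one-sided conditions say that the
  function of the angle is locally constant, and the line of angles is connected.\<close>

lemma germs_const:
  assumes "germs X l r" and "\<And>\<theta>. l (cis \<theta>) = r (cis \<theta>)"
  shows "l (cis a) = l (cis b)"
proof (rule locally_const_imp_const[of UNIV "\<lambda>x. l (cis x)"])
  fix t :: real
  show "\<forall>\<^sub>F x in nhds t. l (cis x) = l (cis t)"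
    unfolding eventually_nhds_split using germsD(1,2)[OF assms(1), of t] assms(2)[of t]
    by (auto elim: eventually_mono)
qed auto

section \<open>Semiarcs as one-sided limits on the cut parameter circle\<close>

lemma crossed_finite:
  assumes "twisted_diagram D" shows "finite {(p, q). double D p q}" "finite {(p, q). classical D p q}"
proof -
  show "finite {(p, q). double D p q}" using assms by (auto simp: twisted_diagram_def generic_def)
  then show "finite {(p, q). classical D p q}"
    by (rule finite_subset[rotated]) (auto simp: classical_def)
qed

lemma finite_cuts:
  assumes "twisted_diagram D" shows "finite (cuts D i)"
proof -
  have "cuts D i \<subseteq> snd ` fst ` {(p, q). classical D p q} \<union> snd ` bars D"
    unfolding cuts_def by force
  moreover have "finite (bars D)" using assms by (auto simp: twisted_diagram_def)
  ultimately show ?thesis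
    using crossed_finite(2)[OF assms] by (meson finite_Un finite_imageI finite_subset)
qed

text \<open>A point other than the base point is avoided by continuity, the base point itself by
  injectivity of \<open>cis\<close> on less than a full turn. The sign of s selects departure or
  arrival.\<close>

lemma cis_avoids_finite:
  assumes "finite X" "s \<noteq> 0"
  shows "\<forall>\<^sub>F \<epsilon> in at_right 0. cis (\<theta> + s * \<epsilon>) \<notin> X"
proof -
  have "\<forall>\<^sub>F \<epsilon> in at_right 0. cis (\<theta> + s * \<epsilon>) \<noteq> w" for w
  proof (cases "cis \<theta> = w")
    case False
    have "((\<lambda>\<epsilon>. cis (\<theta> + s * \<epsilon>)) \<longlongrightarrow> cis (\<theta> + s * 0)) (at_right 0)"
      by (intro tendsto_intros)
    from tendsto_imp_eventually_ne[OF this, of w] False show ?thesis by simp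
  next
    case True
    have "\<forall>\<^sub>F \<epsilon> in at_right 0. \<epsilon> \<in> {0<..<2 * pi / \<bar>s\<bar>}"
      by (rule eventually_at_right_real) (use assms(2) in auto)
    then show ?thesis
    proof eventually_elim
      case (elim \<epsilon>)
      then have "\<bar>s * \<epsilon>\<bar> < 2 * pi" "s * \<epsilon> \<noteq> 0" using assms(2) by (auto simp: abs_mult field_simps)
      then show ?case using cis_inj_close[of "\<theta> + s * \<epsilon>" \<theta>] True by auto
    qed
  qed
  then have "\<forall>\<^sub>F \<epsilon> in at_right 0. \<forall>w\<in>X. cis (\<theta> + s * \<epsilon>) \<noteq> w"
    using assms(1) by (intro eventually_ball_finite) auto
  then show ?thesis by (rule eventually_mono) auto
qed

text \<open>At an uncut parameter this is the semiarc through it. It replaces the definite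
  descriptions in \<open>arc_in\<close> and \<open>arc_out\<close>.\<close>

definition component_at :: "diagram \<Rightarrow> nat \<Rightarrow> complex \<Rightarrow> complex set" where
  "component_at D i z = connected_component_set (sphere 0 1 - cuts D i) z"

lemma component_at_eq:
  fixes I :: "real set"
  assumes "connected I" "\<And>y. y \<in> I \<Longrightarrow> cis (\<theta> + s * y) \<notin> cuts D i" "x \<in> I" "y \<in> I"
  shows "component_at D i (cis (\<theta> + s * x)) = component_at D i (cis (\<theta> + s * y))"
proof -
  have "connected ((\<lambda>y. cis (\<theta> + s * y)) ` I)"
    by (intro connected_continuous_image continuous_intros assms(1))
  moreover have "(\<lambda>y. cis (\<theta> + s * y)) ` I \<subseteq> sphere 0 1 - cuts D i" using assms(2) by auto
  ultimately have "connected_component (sphere 0 1 - cuts D i) (cis (\<theta> + s * x)) (cis (\<theta> + s * y))"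
    using assms(3,4) unfolding connected_component_def by blast
  then show ?thesis
    unfolding component_at_def by (rule connected_component_eq[unfolded mem_Collect_eq, THEN sym, rotated -1])
qed

lemma component_at_semiarc:
  assumes "cis x \<notin> cuts D i" 
  shows "component_at D i (cis x) \<in> semiarcs D i" "cis x \<in> component_at D i (cis x)"
  using assms by (auto simp: semiarcs_def component_at_def components_def connected_component_refl)

lemma component_at_unique:
  assumes "A \<in> semiarcs D i" "z \<in> A" shows "A = component_at D i z"
  using assms unfolding semiarcs_def component_at_def components_def
  by (smt (verit, ccfv_threshold) connected_component_eq imageE)

text \<open>This resolves the definite descriptions: a short cut-free interval on one side is
  connected, hence contained in one semiarc, and two semiarcs that both contain points close to the
  base point on that side share a point and coincide.\<close>

lemma semiarc_side:
  assumes "twisted_diagram D" "s \<noteq> 0"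
  shows "\<forall>\<^sub>F \<epsilon> in at_right 0. cis (\<theta> + s * \<epsilon>) \<notin> cuts D i \<and>
    component_at D i (cis (\<theta> + s * \<epsilon>)) =
      (THE A. A \<in> semiarcs D i \<and> (\<forall>\<^sub>F \<epsilon> in at_right 0. cis \<theta> * cis (s * \<epsilon>) \<in> A))"
proof -
  obtain d where d: "d > 0" "\<And>\<epsilon>. 0 < \<epsilon> \<Longrightarrow> \<epsilon> < d \<Longrightarrow> cis (\<theta> + s * \<epsilon>) \<notin> cuts D i"
    using cis_avoids_finite[OF finite_cuts[OF assms(1)] assms(2)]
    unfolding eventually_at_right_field by (metis)
  define A where "A = component_at D i (cis (\<theta> + s * (d / 2)))"
  have A: "component_at D i (cis (\<theta> + s * \<epsilon>)) = A" if "0 < \<epsilon>" "\<epsilon> < d" for \<epsilon>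
    unfolding A_def by (rule component_at_eq[of "{0<..<d}"]) (use that d in auto)
  have ev: "\<forall>\<^sub>F \<epsilon> in at_right 0. 0 < \<epsilon> \<and> \<epsilon> < d"
    using eventually_at_right_real[OF d(1)] by (simp add: conj_commute)
  have "(THE A. A \<in> semiarcs D i \<and> (\<forall>\<^sub>F \<epsilon> in at_right 0. cis \<theta> * cis (s * \<epsilon>) \<in> A)) = A"
  proof (rule the_equality, intro conjI)
    show "A \<in> semiarcs D i" unfolding A_def by (rule component_at_semiarc) (use d(1) d(2)[of "d / 2"] in auto)
    show "\<forall>\<^sub>F \<epsilon> in at_right 0. cis \<theta> * cis (s * \<epsilon>) \<in> A"
      using ev by eventually_elim (metis A d(2) component_at_semiarc(2) cis_mult)
  next
    fix B assume B: "B \<in> semiarcs D i \<and> (\<forall>\<^sub>F \<epsilon> in at_right 0. cis \<theta> * cis (s * \<epsilon>) \<in> B)"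
    then have "\<forall>\<^sub>F \<epsilon> in at_right 0. cis \<theta> * cis (s * \<epsilon>) \<in> B \<and> 0 < \<epsilon> \<and> \<epsilon> < d"
      using ev by (auto elim: eventually_elim2)
    from eventually_happens[OF this] obtain \<epsilon> where "cis \<theta> * cis (s * \<epsilon>) \<in> B" "0 < \<epsilon>" "\<epsilon> < d"
      by auto
    then show "B = A" using component_at_unique[of B D i] B A by (metis cis_mult)
  qed
  with ev show ?thesis by (auto elim!: eventually_mono simp: A d(2))
qed

text \<open>The factor 1 keeps the shape \<theta> + s * \<epsilon> of \<open>semiarc_side\<close>,
  which covers both directions.\<close>

lemma at_right_shift:
  "eventually P (at_right \<theta>) \<longleftrightarrow> (\<forall>\<^sub>F \<epsilon> in at_right 0. P (\<theta> + 1 * \<epsilon>))" for \<theta> :: real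
proof -
  have "at_right \<theta> = filtermap (\<lambda>\<epsilon>. \<theta> + 1 * \<epsilon>) (at_right 0)"
    by (subst at_right_to_0) (simp add: add.commute)
  then show ?thesis by (metis eventually_filtermap)
qed

lemma at_left_shift:
  "eventually P (at_left \<theta>) \<longleftrightarrow> (\<forall>\<^sub>F \<epsilon> in at_right 0. P (\<theta> + (-1) * \<epsilon>))" for \<theta> :: real
proof -
  have "at_left \<theta> = filtermap uminus (filtermap (\<lambda>\<epsilon>. \<epsilon> + - \<theta>) (at_right 0))"
    unfolding at_left_minus[of \<theta>] by (rule arg_cong[OF at_right_to_0])
  also have "\<dots> = filtermap (\<lambda>\<epsilon>. \<theta> + (-1) * \<epsilon>) (at_right 0)"
    unfolding filtermap_filtermap by (rule arg_cong[of _ _ "\<lambda>f. filtermap f _"]) auto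
  finally show ?thesis by (metis eventually_filtermap)
qed

lemma arc_out_germ:
  assumes "twisted_diagram D"
  shows "\<forall>\<^sub>F x in at_right \<theta>. cis x \<notin> cuts D i \<and> component_at D i (cis x) = arc_out D (i, cis \<theta>)"
proof (rule at_right_shift[THEN iffD2])
  show "\<forall>\<^sub>F \<epsilon> in at_right 0. cis (\<theta> + 1 * \<epsilon>) \<notin> cuts D i \<and>
      component_at D i (cis (\<theta> + 1 * \<epsilon>)) = arc_out D (i, cis \<theta>)"
    using semiarc_side[OF assms, of 1 \<theta> i] by (simp add: arc_out_def)
qed

lemma arc_in_germ:
  assumes "twisted_diagram D"
  shows "\<forall>\<^sub>F x in at_left \<theta>. cis x \<notin> cuts D i \<and> component_at D i (cis x) = arc_in D (i, cis \<theta>)"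
proof (rule at_left_shift[THEN iffD2])
  show "\<forall>\<^sub>F \<epsilon> in at_right 0. cis (\<theta> + (-1) * \<epsilon>) \<notin> cuts D i \<and>
      component_at D i (cis (\<theta> + (-1) * \<epsilon>)) = arc_in D (i, cis \<theta>)"
    using semiarc_side[OF assms, of "-1" \<theta> i] by (simp add: arc_in_def)
qed

lemma arc_semiarc:
  assumes "twisted_diagram D"
  shows "arc_in D (i, cis \<theta>) \<in> semiarcs D i" "arc_out D (i, cis \<theta>) \<in> semiarcs D i"
proof -
  show "arc_in D (i, cis \<theta>) \<in> semiarcs D i"
    using eventually_happens[OF arc_in_germ[OF assms, of i \<theta>]] component_at_semiarc(1) by fastforce
  show "arc_out D (i, cis \<theta>) \<in> semiarcs D i"
    using eventually_happens[OF arc_out_germ[OF assms, of i \<theta>]] component_at_semiarc(1) by fastforce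
qed

text \<open>The cut-free intervals on the two sides join through the uncut point to a connected set,
  so both one-sided semiarcs are the one through that point.\<close>

lemma arc_uncut:
  assumes "twisted_diagram D" "cis \<theta> \<notin> cuts D i"
  shows "arc_in D (i, cis \<theta>) = component_at D i (cis \<theta>)" "arc_out D (i, cis \<theta>) = component_at D i (cis \<theta>)"
proof -
  obtain x where x: "x < \<theta>" "\<And>y. x < y \<Longrightarrow> y < \<theta> \<Longrightarrow> cis y \<notin> cuts D i \<and> component_at D i (cis y) = arc_in D (i, cis \<theta>)"
    using arc_in_germ[OF assms(1), of i \<theta>] unfolding eventually_at_left_field by blast
  obtain u where u: "u > \<theta>" "\<And>y. u > y \<Longrightarrow> y > \<theta> \<Longrightarrow> cis y \<notin> cuts D i \<and> component_at D i (cis y) = arc_out D (i, cis \<theta>)"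
    using arc_out_germ[OF assms(1), of i \<theta>] unfolding eventually_at_right_field by blast
  define a b where "a = (x + \<theta>) / 2" and "b = (\<theta> + u) / 2"
  have ab: "x < a" "a < \<theta>" "\<theta> < b" "b < u" using x u by (auto simp: a_def b_def)
  have "cis y \<notin> cuts D i" if "a \<le> y" "y \<le> b" for y
    using x(2)[of y] u(2)[of y] assms(2) that ab by (cases y \<theta> rule: linorder_cases) auto
  then have "component_at D i (cis a) = component_at D i (cis \<theta>)" "component_at D i (cis b) = component_at D i (cis \<theta>)"
    using component_at_eq[of "{a..b}" 0 1 D i a \<theta>] component_at_eq[of "{a..b}" 0 1 D i b \<theta>] ab by auto
  then show "arc_in D (i, cis \<theta>) = component_at D i (cis \<theta>)" "arc_out D (i, cis \<theta>) = component_at D i (cis \<theta>)"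
    using x(2)[of a] u(2)[of b] ab by auto
qed

text \<open>An arbitrary function on semiarcs gives germs, because points close to a given one are
  uncut; the rules of a coloring concern only the jumps at cuts.\<close>

lemma germs_semiarcs:
  assumes "twisted_diagram D"
  shows "germs (cuts D i) (\<lambda>z. C (arc_in D (i, z))) (\<lambda>z. C (arc_out D (i, z)))"
  unfolding germs_def
proof (intro allI conjI impI)
  fix \<theta>
  show "\<forall>\<^sub>F x in at_right \<theta>. C (arc_in D (i, cis x)) = C (arc_out D (i, cis \<theta>)) \<and> C (arc_out D (i, cis x)) = C (arc_out D (i, cis \<theta>))"
    using arc_out_germ[OF assms, of i \<theta>] by eventually_elim (metis arc_uncut[OF assms])
  show "\<forall>\<^sub>F x in at_left \<theta>. C (arc_in D (i, cis x)) = C (arc_in D (i, cis \<theta>)) \<and> C (arc_out D (i, cis x)) = C (arc_in D (i, cis \<theta>))"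
    using arc_in_germ[OF assms, of i \<theta>] by eventually_elim (metis arc_uncut[OF assms])
  show "C (arc_in D (i, cis \<theta>)) = C (arc_out D (i, cis \<theta>))" if "cis \<theta> \<notin> cuts D i"
    using that by (simp add: arc_uncut[OF assms])
qed

section \<open>Colorings and sign assignments as germs; the defect as a signed sum\<close>

declare split_paired_All [simp del] split_paired_Ex [simp del]

text \<open>The change of the first factor when the strand of p passes that of q. A vanishing
  determinant would also give -1, but double points of a twisted diagram are transverse. If p is the
  over point, the crossing sign is the negative of this number.\<close>

definition eps :: "diagram \<Rightarrow> pt \<Rightarrow> pt \<Rightarrow> int" where
  "eps D p q = (if crosses_left_to_right D q p then 1 else -1)"

text \<open>The form of a coloring that can be transported: its domain is the parameter circle,
  which a move leaves alone, and not the set of semiarcs.\<close>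

definition colors :: "nat \<Rightarrow> diagram \<Rightarrow> nat \<Rightarrow> (complex \<Rightarrow> int \<times> int) \<Rightarrow> (complex \<Rightarrow> int \<times> int) \<Rightarrow> bool" where
  "colors n D i l r \<longleftrightarrow> germs (cuts D i) l r \<and>
    (\<forall>z\<in>sphere 0 1. snd (l z) \<in> {1, -1}) \<and>
    (\<forall>z q. classical D (i, z) q \<longrightarrow>
      snd (r z) = snd (l z) \<and> [fst (r z) = fst (l z) + eps D (i, z) q] (mod int n)) \<and>
    (\<forall>z. (i, z) \<in> bars D \<longrightarrow> snd (r z) = - snd (l z) \<and> [fst (r z) = - fst (l z)] (mod int n))"

lemma colorsD:
  assumes "colors n D i l r"
  shows "germs (cuts D i) l r"
    and "z \<in> sphere 0 1 \<Longrightarrow> snd (l z) \<in> {1, -1}"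
    and "classical D (i, z) q \<Longrightarrow>
      snd (r z) = snd (l z) \<and> [fst (r z) = fst (l z) + eps D (i, z) q] (mod int n)"
    and "(i, z) \<in> bars D \<Longrightarrow> snd (r z) = - snd (l z) \<and> [fst (r z) = - fst (l z)] (mod int n)"
  using assms unfolding colors_def by blast+

definition signs :: "diagram \<Rightarrow> nat \<Rightarrow> (complex \<Rightarrow> int) \<Rightarrow> (complex \<Rightarrow> int) \<Rightarrow> bool" where
  "signs D i l r \<longleftrightarrow> germs (cuts D i) l r \<and>
    (\<forall>z\<in>sphere 0 1. l z \<in> {1, -1}) \<and>
    (\<forall>z q. classical D (i, z) q \<longrightarrow> r z = l z) \<and>
    (\<forall>z. (i, z) \<in> bars D \<longrightarrow> r z = - l z)"

lemma generic_double:
  assumes "twisted_diagram D" "double D p q"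
  shows "det2 (vel D p) (vel D q) \<noteq> 0" "double D p q' \<Longrightarrow> q' = q"
  using assms unfolding twisted_diagram_def generic_def by blast+

lemma double_sym: "double D p q \<longleftrightarrow> double D q p"
  by (auto simp: double_def)

lemma classical_sym: "classical D p q \<longleftrightarrow> classical D q p"
  by (auto simp: classical_def double_sym)

lemma det2_swap: "det2 u v = - det2 v u"
  by (simp add: det2_def)

lemma eps_swap:
  assumes "twisted_diagram D" "double D p q" shows "eps D q p = - eps D p q"
  using generic_double(1)[OF assms] det2_swap[of "vel D q" "vel D p"]
  by (auto simp: eps_def crosses_left_to_right_def)

lemma not_both_over:
  assumes "twisted_diagram D" "double D p q" "p \<in> overs D" shows "q \<notin> overs D"
proof -
  obtain q' where "double D p q'" "q' \<notin> overs D"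
    using assms(1,3) by (auto simp: twisted_diagram_def)
  then show ?thesis using generic_double(2)[OF assms(1,2)] by metis
qed

lemma crosses_eps:
  assumes "twisted_diagram D" "classical D p q"
  shows "crosses_left_to_right D q p \<longleftrightarrow> eps D p q = 1"
    "crosses_right_to_left D q p \<longleftrightarrow> eps D p q = -1"
    "crossing_sign D (p, q) = - eps D p q"
  using generic_double(1)[OF assms(1), of p q] assms(2)
  by (auto simp: eps_def crosses_left_to_right_def crosses_right_to_left_def classical_def crossing_sign_def)

lemma point_on_sphere:
  assumes "double D (i, z) q" shows "z \<in> sphere 0 1"
  using assms by (auto simp: double_def points_def)

lemma bar_on_sphere:
  assumes "twisted_diagram D" "(i, z) \<in> bars D" shows "z \<in> sphere 0 1"
  using assms by (auto simp: twisted_diagram_def points_def)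

lemma colors_of_coloring:
  assumes D: "twisted_diagram D" and C: "twisted_coloring n D i C"
  shows "colors n D i (\<lambda>z. C (arc_in D (i, z))) (\<lambda>z. C (arc_out D (i, z)))"
  unfolding colors_def
proof (intro conjI allI impI ballI)
  show "germs (cuts D i) (\<lambda>z. C (arc_in D (i, z))) (\<lambda>z. C (arc_out D (i, z)))"
    by (rule germs_semiarcs[OF D])
  show "snd (C (arc_in D (i, z))) \<in> {1, -1}" if "z \<in> sphere 0 1" for z
    using that C arc_semiarc(1)[OF D, of i] unfolding sphere_cis twisted_coloring_def by blast
  fix z q assume q: "classical D (i, z) q"
  show "snd (C (arc_out D (i, z))) = snd (C (arc_in D (i, z)))"
    using q C unfolding twisted_coloring_def by blast
  show "[fst (C (arc_out D (i, z))) = fst (C (arc_in D (i, z))) + eps D (i, z) q] (mod int n)"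
  proof (cases "crosses_left_to_right D q (i, z)")
    case True
    then have "eps D (i, z) q = 1" by (simp add: eps_def)
    with True show ?thesis using q C unfolding twisted_coloring_def by metis
  next
    case False
    then have "eps D (i, z) q = -1" by (simp add: eps_def)
    with crosses_eps(2)[OF D q] show ?thesis using q C unfolding twisted_coloring_def
      by (metis diff_conv_add_uminus)
  qed
qed (use C in \<open>auto simp: twisted_coloring_def\<close>)

lemma signs_of_colors:
  assumes "colors n D i l r" shows "signs D i (\<lambda>z. snd (l z)) (\<lambda>z. snd (r z))"
  using assms germs_compose[of "cuts D i" l r l r "\<lambda>x y. snd x"] by (auto simp: colors_def signs_def)

text \<open>The range is prescribed for l only; a value of r is also a value of l slightly
  later.\<close>

lemma sign_pm:
  assumes c: "colors n D i l r" and z: "z \<in> sphere 0 1"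
  shows "snd (l z) \<in> {1, -1}" "snd (r z) \<in> {1, -1}"
proof -
  show "snd (l z) \<in> {1, -1}" using c z unfolding colors_def by blast
  obtain \<theta> where \<theta>: "z = cis \<theta>" using z unfolding sphere_cis by blast
  from eventually_happens[OF germsD(1)[OF colorsD(1)[OF c], of \<theta>]] obtain x where "l (cis x) = r z" unfolding \<theta> by auto
  moreover have "cis x \<in> sphere 0 1" by simp
  ultimately show "snd (r z) \<in> {1, -1}" using c unfolding colors_def by metis
qed

lemma signs_of_assignment:
  assumes "twisted_diagram D" "sign_assignment D i e"
  shows "signs D i (\<lambda>z. e (arc_in D (i, z))) (\<lambda>z. e (arc_out D (i, z)))"
  unfolding signs_def
proof (intro conjI ballI)
  fix z :: complex assume "z \<in> sphere 0 1"
  then show "e (arc_in D (i, z)) \<in> {1, -1}"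
    using assms(2) arc_semiarc(1)[OF assms(1), of i] unfolding sphere_cis sign_assignment_def by blast
qed (use assms germs_semiarcs in \<open>auto simp: sign_assignment_def\<close>)

lemma assignment_of_coloring:
  assumes "twisted_coloring n D i C" shows "sign_assignment D i (\<lambda>A. snd (C A))"
  using assms unfolding twisted_coloring_def sign_assignment_def by blast

lemma signs_unique:
  assumes "signs D i l r" "signs D i l2 r2"
  shows "\<exists>\<eta>\<in>{1, -1}. \<forall>z\<in>sphere 0 1. l2 z = \<eta> * l z"
proof -
  \<comment> \<open>Both signs are kept at crossings and both are negated at bars, so their product
    never jumps.\<close>
  define h where "h z = l2 z * l z" for z
  have g: "germs (cuts D i) h (\<lambda>z. r2 z * r z)"
    using germs_compose[of "cuts D i" l2 r2 l r "(*)"] assms unfolding signs_def h_def by blast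
  have "h (cis \<theta>) = r2 (cis \<theta>) * r (cis \<theta>)" for \<theta>
  proof (cases "cis \<theta> \<in> cuts D i")
    case True
    then consider q where "classical D (i, cis \<theta>) q" | "(i, cis \<theta>) \<in> bars D"
      unfolding cuts_def by blast
    then show ?thesis using assms unfolding signs_def h_def by cases (metis, simp)
  next
    case False then show ?thesis using germsD(3)[OF g] by simp
  qed
  then have const: "h (cis a) = h (cis b)" for a b by (rule germs_const[OF g])
  have pm: "l z \<in> {1, -1}" "l2 z \<in> {1, -1}" if "z \<in> sphere 0 1" for z
    using that assms unfolding signs_def by blast+
  have "l2 z = h 1 * l z" if "z \<in> sphere 0 1" for z
  proof -
    have "h z = h 1" using that const[of _ 0] unfolding sphere_cis by auto
    moreover have "l2 z = h z * l z" using pm[OF that] by (auto simp: h_def)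
    ultimately show ?thesis by simp
  qed
  moreover have "h 1 \<in> {1, -1}" using pm[of 1] by (auto simp: h_def)
  ultimately show ?thesis by blast
qed

lemma colors_unique:
  assumes 1: "colors n D i l r" and 2: "colors n D i l2 r2"
  shows "\<exists>\<eta>\<in>{1, -1}. \<exists>k. \<forall>z\<in>sphere 0 1. snd (l2 z) = \<eta> * snd (l z) \<and>
    [fst (l2 z) = fst (l z) + k * snd (l z)] (mod int n)"
proof -
  obtain \<eta> where \<eta>: "\<eta> \<in> {1, -1}" "\<And>z. z \<in> sphere 0 1 \<Longrightarrow> snd (l2 z) = \<eta> * snd (l z)"
    using signs_unique[OF signs_of_colors[OF 1] signs_of_colors[OF 2]] by blast
  \<comment> \<open>At a crossing the two first factors jump by the same amount, and at a bar both
    their difference and the sign are negated. Reduction mod n turns the congruences into the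
    equalities that \<open>germs_const\<close> needs.\<close>
  define f where "f x y = ((fst y - fst x) * snd x) mod int n" for x y :: "int \<times> int"
  have g: "germs (cuts D i) (\<lambda>z. f (l z) (l2 z)) (\<lambda>z. f (r z) (r2 z))"
    by (rule germs_compose) (use 1 2 in \<open>auto simp: colors_def\<close>)
  have "f (l z) (l2 z) = f (r z) (r2 z)" if "z = cis \<theta>" for z \<theta>
  proof (cases "z \<in> cuts D i")
    case True
    then consider q where "classical D (i, z) q" | "(i, z) \<in> bars D"
      unfolding cuts_def by blast
    then show ?thesis
    proof cases
      case (1 q)
      have "snd (r z) = snd (l z)" "[fst (r z) = fst (l z) + eps D (i, z) q] (mod int n)"
        "[fst (r2 z) = fst (l2 z) + eps D (i, z) q] (mod int n)"
        using 1 assms unfolding colors_def by blast+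
      then have "[(fst (r2 z) - fst (r z)) * snd (l z) =
          (fst (l2 z) + eps D (i, z) q - (fst (l z) + eps D (i, z) q)) * snd (l z)] (mod int n)"
        by (intro cong_mult cong_diff) auto
      then show ?thesis using \<open>snd (r z) = snd (l z)\<close> by (simp add: f_def cong_def)
    next
      case 2
      have "snd (r z) = - snd (l z)" "[fst (r z) = - fst (l z)] (mod int n)"
        "[fst (r2 z) = - fst (l2 z)] (mod int n)"
        using 2 assms unfolding colors_def by blast+
      then have "[(fst (r2 z) - fst (r z)) * snd (r z) =
          (- fst (l2 z) - (- fst (l z))) * (- snd (l z))] (mod int n)"
        by (intro cong_mult cong_diff) auto
      then show ?thesis by (simp add: f_def cong_def algebra_simps)
    qed
  next
    case False then show ?thesis using germsD(3)[OF g] that by simp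
  qed
  then have "f (l (cis a)) (l2 (cis a)) = f (l (cis b)) (l2 (cis b))" for a b
    using germs_const[OF g] by blast
  then have const: "f (l z) (l2 z) = f (l 1) (l2 1)" if "z \<in> sphere 0 1" for z
    using that unfolding sphere_cis by (metis cis_zero)
  define k where "k = f (l 1) (l2 1)"
  have "[fst (l2 z) = fst (l z) + k * snd (l z)] (mod int n)" if z: "z \<in> sphere 0 1" for z
  proof -
    have "[(fst (l2 z) - fst (l z)) * snd (l z) = k] (mod int n)"
      using const[OF z] by (simp add: f_def k_def cong_def)
    then have "[(fst (l2 z) - fst (l z)) * snd (l z) * snd (l z) + fst (l z) = k * snd (l z) + fst (l z)] (mod int n)"
      by (intro cong_add cong_mult) auto
    moreover have "snd (l z) * snd (l z) = 1" using 1 z unfolding colors_def by fastforce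
    ultimately show ?thesis by (simp add: mult.assoc add.commute)
  qed
  then show ?thesis using \<eta> by blast
qed

text \<open>For a sign function e this is the total change of the product of the two factors of a
  color once around the component. As \<open>classical\<close> is symmetric, every passage through a
  crossing counts once, hence a self-crossing twice.\<close>

definition defect_sum :: "diagram \<Rightarrow> nat \<Rightarrow> (complex \<Rightarrow> int) \<Rightarrow> int" where
  "defect_sum D i e = (\<Sum>(p, q) | classical D p q. if fst p = i then e (snd p) * eps D p q else 0)"

lemma crossings_subset: "crossings D \<subseteq> {(p, q). classical D p q}"
  by (auto simp: crossings_def classical_def)

lemma finite_crossings: "twisted_diagram D \<Longrightarrow> finite (crossings D)"
  using crossed_finite(2) crossings_subset finite_subset by blast

lemma sum_classical:
  assumes D: "twisted_diagram D"
  shows "(\<Sum>(p, q) | classical D p q. f p q) = (\<Sum>(p, q)\<in>crossings D. f p q + f q p)"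
proof -
  have eq: "{(p, q). classical D p q} = crossings D \<union> prod.swap ` crossings D"
    by (force simp: crossings_def classical_def double_sym)
  have "crossings D \<inter> prod.swap ` crossings D = {}"
    using not_both_over[OF D] by (auto simp: crossings_def)
  then have "(\<Sum>(p, q) | classical D p q. f p q) =
      (\<Sum>(p, q)\<in>crossings D. f p q) + (\<Sum>(p, q)\<in>prod.swap ` crossings D. f p q)"
    unfolding eq by (intro sum.union_disjoint) (auto simp: finite_crossings[OF D])
  also have "(\<Sum>(p, q)\<in>prod.swap ` crossings D. f p q) = (\<Sum>(p, q)\<in>crossings D. f q p)"
    by (subst sum.reindex) (auto simp: case_prod_unfold)
  finally show ?thesis by (simp add: sum.distrib case_prod_unfold)
qed

text \<open>The sets count crossings, the sum counts passages. The two jumps at a self-crossing are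
  opposite, so its two passages never enter the same set and cardinalities are sums of the
  indicators G of passages with sign s and jump c.\<close>

lemma defect_of_assignment:
  assumes D: "twisted_diagram D" and e: "sign_assignment D i e"
  shows "int (card (S_L D i e 1)) - int (card (S_L D i e (-1)))
       - int (card (S_R D i e 1)) + int (card (S_R D i e (-1))) = defect_sum D i (\<lambda>z. e (arc_in D (i, z)))"
proof -
  let ?X = "crossings D"
  define G where "G c s p q = (if fst p = i \<and> e (arc_in D p) = s \<and> eps D p q = c then 1 else 0 :: int)" for c s p q
  have cl: "classical D p q" "classical D q p" "eps D q p = - eps D p q" if "(p, q) \<in> ?X" for p q
    using that eps_swap[OF D, of p q] double_sym[of D p q] by (auto simp: crossings_def classical_def)
  have card: "int (card S) = (\<Sum>(p, q)\<in>?X. G c s p q + G c s q p)"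
    if S: "S = {(p, q) \<in> ?X. fst p = i \<and> e (arc_in D p) = s \<and> eps D p q = c \<or>
        fst q = i \<and> e (arc_in D q) = s \<and> eps D q p = c}" and "c \<noteq> 0" for S s c
  proof -
    have "int (card S) = (\<Sum>x\<in>?X. if x \<in> S then 1 else 0)"
      by (subst sum.inter_restrict[symmetric])
        (auto simp: finite_crossings[OF D] S intro!: arg_cong[of _ _ card])
    also have "\<dots> = (\<Sum>(p, q)\<in>?X. G c s p q + G c s q p)"
    proof (rule sum.cong[OF refl])
      fix x assume x: "x \<in> ?X"
      obtain p q where pq: "x = (p, q)" by (cases x)
      show "(if x \<in> S then 1 else 0) = (case x of (p, q) \<Rightarrow> G c s p q + G c s q p)"
        using x cl(3)[OF x[unfolded pq]] \<open>c \<noteq> 0\<close> by (simp add: pq S G_def)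
    qed
    finally show ?thesis .
  qed
  have "S_L D i e s = {(p, q) \<in> ?X. fst p = i \<and> e (arc_in D p) = s \<and> eps D p q = 1 \<or>
      fst q = i \<and> e (arc_in D q) = s \<and> eps D q p = 1}" for s
    unfolding S_L_def by (intro Collect_cong) (auto simp: crosses_eps[OF D cl(1)] crosses_eps[OF D cl(2)])
  moreover have "S_R D i e s = {(p, q) \<in> ?X. fst p = i \<and> e (arc_in D p) = s \<and> eps D p q = -1 \<or>
      fst q = i \<and> e (arc_in D q) = s \<and> eps D q p = -1}" for s
    unfolding S_R_def by (intro Collect_cong) (auto simp: crosses_eps[OF D cl(1)] crosses_eps[OF D cl(2)])
  moreover have "(if fst p = i then e (arc_in D (i, snd p)) * eps D p q else 0) =
      G 1 1 p q - G 1 (-1) p q - G (-1) 1 p q + G (-1) (-1) p q" if "classical D p q" for p q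
  proof -
    have "snd p \<in> sphere 0 1" if "fst p = i"
      using \<open>classical D p q\<close> point_on_sphere[of D i "snd p" q] that unfolding classical_def by (metis prod.collapse)
    then have "fst p = i \<Longrightarrow> e (arc_in D p) \<in> {1, -1}"
      using signs_of_assignment[OF D e] unfolding signs_def by (metis prod.collapse)
    moreover have "eps D p q \<in> {1, -1}" by (simp add: eps_def)
    ultimately show ?thesis by (cases p) (auto simp: G_def)
  qed
  then have "defect_sum D i (\<lambda>z. e (arc_in D (i, z))) =
      (\<Sum>(p, q) | classical D p q. G 1 1 p q - G 1 (-1) p q - G (-1) 1 p q + G (-1) (-1) p q)"
    unfolding defect_sum_def by (intro sum.cong) auto
  ultimately show ?thesis
    unfolding sum_classical[OF D] by (simp add: card sum.distrib sum_subtractf case_prod_unfold)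
qed

lemma defect_sum_unique:
  assumes D: "twisted_diagram D" and "signs D i l r" "signs D i l2 r2"
  shows "\<bar>defect_sum D i l2\<bar> = \<bar>defect_sum D i l\<bar>"
proof -
  obtain \<eta> where \<eta>: "\<eta> \<in> {1, -1}" "\<And>z. z \<in> sphere 0 1 \<Longrightarrow> l2 z = \<eta> * l z"
    using signs_unique[OF assms(2,3)] by blast
  have "(if fst p = i then l2 (snd p) * eps D p q else 0) =
      \<eta> * (if fst p = i then l (snd p) * eps D p q else 0)" if "classical D p q" for p q
    using that \<eta>(2)[of "snd p"] point_on_sphere[of D "fst p" "snd p" q] by (auto simp: classical_def)
  then have "defect_sum D i l2 = \<eta> * defect_sum D i l"
    unfolding defect_sum_def sum_distrib_left by (intro sum.cong) auto
  then show ?thesis using \<eta>(1) by auto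
qed

text \<open>The second factor of the coloring is a sign assignment, so the one picked by
  \<open>SOME\<close> is genuine; every other sign function agrees with it up to a global
  sign.\<close>

lemma twisted_defect_defect_sum:
  assumes D: "twisted_diagram D" and C: "twisted_coloring n D i C" and "signs D i l r"
  shows "int (twisted_defect D i) = \<bar>defect_sum D i l\<bar>"
proof -
  define e where "e = (SOME e. sign_assignment D i e)"
  have e: "sign_assignment D i e"
    unfolding e_def by (rule someI[of "sign_assignment D i", OF assignment_of_coloring[OF C]])
  have "int (twisted_defect D i) = \<bar>defect_sum D i (\<lambda>z. e (arc_in D (i, z)))\<bar>"
    unfolding twisted_defect_def e_def[symmetric] Let_def defect_of_assignment[OF D e] by simp
  also have "\<dots> = \<bar>defect_sum D i l\<bar>"
    by (rule defect_sum_unique[OF D assms(3) signs_of_assignment[OF D e]])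
  finally show ?thesis .
qed

section \<open>Index polynomials of germ colorings\<close>

lemma tpow_add: "tpow (a + b) = tpow a * tpow b"
  by (simp add: tpow_def mult_single)

lemma tpow_0 [simp]: "tpow 0 = 1"
  by (simp add: tpow_def)

lemma tpow_mult_neg: "tpow a * tpow (- a) = 1"
  by (simp flip: tpow_add)

lemma tpow_dvd_nat: "tpow a - 1 dvd tpow (a * int k) - 1"
proof (induction k)
  case (Suc k)
  have "tpow (a * int (Suc k)) - 1 = tpow a * (tpow (a * int k) - 1) + (tpow a - 1)"
    by (simp add: algebra_simps flip: tpow_add)
  then show ?case using Suc by (metis dvd_add dvd_mult dvd_refl)
qed simp

lemma tpow_dvd: "tpow a - 1 dvd tpow (a * k) - 1"
proof (cases "k \<ge> 0")
  case True
  then show ?thesis using tpow_dvd_nat[of a "nat k"] by simp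
next
  case False
  have "tpow (a * k) - 1 = - (tpow (a * k) * (tpow (a * int (nat (- k))) - 1))"
    using False by (simp add: algebra_simps flip: tpow_add)
  then show ?thesis using tpow_dvd_nat[of a "nat (- k)"] by (metis dvd_minus_iff dvd_mult)
qed

lemma tpow_cong:
  assumes "[a = b] (mod int n)" shows "tpow (int n) - 1 dvd tpow a - tpow b"
proof -
  obtain k where "a = b + int n * k" using assms by (metis cong_iff_lin cong_sym)
  then have "tpow a - tpow b = tpow b * (tpow (int n * k) - 1)"
    by (simp add: algebra_simps tpow_add)
  then show ?thesis using tpow_dvd by simp
qed

lemma tpow_mod: "tpow (int n) - 1 dvd tpow a - tpow (a mod int n)"
  by (rule tpow_cong) (simp add: cong_def)

lemma residue_class_eqI:
  assumes "tpow (int n) - 1 dvd f - g" shows "residue_class n f = residue_class n g"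
proof -
  have "tpow (int n) - 1 dvd h - f \<longleftrightarrow> tpow (int n) - 1 dvd h - g" for h
  proof -
    have "h - g = (h - f) + (f - g)" by simp
    then show ?thesis using assms by (metis dvd_add_left_iff)
  qed
  then show ?thesis by (simp add: residue_class_def)
qed

text \<open>Multiplication by the inverse unit \<open>tpow (- k)\<close> gives the preimage of any
  representative.\<close>

lemma times_tpow_residue_class: "times_tpow (residue_class n f) k = residue_class n (f * tpow k)"
proof -
  have "g \<in> times_tpow (residue_class n f) k" if "tpow (int n) - 1 dvd g - f * tpow k" for g
  proof -
    have "g * tpow (- k) - f = (g - f * tpow k) * tpow (- k)"
      using tpow_mult_neg[of k] by (simp add: algebra_simps)
    then have "g * tpow (- k) \<in> residue_class n f" using that by (simp add: residue_class_def)
    moreover have "g = g * tpow (- k) * tpow k" using tpow_mult_neg[of k] by (simp add: algebra_simps)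
    ultimately show ?thesis unfolding times_tpow_def by blast
  qed
  moreover have "tpow (int n) - 1 dvd g * tpow k - f * tpow k" if "tpow (int n) - 1 dvd g - f" for g
    using that by (simp flip: left_diff_distrib)
  ultimately show ?thesis by (auto simp: times_tpow_def residue_class_def)
qed

text \<open>Of the two values that a strand carries at a crossing, the left-hand end has the larger one,
  because passing a strand that comes from the left adds 1.\<close>

definition left_value :: "diagram \<Rightarrow> (complex \<Rightarrow> int \<times> int) \<Rightarrow> pt \<Rightarrow> pt \<Rightarrow> int" where
  "left_value D l p q = fst (l (snd p)) + (if eps D p q = 1 then 1 else 0)"

text \<open>The arguments of \<phi> are the weight and the second factors of the over and the under
  strand, p being the over point; one invariance proof then serves all three polynomials.\<close>

definition crossing_term ::
  "(int \<Rightarrow> int \<Rightarrow> int \<Rightarrow> laurent) \<Rightarrow> diagram \<Rightarrow> nat \<Rightarrow> (complex \<Rightarrow> int \<times> int) \<Rightarrow> pt \<Rightarrow> pt \<Rightarrow> laurent"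
where
  "crossing_term \<phi> D i l p q = (if fst p = i \<and> fst q = i
    then of_int (- eps D p q) *
      \<phi> (left_value D l p q - left_value D l q p) (snd (l (snd p))) (snd (l (snd q)))
    else 0)"

definition crossing_sum ::
  "(int \<Rightarrow> int \<Rightarrow> int \<Rightarrow> laurent) \<Rightarrow> diagram \<Rightarrow> nat \<Rightarrow> (complex \<Rightarrow> int \<times> int) \<Rightarrow> laurent" where
  "crossing_sum \<phi> D i l = (\<Sum>(p, q)\<in>crossings D. crossing_term \<phi> D i l p q)"

text \<open>The conditions on \<open>\<phi> 0 a a\<close> and \<open>\<phi> x (- a) (- a)\<close> are what the moves R1 and T3 need.\<close>

definition admissible :: "nat \<Rightarrow> (int \<Rightarrow> int \<Rightarrow> int \<Rightarrow> laurent) \<Rightarrow> bool" where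
  "admissible n \<phi> \<longleftrightarrow> (\<forall>x y a b. [x = y] (mod int n) \<longrightarrow> \<phi> x a b = \<phi> y a b) \<and>
    (\<forall>a\<in>{1, -1}. \<phi> 0 a a = 0 \<and> (\<forall>x. \<phi> x (- a) (- a) = \<phi> x a a))"

text \<open>Reducing the exponent fixes a representative polynomial, so that invariance can be
  stated as equality of polynomials instead of residue classes.\<close>

definition phi_same :: "nat \<Rightarrow> int \<Rightarrow> int \<Rightarrow> int \<Rightarrow> laurent" where
  "phi_same n x a b = (if a = b then tpow (x mod int n) - 1 else 0)"

definition phi_signed :: "int \<Rightarrow> nat \<Rightarrow> int \<Rightarrow> int \<Rightarrow> int \<Rightarrow> laurent" where
  "phi_signed s n x a b = (if a = s \<and> b = - s then tpow (x mod int n) else 0)"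

text \<open>The subtracted 1 is what makes \<open>phi_same\<close> vanish at weight 0. The signed
  version vanishes whenever the two signs agree.\<close>

lemma admissible_phi:
  "admissible n (phi_same n)" "s \<in> {1, -1} \<Longrightarrow> admissible n (phi_signed s n)"
  by (auto simp: admissible_def phi_same_def phi_signed_def cong_def)

lemma left_arc_color:
  assumes D: "twisted_diagram D" and C: "twisted_coloring n D i C"
    and "classical D p q" "fst p = i"
  defines "l \<equiv> \<lambda>z. C (arc_in D (i, z))"
  shows "[fst (C (left_arc D p q)) = left_value D l p q] (mod int n)"
    and "snd (C (left_arc D p q)) = snd (l (snd p))" and "snd (l (snd p)) \<in> {1, -1}"
proof -
  obtain z where p: "p = (i, z)" using assms(4) by (cases p) auto
  have c: "colors n D i l (\<lambda>z. C (arc_out D (i, z)))"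
    unfolding l_def by (rule colors_of_coloring[OF D C])
  have z: "z \<in> sphere 0 1" using point_on_sphere assms(3) unfolding p classical_def by blast
  show "snd (l (snd p)) \<in> {1, -1}" using c z unfolding colors_def p by auto
  have out: "snd (C (arc_out D p)) = snd (l z)" "[fst (C (arc_out D p)) = fst (l z) + eps D p q] (mod int n)"
    using c assms(3) unfolding colors_def p by blast+
  have "eps D p q \<in> {1, -1}" by (simp add: eps_def)
  then show "[fst (C (left_arc D p q)) = left_value D l p q] (mod int n)"
    using out crosses_eps[OF D assms(3)] by (auto simp: left_arc_def left_value_def p l_def)
  show "snd (C (left_arc D p q)) = snd (l (snd p))"
    using out by (auto simp: left_arc_def p l_def)
qed

lemma dvd_sum_diff:
  fixes f g :: "'a \<Rightarrow> laurent"
  assumes "\<And>x. x \<in> X \<Longrightarrow> d dvd f x - g x"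
  shows "d dvd sum f X - sum g X"
  using assms by (simp add: dvd_sum flip: sum_subtractf)

text \<open>P is the condition selecting a set of self-crossings and F the summand of its
  polynomial. Outside the set \<phi> vanishes, inside it represents F modulo
  \<open>tpow (int n) - 1\<close>.\<close>

lemma coloring_sum:
  assumes D: "twisted_diagram D" and C: "twisted_coloring n D i C"
    and \<phi>: "\<And>x a b. P a b \<Longrightarrow> tpow (int n) - 1 dvd F x - \<phi> x a b" "\<And>x a b. \<not> P a b \<Longrightarrow> \<phi> x a b = 0"
      "\<And>x y a b. [x = y] (mod int n) \<Longrightarrow> \<phi> x a b = \<phi> y a b"
  shows "residue_class n (\<Sum>\<tau>\<in>{\<tau> \<in> self_crossings D i. P (snd (over_color D C \<tau>)) (snd (under_color D C \<tau>))}.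
      of_int (crossing_sign D \<tau>) * F (weight D C \<tau>)) =
    residue_class n (crossing_sum \<phi> D i (\<lambda>z. C (arc_in D (i, z))))"
    (is "residue_class n (sum ?f ?X) = residue_class n (crossing_sum \<phi> D i ?l)")
proof (rule residue_class_eqI)
  let ?g = "\<lambda>(p, q). crossing_term \<phi> D i ?l p q"
  have X: "?X \<subseteq> crossings D" by (auto simp: self_crossings_def)
  have eq: "snd (over_color D C (p, q)) = snd (?l (snd p))" "snd (under_color D C (p, q)) = snd (?l (snd q))"
    "[weight D C (p, q) = left_value D ?l p q - left_value D ?l q p] (mod int n)"
    "crossing_sign D (p, q) = - eps D p q"
    if "(p, q) \<in> crossings D" "fst p = i" "fst q = i" for p q
  proof -
    have c: "classical D p q" "classical D q p"
      using that classical_sym[of D p q] by (auto simp: crossings_def classical_def)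
    show "snd (over_color D C (p, q)) = snd (?l (snd p))" "snd (under_color D C (p, q)) = snd (?l (snd q))"
      "[weight D C (p, q) = left_value D ?l p q - left_value D ?l q p] (mod int n)"
      using left_arc_color[OF D C c(1) that(2)] left_arc_color[OF D C c(2) that(3)]
      by (auto simp: over_color_def under_color_def weight_def intro: cong_diff)
    show "crossing_sign D (p, q) = - eps D p q" by (rule crosses_eps(3)[OF D c(1)])
  qed
  have "crossing_sum \<phi> D i ?l = sum ?g ?X"
    unfolding crossing_sum_def
  proof (rule sum.mono_neutral_right[OF finite_crossings[OF D] X], rule ballI)
    fix x assume x: "x \<in> crossings D - ?X"
    obtain p q where pq: "x = (p, q)" by (cases x)
    show "?g x = 0"
    proof (cases "fst p = i \<and> fst q = i")
      case True
      then have "\<not> P (snd (over_color D C x)) (snd (under_color D C x))"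
        using x by (auto simp: self_crossings_def pq)
      then show ?thesis using eq(1,2)[of p q] True x pq \<phi>(2) by (auto simp: crossing_term_def)
    qed (auto simp: pq crossing_term_def)
  qed
  moreover have "tpow (int n) - 1 dvd sum ?f ?X - sum ?g ?X"
  proof (rule dvd_sum_diff)
    fix x assume x: "x \<in> ?X"
    obtain p q where pq: "x = (p, q)" by (cases x)
    have i: "fst p = i" "fst q = i" "(p, q) \<in> crossings D"
      using x by (auto simp: self_crossings_def pq)
    note e = eq[OF i(3,1,2)]
    have P: "P (snd (?l (snd p))) (snd (?l (snd q)))" using x e pq by auto
    have "\<phi> (left_value D ?l p q - left_value D ?l q p) a b = \<phi> (weight D C x) a b" for a b
      using \<phi>(3) e(3) pq by (metis cong_sym)
    then have "?f x - ?g x = of_int (- eps D p q) *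
        (F (weight D C x) - \<phi> (weight D C x) (snd (?l (snd p))) (snd (?l (snd q))))"
      using i e by (simp add: pq crossing_term_def right_diff_distrib)
    then show "tpow (int n) - 1 dvd ?f x - ?g x" using \<phi>(1)[OF P] by simp
  qed
  ultimately show "tpow (int n) - 1 dvd sum ?f ?X - crossing_sum \<phi> D i ?l" by simp
qed

lemma index_poly_crossing_sum:
  assumes D: "twisted_diagram D" and C: "twisted_coloring (twisted_defect D i) D i C"
  shows "index_poly D i C = residue_class (twisted_defect D i)
      (crossing_sum (phi_same (twisted_defect D i)) D i (\<lambda>z. C (arc_in D (i, z))))"
    and "signed_index_poly s D i C = residue_class (twisted_defect D i)
      (crossing_sum (phi_signed s (twisted_defect D i)) D i (\<lambda>z. C (arc_in D (i, z))))"
proof -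
  let ?n = "twisted_defect D i"
  show "index_poly D i C = residue_class ?n (crossing_sum (phi_same ?n) D i (\<lambda>z. C (arc_in D (i, z))))"
    unfolding index_poly_def T_same_def
    by (rule coloring_sum[OF D C, where P = "(=)" and F = "\<lambda>x. tpow x - 1"])
      (use tpow_mod[of ?n] in \<open>auto simp: phi_same_def cong_def\<close>)
  show "signed_index_poly s D i C = residue_class ?n (crossing_sum (phi_signed s ?n) D i (\<lambda>z. C (arc_in D (i, z))))"
    unfolding signed_index_poly_def T_signed_def
    by (rule coloring_sum[OF D C, where P = "\<lambda>a b. a = s \<and> b = - s" and F = "\<lambda>x. tpow x"])
      (use tpow_mod[of ?n] in \<open>auto simp: phi_signed_def cong_def\<close>)
qed

text \<open>The weight changes by k times the difference of the two old second factors. For \<eta> =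
  -1 the crossings counted for s in the new coloring are those counted for -s in the old one, hence
  the type \<eta> * s on the right.\<close>

lemma crossing_sum_change:
  assumes D: "twisted_diagram D" and c: "colors n D i l r"
    and \<eta>: "\<eta> \<in> {1, -1}" and l2: "\<And>z. z \<in> sphere 0 1 \<Longrightarrow> snd (l2 z) = \<eta> * snd (l z) \<and>
      [fst (l2 z) = fst (l z) + k * snd (l z)] (mod int n)"
  shows "crossing_sum (phi_same n) D i l2 = crossing_sum (phi_same n) D i l"
    and "s \<in> {1, -1} \<Longrightarrow> residue_class n (crossing_sum (phi_signed s n) D i l2) =
      times_tpow (residue_class n (crossing_sum (phi_signed (\<eta> * s) n) D i l)) (2 * k * \<eta> * s)"
proof -
  have W: "[left_value D l2 p q - left_value D l2 q p =
      left_value D l p q - left_value D l q p + k * (snd (l (snd p)) - snd (l (snd q)))] (mod int n)"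
    "snd (l2 (snd p)) = \<eta> * snd (l (snd p))" "snd (l2 (snd q)) = \<eta> * snd (l (snd q))"
    "snd (l (snd p)) \<in> {1, -1}" "snd (l (snd q)) \<in> {1, -1}"
    if "(p, q) \<in> crossings D" for p q
  proof -
    have s: "snd p \<in> sphere 0 1" "snd q \<in> sphere 0 1"
      using that by (auto simp: crossings_def double_def points_def)
    note 1 = l2[OF s(1)] and 2 = l2[OF s(2)]
    show "snd (l2 (snd p)) = \<eta> * snd (l (snd p))" "snd (l2 (snd q)) = \<eta> * snd (l (snd q))"
      using 1 2 by auto
    show "snd (l (snd p)) \<in> {1, -1}" "snd (l (snd q)) \<in> {1, -1}"
      using c s unfolding colors_def by auto
    have "[left_value D l2 p q - left_value D l2 q p =
        (fst (l (snd p)) + k * snd (l (snd p)) + (if eps D p q = 1 then 1 else 0)) -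
        (fst (l (snd q)) + k * snd (l (snd q)) + (if eps D q p = 1 then 1 else 0))] (mod int n)"
      unfolding left_value_def using 1 2 by (intro cong_diff cong_add) auto
    then show "[left_value D l2 p q - left_value D l2 q p =
      left_value D l p q - left_value D l q p + k * (snd (l (snd p)) - snd (l (snd q)))] (mod int n)"
      by (simp add: left_value_def algebra_simps)
  qed
  show "crossing_sum (phi_same n) D i l2 = crossing_sum (phi_same n) D i l"
    unfolding crossing_sum_def
  proof (rule sum.cong[OF refl], clarify)
    fix p1 p2 q1 q2 assume "((p1, p2), (q1, q2)) \<in> crossings D"
    from W[OF this] show "crossing_term (phi_same n) D i l2 (p1, p2) (q1, q2) =
        crossing_term (phi_same n) D i l (p1, p2) (q1, q2)"
      using \<eta> by (auto simp: crossing_term_def phi_same_def cong_def)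
  qed
  assume s: "s \<in> {1, -1}"
  show "residue_class n (crossing_sum (phi_signed s n) D i l2) =
      times_tpow (residue_class n (crossing_sum (phi_signed (\<eta> * s) n) D i l)) (2 * k * \<eta> * s)"
    unfolding times_tpow_residue_class
  proof (rule residue_class_eqI)
    show "tpow (int n) - 1 dvd crossing_sum (phi_signed s n) D i l2 -
        crossing_sum (phi_signed (\<eta> * s) n) D i l * tpow (2 * k * \<eta> * s)"
      unfolding crossing_sum_def sum_distrib_right
    proof (rule dvd_sum_diff)
      fix x assume x: "x \<in> crossings D"
      obtain p q where pq: "x = (p, q)" by (cases x)
      note W = W[OF x[unfolded pq]]
      let ?W2 = "left_value D l2 p q - left_value D l2 q p" and ?W = "left_value D l p q - left_value D l q p"
      have *: "tpow (int n) - 1 dvd phi_signed s n ?W2 (snd (l2 (snd p))) (snd (l2 (snd q))) -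
          phi_signed (\<eta> * s) n ?W (snd (l (snd p))) (snd (l (snd q))) * tpow (2 * k * \<eta> * s)"
      \<comment> \<open>For the old signs \<eta> * s and - (\<eta> * s) the difference of second
        factors is 2 * \<eta> * s, the source of the exponent.\<close>
      proof (cases "snd (l (snd p)) = \<eta> * s \<and> snd (l (snd q)) = - (\<eta> * s)")
        case True
        then have "[?W2 = ?W + 2 * k * \<eta> * s] (mod int n)" using W(1) by (simp add: algebra_simps)
        then have "[?W2 mod int n = ?W mod int n + 2 * k * \<eta> * s] (mod int n)"
          by (simp add: cong_def mod_add_left_eq)
        moreover have "snd (l2 (snd p)) = s \<and> snd (l2 (snd q)) = - s" using W(2,3) True \<eta> by auto
        ultimately show ?thesis using True tpow_cong by (simp add: phi_signed_def flip: tpow_add)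
      next
        case False
        then have "\<not> (snd (l2 (snd p)) = s \<and> snd (l2 (snd q)) = - s)" using W(2-5) \<eta> by auto
        with False show ?thesis by (auto simp: phi_signed_def)
      qed
      show "tpow (int n) - 1 dvd (case x of (p, q) \<Rightarrow> crossing_term (phi_signed s n) D i l2 p q) -
          (case x of (p, q) \<Rightarrow> crossing_term (phi_signed (\<eta> * s) n) D i l p q) * tpow (2 * k * \<eta> * s)"
        using dvd_mult[OF *, of "of_int (- eps D p q)"] by (auto simp: pq crossing_term_def algebra_simps)
    qed
  qed
qed

lemma two_equivalent_change:
  assumes D: "twisted_diagram D" and c: "colors n D i l r" "colors n D i l2 r2"
  shows "residue_class n (crossing_sum (phi_same n) D i l2) = residue_class n (crossing_sum (phi_same n) D i l)"
    and "two_equivalent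
      (residue_class n (crossing_sum (phi_signed 1 n) D i l2), residue_class n (crossing_sum (phi_signed (-1) n) D i l2))
      (residue_class n (crossing_sum (phi_signed 1 n) D i l), residue_class n (crossing_sum (phi_signed (-1) n) D i l))"
proof -
  obtain \<eta> k where \<eta>: "\<eta> \<in> {1, -1}" and l2: "\<And>z. z \<in> sphere 0 1 \<Longrightarrow> snd (l2 z) = \<eta> * snd (l z) \<and>
      [fst (l2 z) = fst (l z) + k * snd (l z)] (mod int n)"
    using colors_unique[OF c] by blast
  note * = crossing_sum_change[OF D c(1) \<eta> l2]
  show "residue_class n (crossing_sum (phi_same n) D i l2) = residue_class n (crossing_sum (phi_same n) D i l)"
    using *(1) by simp
  show "two_equivalent
      (residue_class n (crossing_sum (phi_signed 1 n) D i l2), residue_class n (crossing_sum (phi_signed (-1) n) D i l2))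
      (residue_class n (crossing_sum (phi_signed 1 n) D i l), residue_class n (crossing_sum (phi_signed (-1) n) D i l))"
    \<comment> \<open>The exponents for s = 1 and s = -1 are 2 * k * \<eta> and its negative; \<eta>
      decides between the two disjuncts.\<close>
    unfolding two_equivalent_def
    by (rule exI[of _ "k * \<eta>"]) (use *(2)[of 1] *(2)[of "-1"] \<eta> in \<open>auto simp: mult.assoc\<close>)
qed

section \<open>Isotopies\<close>

text \<open>Lifts of orientation preserving homeomorphisms of the circle. Keeping only order,
  surjectivity and periodicity makes closure under inverses immediate.\<close>

definition circle_lift :: "(real \<Rightarrow> real) \<Rightarrow> bool" where
  "circle_lift f \<longleftrightarrow> strict_mono f \<and> surj f \<and> (\<forall>\<theta>. f (\<theta> + 2 * pi) = f \<theta> + 2 * pi)"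

lemma periodic_shift_int:
  fixes f :: "real \<Rightarrow> real" and k :: int
  assumes "\<And>\<theta>. f (\<theta> + 2 * pi) = f \<theta> + 2 * pi"
  shows "f (\<theta> + 2 * pi * k) = f \<theta> + 2 * pi * k"
proof -
  have nat: "f (\<theta> + 2 * pi * real m) = f \<theta> + 2 * pi * real m" for m \<theta>
  proof (induction m)
    case (Suc m)
    then show ?case using assms[of "\<theta> + 2 * pi * real m"] by (simp add: algebra_simps)
  qed simp
  show ?thesis
  proof (cases "k \<ge> 0")
    case True then show ?thesis using nat[of \<theta> "nat k"] by simp
  next
    case False
    then show ?thesis using nat[of "\<theta> + 2 * pi * k" "nat (- k)"] by simp
  qed
qed

text \<open>Well-definedness and injectivity of the induced map of the circle: the lift commutes
  with full turns and is injective on angles.\<close>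

lemma circle_lift_cis:
  assumes "circle_lift f" shows "cis (f a) = cis (f b) \<longleftrightarrow> cis a = cis b"
proof -
  have *: "f (x + 2 * pi * of_int k) = f x + 2 * pi * of_int k" for x k
    using assms by (intro periodic_shift_int) (auto simp: circle_lift_def)
  have "f a = f b + 2 * pi * of_int k \<longleftrightarrow> a = b + 2 * pi * of_int k" for k
    using assms unfolding *[symmetric] circle_lift_def by (metis strict_mono_eq)
  then show ?thesis unfolding cis_eq_iff by simp
qed

lemma circle_lift_inv:
  assumes "circle_lift f" shows "circle_lift (inv f)"
proof -
  have f: "strict_mono f" "surj f" "inj f" "\<And>\<theta>. f (\<theta> + 2 * pi) = f \<theta> + 2 * pi"
    using assms strict_mono_imp_inj_on[of f UNIV] by (auto simp: circle_lift_def)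
  have "inv f x < inv f y" if "x < y" for x y
    using that f(1,2) by (metis strict_mono_less surj_f_inv_f)
  moreover have "inv f (\<theta> + 2 * pi) = inv f \<theta> + 2 * pi" for \<theta>
    by (rule inv_f_eq[OF f(3)]) (simp add: f surj_f_inv_f)
  ultimately show ?thesis
    using f by (simp add: circle_lift_def strict_mono_def inj_imp_surj_inv)
qed

text \<open>An increasing surjection maps arbitrarily short one-sided intervals into given ones;
  order and surjectivity take the place of continuity.\<close>

lemma circle_lift_eventually:
  assumes "circle_lift f"
  shows "eventually P (at_right (f \<theta>)) \<Longrightarrow> \<forall>\<^sub>F x in at_right \<theta>. P (f x)"
    and "eventually P (at_left (f \<theta>)) \<Longrightarrow> \<forall>\<^sub>F x in at_left \<theta>. P (f x)"
  using assms unfolding circle_lift_def eventually_at_right_field eventually_at_left_field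
  by (metis strict_mono_less surj_def)+

lemma circle_lift_of_reparam:
  assumes "circle_reparam f" shows "circle_lift f"
proof -
  have per: "\<And>\<theta>. f (\<theta> + 2 * pi) = f \<theta> + 2 * pi" using assms by (auto simp: circle_reparam_def)
  have d: "\<And>x. \<exists>y. (f has_real_derivative y) (at x) \<and> y > 0"
    using assms by (fastforce simp: circle_reparam_def)
  have mono: "f a < f b" if "a < b" for a b using DERIV_pos_imp_increasing[OF that] d by blast
  have cont: "isCont f x" for x using d DERIV_isCont by blast
  have "\<exists>x. f x = y" for y
  proof -
    \<comment> \<open>This many full turns exceed the distance from f 0 to y, so the values at -k
      and k turns enclose y and the intermediate value theorem applies.\<close>
    define k where "k = \<lceil>\<bar>y - f 0\<bar> / (2 * pi)\<rceil>"
    have k: "\<bar>y - f 0\<bar> \<le> 2 * pi * k"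
      using le_of_int_ceiling[of "\<bar>y - f 0\<bar> / (2 * pi)"] pi_gt_zero
      unfolding k_def by (subst (asm) pos_divide_le_eq) (simp_all add: mult.commute)
    have "f (0 + 2 * pi * of_int (- k)) \<le> y" "y \<le> f (0 + 2 * pi * of_int k)"
      unfolding periodic_shift_int[of f, OF per] using k by auto
    moreover have "0 \<le> \<bar>y - f 0\<bar> / (2 * pi)" by simp
    then have "k \<ge> 0" unfolding k_def by linarith
    ultimately show ?thesis
      using IVT[of f "0 + 2 * pi * of_int (- k)" y "0 + 2 * pi * of_int k"] cont by auto
  qed
  then show ?thesis using mono per unfolding circle_lift_def strict_mono_def surj_def by metis
qed

text \<open>Unlike isotopies, these are obviously invertible, which settles the symmetric closure in the
  definition of equivalence.\<close>

definition combinatorial_iso :: "(nat \<Rightarrow> real \<Rightarrow> real) \<Rightarrow> diagram \<Rightarrow> diagram \<Rightarrow> bool" where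
  "combinatorial_iso \<phi> D D' \<longleftrightarrow> ncomp D' = ncomp D \<and>
    (\<forall>i\<in>{1..ncomp D}. circle_lift (\<phi> i) \<and> (\<forall>a.
      ((i, cis a) \<in> overs D' \<longleftrightarrow> (i, cis (\<phi> i a)) \<in> overs D) \<and>
      ((i, cis a) \<in> bars D' \<longleftrightarrow> (i, cis (\<phi> i a)) \<in> bars D) \<and>
      (\<forall>j\<in>{1..ncomp D}. \<forall>b.
        (double D' (i, cis a) (j, cis b) \<longleftrightarrow> double D (i, cis (\<phi> i a)) (j, cis (\<phi> j b))) \<and>
        (double D' (i, cis a) (j, cis b) \<longrightarrow>
          eps D' (i, cis a) (j, cis b) = eps D (i, cis (\<phi> i a)) (j, cis (\<phi> j b))))))"

lemma combinatorial_iso_sym: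
  assumes "combinatorial_iso \<phi> D D'"
  shows "combinatorial_iso (\<lambda>i. inv (\<phi> i)) D' D"
proof -
  have "\<phi> i (inv (\<phi> i) a) = a" if "i \<in> {1..ncomp D}" for i a
    using assms that by (auto simp: combinatorial_iso_def circle_lift_def surj_f_inv_f)
  then show ?thesis
    using assms circle_lift_inv unfolding combinatorial_iso_def by (smt (verit, best))
qed

section \<open>Isotopies preserve the sides of a crossing\<close>

lemma linear_complex:
  fixes A :: "complex \<Rightarrow> complex"
  assumes "linear A" shows "A w = Re w *\<^sub>R A 1 + Im w *\<^sub>R A \<i>"
proof -
  have "w = Re w *\<^sub>R 1 + Im w *\<^sub>R \<i>" by (simp add: complex_eq_iff)
  then show ?thesis using assms by (metis linear_add linear_scale)
qed

lemma linear_det2: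
  fixes A :: "complex \<Rightarrow> complex"
  assumes "linear A"
  shows "det2 (A u) (A v) = det2 (A 1) (A \<i>) * det2 u v"
  using linear_complex[OF assms, of u] linear_complex[OF assms, of v]
  by (simp add: det2_def algebra_simps)

lemma linear_inj_det2:
  fixes A :: "complex \<Rightarrow> complex"
  assumes "linear A" "inj A" shows "det2 (A 1) (A \<i>) \<noteq> 0"
proof
  assume 0: "det2 (A 1) (A \<i>) = 0"
  have inj0: "w = 0" if "A w = 0" for w using that assms by (metis linear_injective_0)
  \<comment> \<open>Each row (x, y) of a singular 2 by 2 matrix yields the kernel vector (y,
    -x).\<close>
  have "A (Complex (Re (A \<i>)) (- Re (A 1))) = 0" "A (Complex (Im (A \<i>)) (- Im (A 1))) = 0"
    using 0 linear_complex[OF assms(1), of "Complex _ _"]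
    by (auto simp: complex_eq_iff det2_def algebra_simps)
  from inj0[OF this(1)] inj0[OF this(2)] have "A 1 = 0" by (simp add: complex_eq_iff)
  then show False using inj0 by fastforce
qed

text \<open>Orientation is preserved because the determinant of the derivative at w depends
  continuously on the time, never vanishes and equals 1 at time 0.\<close>

lemma plane_isotopy_derivative:
  assumes "plane_isotopy H"
  shows "\<exists>A. (H 1 has_derivative A) (at w) \<and> (\<forall>u v. sgn (det2 (A u) (A v)) = sgn (det2 u v))"
proof -
  obtain H' where H': "\<And>t z. t \<in> {0..1} \<Longrightarrow> (H t has_derivative H' t z) (at z) \<and> inj (H' t z)"
    "\<And>v. continuous_on ({0..1} \<times> UNIV) (\<lambda>(t, z). H' t z v)" and H0: "H 0 = id"
    using assms unfolding plane_isotopy_def by blast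
  define f where "f t = det2 (H' t w 1) (H' t w \<i>)" for t
  have lin: "linear (H' t w)" if "t \<in> {0..1}" for t using H'(1)[OF that] has_derivative_linear by blast
  have nz: "f t \<noteq> 0" if "t \<in> {0..1}" for t
    unfolding f_def using linear_inj_det2 lin H'(1) that by blast
  have "(id has_derivative H' 0 w) (at w)" using H'(1)[of 0 w] H0 by simp
  then have "H' 0 w = (\<lambda>x. x)" using has_derivative_unique has_derivative_id by (metis id_def)
  then have f0: "f 0 = 1" by (simp add: f_def det2_def)
  have "continuous_on {0..1} (\<lambda>t. H' t w v)" for v
    using continuous_on_compose2[OF H'(2)[of v], of "{0..1}" "\<lambda>t. (t, w)"]
    by (force intro: continuous_intros)
  then have cont: "continuous_on {0..1} f" unfolding f_def det2_def by (intro continuous_intros)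
  have "f 1 > 0"
  proof (rule ccontr)
    assume "\<not> f 1 > 0"
    then have "\<exists>x. 0 \<le> x \<and> x \<le> 1 \<and> f x = 0" using IVT2'[of f 1 0 0] f0 cont by auto
    then show False using nz by auto
  qed
  moreover have "det2 (H' 1 w u) (H' 1 w v) = f 1 * det2 u v" for u v
    unfolding f_def by (rule linear_det2[OF lin]) simp
  ultimately show ?thesis using H'(1)[of 1 w] by (intro exI[of _ "H' 1 w"]) (simp add: sgn_mult)
qed

text \<open>\<open>vel\<close> differentiates at 0 after rotating the point to the origin of angles;
  a shift of the angle gives the form to which the chain rule applies.\<close>

lemma has_vel:
  assumes "twisted_diagram D" "i \<in> {1..ncomp D}"
  shows "((\<lambda>x. crv D i (cis x)) has_vector_derivative vel D (i, cis \<theta>)) (at \<theta>)"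
proof -
  have "(\<lambda>x. crv D i (cis \<theta> * cis x)) differentiable at 0"
    using assms unfolding twisted_diagram_def immersed_def by (metis sphere_cis)
  then have "((\<lambda>x. crv D i (cis \<theta> * cis x)) has_vector_derivative vel D (i, cis \<theta>)) (at 0)"
    unfolding vel_def by (simp add: vector_derivative_works)
  then have "(((\<lambda>x. crv D i (cis \<theta> * cis x)) \<circ> (\<lambda>x. x - \<theta>)) has_vector_derivative (1 *\<^sub>R vel D (i, cis \<theta>))) (at \<theta>)"
    by (intro vector_diff_chain_at) (auto intro!: derivative_eq_intros)
  then show ?thesis by (simp add: o_def cis_mult)
qed

lemma vel_unique:
  assumes "twisted_diagram D" "i \<in> {1..ncomp D}"
    and "((\<lambda>x. crv D i (cis x)) has_vector_derivative v) (at \<theta>)"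
  shows "vel D (i, cis \<theta>) = v"
  using vector_derivative_at[OF has_vel[OF assms(1,2)]] vector_derivative_at[OF assms(3)] by simp

lemma eps_sgn: "eps D p q = eps D' p' q'"
  if "sgn (det2 (vel D p) (vel D q)) = sgn (det2 (vel D' p') (vel D' q'))"
  using that by (auto simp: eps_def crosses_left_to_right_def sgn_if split: if_splits)

lemma isotopic_combinatorial_iso:
  assumes D: "twisted_diagram D" and D': "twisted_diagram D'" and "isotopic D D'"
  shows "\<exists>\<phi>. combinatorial_iso \<phi> D D'"
proof -
  obtain H \<phi> where n: "ncomp D' = ncomp D" and H: "plane_isotopy H"
    and \<phi>: "\<And>i \<theta>. i \<in> {1..ncomp D} \<Longrightarrow> circle_reparam (\<phi> i) \<and>
        crv D' i (cis \<theta>) = H 1 (crv D i (cis (\<phi> i \<theta>))) \<and>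
        ((i, cis \<theta>) \<in> overs D' \<longleftrightarrow> (i, cis (\<phi> i \<theta>)) \<in> overs D) \<and>
        ((i, cis \<theta>) \<in> bars D' \<longleftrightarrow> (i, cis (\<phi> i \<theta>)) \<in> bars D)"
    using assms(3) unfolding isotopic_def by blast
  have inj: "H 1 x = H 1 y \<longleftrightarrow> x = y" for x y
    using H unfolding plane_isotopy_def by (metis atLeastAtMost_iff bij_def inj_eq order.refl zero_le_one)
  have lift: "circle_lift (\<phi> i)" if "i \<in> {1..ncomp D}" for i
    using circle_lift_of_reparam \<phi>[OF that] by blast
  have dbl: "double D' (i, cis a) (j, cis b) \<longleftrightarrow> double D (i, cis (\<phi> i a)) (j, cis (\<phi> j b))"
    if "i \<in> {1..ncomp D}" "j \<in> {1..ncomp D}" for i j a b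
    using that \<phi>[of i a] \<phi>[of j b] circle_lift_cis[OF lift[of i], of a b]
    by (auto simp: double_def points_def n pos_def inj)
  have "eps D' (i, cis a) (j, cis b) = eps D (i, cis (\<phi> i a)) (j, cis (\<phi> j b))"
    if ij: "i \<in> {1..ncomp D}" "j \<in> {1..ncomp D}" and "double D' (i, cis a) (j, cis b)" for i j a b
  proof -
    \<comment> \<open>Both strands pass through w, so one linear map A acts on both velocities; the
      reparametrizations contribute only positive factors d and e.\<close>
    define w where "w = pos D (i, cis (\<phi> i a))"
    have w: "w = crv D i (cis (\<phi> i a))" "w = crv D j (cis (\<phi> j b))"
      using that(3) unfolding dbl[OF ij] by (auto simp: double_def w_def pos_def)
    obtain A where A: "(H 1 has_derivative A) (at w)" "\<And>u v. sgn (det2 (A u) (A v)) = sgn (det2 u v)"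
      using plane_isotopy_derivative[OF H, of w] by blast
    have v: "\<exists>d>0. vel D' (k, cis x) = A (d *\<^sub>R vel D (k, cis (\<phi> k x)))"
      if k: "k \<in> {1..ncomp D}" and wk: "w = crv D k (cis (\<phi> k x))" for k x
    proof -
      obtain d where d: "d > 0" "(\<phi> k has_real_derivative d) (at x)"
        using \<phi>[OF k] unfolding circle_reparam_def by blast
      have "((\<lambda>y. crv D k (cis y)) \<circ> \<phi> k has_vector_derivative d *\<^sub>R vel D (k, cis (\<phi> k x))) (at x)"
        by (intro vector_diff_chain_at has_vel[OF D k])
          (use d(2) in \<open>simp add: has_real_derivative_iff_has_vector_derivative\<close>)
      then have "(H 1 \<circ> ((\<lambda>y. crv D k (cis y)) \<circ> \<phi> k) has_vector_derivative A (d *\<^sub>R vel D (k, cis (\<phi> k x)))) (at x)"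
        by (rule vector_derivative_diff_chain_within)
          (use has_derivative_at_withinI[OF A(1)] wk in simp)
      moreover have "H 1 \<circ> ((\<lambda>y. crv D k (cis y)) \<circ> \<phi> k) = (\<lambda>y. crv D' k (cis y))"
        using \<phi>[OF k] by (auto simp: o_def)
      ultimately have "vel D' (k, cis x) = A (d *\<^sub>R vel D (k, cis (\<phi> k x)))"
        using k n by (intro vel_unique[OF D']) auto
      then show ?thesis using d(1) by blast
    qed
    obtain d where d: "d > 0" "vel D' (i, cis a) = A (d *\<^sub>R vel D (i, cis (\<phi> i a)))"
      using v[OF ij(1) w(1)] by blast
    obtain e where e: "e > 0" "vel D' (j, cis b) = A (e *\<^sub>R vel D (j, cis (\<phi> j b)))"
      using v[OF ij(2) w(2)] by blast
    have "det2 (d *\<^sub>R u) (e *\<^sub>R v) = d * e * det2 u v" for u v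
      by (simp add: det2_def algebra_simps)
    then show ?thesis
      using d e by (intro eps_sgn) (simp add: A(2) sgn_mult)
  qed
  then show ?thesis unfolding combinatorial_iso_def using n lift \<phi> dbl by blast
qed

section \<open>Transport of colorings along an isotopy\<close>

definition reparam :: "(nat \<Rightarrow> real \<Rightarrow> real) \<Rightarrow> pt \<Rightarrow> pt" where
  "reparam \<phi> p = (fst p, cis (\<phi> (fst p) (Arg (snd p))))"

lemma reparam_cis:
  assumes "circle_lift (\<phi> i)" shows "reparam \<phi> (i, cis \<theta>) = (i, cis (\<phi> i \<theta>))"
proof -
  have "cis (Arg (cis \<theta>)) = cis \<theta>" by (rule cis_Arg[THEN trans]) (auto simp: sgn_div_norm)
  then show ?thesis using circle_lift_cis[OF assms] by (simp add: reparam_def)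
qed

text \<open>The coloring is pulled back along the bijection of points, which respects crossings,
  bars and \<open>eps\<close>. The values themselves are carried over, so both sums agree term by
  term.\<close>

lemma combinatorial_iso_colors:
  assumes iso: "combinatorial_iso \<phi> D D'" and D': "twisted_diagram D'" and i: "i \<in> {1..ncomp D}"
    and c: "colors n D i l r"
  shows "\<exists>l' r'. colors n D' i l' r' \<and>
    defect_sum D' i (\<lambda>z. snd (l' z)) = defect_sum D i (\<lambda>z. snd (l z)) \<and>
    (\<forall>\<phi>. crossing_sum \<phi> D' i l' = crossing_sum \<phi> D i l)"
proof -
  have n: "ncomp D' = ncomp D" using iso by (simp add: combinatorial_iso_def)
  have lift: "circle_lift (\<phi> j)" if "j \<in> {1..ncomp D}" for j
    using iso that by (simp add: combinatorial_iso_def)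
  let ?\<Phi> = "reparam \<phi>"
  have pt: "\<exists>a. p = (fst p, cis a) \<and> ?\<Phi> p = (fst p, cis (\<phi> (fst p) a)) \<and> fst p \<in> {1..ncomp D}"
    if p: "p \<in> points D'" for p
  proof -
    have "fst p \<in> {1..ncomp D}" "snd p \<in> sphere 0 1" using p n by (auto simp: points_def)
    then show ?thesis unfolding sphere_cis by (metis lift reparam_cis prod.collapse)
  qed
  have tr: "(p \<in> overs D' \<longleftrightarrow> ?\<Phi> p \<in> overs D) \<and> (p \<in> bars D' \<longleftrightarrow> ?\<Phi> p \<in> bars D)"
    if "p \<in> points D'" for p
    using pt[OF that] iso unfolding combinatorial_iso_def by metis
  have tr2: "(double D' p q \<longleftrightarrow> double D (?\<Phi> p) (?\<Phi> q)) \<and>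
      (double D' p q \<longrightarrow> eps D' p q = eps D (?\<Phi> p) (?\<Phi> q))"
    if "p \<in> points D'" "q \<in> points D'" for p q
    using pt[OF that(1)] pt[OF that(2)] iso unfolding combinatorial_iso_def by metis
  have bij: "bij_betw ?\<Phi> (points D') (points D)"
  proof (rule bij_betwI')
    fix p q assume "p \<in> points D'" "q \<in> points D'"
    then show "?\<Phi> p = ?\<Phi> q \<longleftrightarrow> p = q"
      using pt[of p] pt[of q] circle_lift_cis[OF lift] by (metis prod.inject)
  next
    fix p assume "p \<in> points D'"
    then show "?\<Phi> p \<in> points D" using pt[of p] by (auto simp: points_def)
  next
    fix q assume "q \<in> points D"
    then have "fst q \<in> {1..ncomp D}" "snd q \<in> sphere 0 1" by (auto simp: points_def)
    then obtain j b where q: "q = (j, cis b)" "j \<in> {1..ncomp D}"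
      unfolding sphere_cis by (metis prod.collapse)
    obtain a where "b = \<phi> j a" using lift[OF q(2)] unfolding circle_lift_def by (metis surjD)
    then show "\<exists>p\<in>points D'. q = ?\<Phi> p"
      using q lift by (intro bexI[of _ "(j, cis a)"]) (auto simp: reparam_cis points_def n)
  qed
  have dp: "p \<in> points E \<and> q \<in> points E" if "double E p q" for E p q
    using that by (auto simp: double_def)
  have clas: "classical D' p q \<longleftrightarrow> classical D (?\<Phi> p) (?\<Phi> q)" if "p \<in> points D'" "q \<in> points D'" for p q
    using tr tr2 that unfolding classical_def by blast
  have bij2: "bij_betw (map_prod ?\<Phi> ?\<Phi>) X' X"
    if X': "X' = {(p, q). double D' p q \<and> P' p q}" and X: "X = {(p, q). double D p q \<and> P p q}"
      and P: "\<And>p q. p \<in> points D' \<Longrightarrow> q \<in> points D' \<Longrightarrow> P' p q \<longleftrightarrow> P (?\<Phi> p) (?\<Phi> q)" for X X' P P'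
  proof (rule bij_betw_subset[OF bij_betw_map_prod[OF bij bij], of X'])
    show "X' \<subseteq> points D' \<times> points D'" unfolding X' using dp by auto
    show "map_prod ?\<Phi> ?\<Phi> ` X' = X"
    proof (intro equalityI subsetI)
      fix x assume "x \<in> map_prod ?\<Phi> ?\<Phi> ` X'"
      then obtain p q where "x = (?\<Phi> p, ?\<Phi> q)" "double D' p q" "P' p q" unfolding X' by auto
      then show "x \<in> X" using tr2[of p q] P[of p q] dp[of D' p q] unfolding X by simp
    next
      fix x assume x: "x \<in> X"
      obtain p q where pq: "x = (p, q)" "double D p q" "P p q" using x unfolding X by auto
      obtain p' q' where "p' \<in> points D'" "q' \<in> points D'" "p = ?\<Phi> p'" "q = ?\<Phi> q'"
        using dp[OF pq(2)] bij unfolding bij_betw_def by (metis imageE)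
      then show "x \<in> map_prod ?\<Phi> ?\<Phi> ` X'"
        using pq tr2[of p' q'] P[of p' q'] unfolding X' by (intro image_eqI[of _ _ "(p', q')"]) simp_all
    qed
  qed
  have bijC: "bij_betw (map_prod ?\<Phi> ?\<Phi>) {(p, q). classical D' p q} {(p, q). classical D p q}"
    by (rule bij2[where P = "\<lambda>p q. p \<in> overs D \<or> q \<in> overs D" and P' = "\<lambda>p q. p \<in> overs D' \<or> q \<in> overs D'"])
      (use tr in \<open>auto simp: classical_def\<close>)
  have bijX: "bij_betw (map_prod ?\<Phi> ?\<Phi>) (crossings D') (crossings D)"
    by (rule bij2[where P = "\<lambda>p q. p \<in> overs D" and P' = "\<lambda>p q. p \<in> overs D'"])
      (use tr in \<open>auto simp: crossings_def\<close>)
  define \<psi> where "\<psi> z = snd (?\<Phi> (i, z))" for z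
  have \<psi>: "\<psi> (cis \<theta>) = cis (\<phi> i \<theta>)" for \<theta> using reparam_cis[of \<phi>, OF lift[OF i]] by (simp add: \<psi>_def)
  have \<psi>\<Phi>: "\<psi> (snd p) = snd (?\<Phi> p)" if "fst p = i" for p using that by (cases p) (simp add: \<psi>_def)
  have fst\<Phi>: "fst (?\<Phi> p) = fst p" for p by (simp add: reparam_def)
  define l' r' where "l' z = l (\<psi> z)" and "r' z = r (\<psi> z)" for z
  have pi: "(i, cis \<theta>) \<in> points D'" for \<theta> using i n by (auto simp: points_def)
  have \<Phi>i: "?\<Phi> (i, cis \<theta>) = (i, cis (\<phi> i \<theta>))" for \<theta> by (rule reparam_cis[of \<phi>, OF lift[OF i]])
  have cl: "classical D (i, cis (\<phi> i \<theta>)) (?\<Phi> q) \<and> eps D' (i, cis \<theta>) q = eps D (i, cis (\<phi> i \<theta>)) (?\<Phi> q)"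
    if "classical D' (i, cis \<theta>) q" for \<theta> q
    using that dp clas[OF pi, of q] tr2[OF pi, of q] unfolding \<Phi>i classical_def by blast
  \<comment> \<open>Germs of D' may jump only at cuts of D', so each jump of the pulled back
    coloring has to come from such a cut.\<close>
  have cut: "cis \<theta> \<in> cuts D' i" if "cis (\<phi> i \<theta>) \<in> cuts D i" for \<theta>
  proof -
    have "\<exists>q. classical D' (i, cis \<theta>) q" if c: "classical D (i, cis (\<phi> i \<theta>)) q" for q
    proof -
      have "q \<in> points D" using c dp unfolding classical_def by blast
      then obtain q' where "q' \<in> points D'" "q = ?\<Phi> q'" using bij unfolding bij_betw_def by blast
      then show ?thesis using clas[OF pi, of q'] c unfolding \<Phi>i by blast
    qed
    then show ?thesis using that tr[OF pi] unfolding cuts_def \<Phi>i by blast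
  qed
  note g = colorsD(1)[OF c]
  have "colors n D' i l' r'"
    unfolding colors_def
  proof (intro conjI allI impI ballI)
    show "germs (cuts D' i) l' r'"
      unfolding germs_def l'_def r'_def \<psi>
    proof (intro allI conjI impI)
      fix \<theta>
      show "\<forall>\<^sub>F x in at_right \<theta>. l (cis (\<phi> i x)) = r (cis (\<phi> i \<theta>)) \<and> r (cis (\<phi> i x)) = r (cis (\<phi> i \<theta>))"
        using circle_lift_eventually(1)[of "\<phi> i" _ \<theta>, OF lift[OF i] germsD(1)[OF g, of "\<phi> i \<theta>"]] .
      show "\<forall>\<^sub>F x in at_left \<theta>. l (cis (\<phi> i x)) = l (cis (\<phi> i \<theta>)) \<and> r (cis (\<phi> i x)) = l (cis (\<phi> i \<theta>))"
        using circle_lift_eventually(2)[of "\<phi> i" _ \<theta>, OF lift[OF i] germsD(2)[OF g, of "\<phi> i \<theta>"]] .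
      show "l (cis (\<phi> i \<theta>)) = r (cis (\<phi> i \<theta>))" if "cis \<theta> \<notin> cuts D' i"
        using that cut germsD(3)[OF g] by blast
    qed
    show "snd (l' z) \<in> {1, -1}" if "z \<in> sphere 0 1" for z
    proof -
      obtain \<theta> where "z = cis \<theta>" using sphere_cisE[OF \<open>z \<in> sphere 0 1\<close>] .
      then have "l' z = l (cis (\<phi> i \<theta>))" by (simp only: l'_def \<psi>)
      then show ?thesis using colorsD(2)[OF c, of "cis (\<phi> i \<theta>)"] by simp
    qed
    fix z q assume q: "classical D' (i, z) q"
    then have "z \<in> sphere 0 1" using point_on_sphere unfolding classical_def by blast
    then obtain \<theta> where z: "z = cis \<theta>" by (rule sphere_cisE)
    show "snd (r' z) = snd (l' z)" "[fst (r' z) = fst (l' z) + eps D' (i, z) q] (mod int n)"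
      using cl[of \<theta> q] q colorsD(3)[OF c, of "cis (\<phi> i \<theta>)" "reparam \<phi> q"] unfolding l'_def r'_def z \<psi> by simp_all
  next
    fix z assume b: "(i, z) \<in> bars D'"
    obtain \<theta> where z: "z = cis \<theta>" using sphere_cisE[OF bar_on_sphere[OF D' b]] .
    then have "(i, cis (\<phi> i \<theta>)) \<in> bars D" using b tr[OF pi] \<Phi>i by simp
    show "snd (r' z) = - snd (l' z)" "[fst (r' z) = - fst (l' z)] (mod int n)"
      using \<open>(i, cis (\<phi> i \<theta>)) \<in> bars D\<close> colorsD(4)[OF c] unfolding l'_def r'_def z \<psi> by simp_all
  qed
  moreover have "defect_sum D' i (\<lambda>z. snd (l' z)) = defect_sum D i (\<lambda>z. snd (l z))"
    unfolding defect_sum_def sum.reindex_bij_betw[OF bijC, symmetric]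
  proof (rule sum.cong[OF refl], clarify)
    fix j z j' z' assume "classical D' (j, z) (j', z')"
    then have "eps D' (j, z) (j', z') = eps D (?\<Phi> (j, z)) (?\<Phi> (j', z'))"
      using tr2 dp unfolding classical_def by blast
    then show "(if fst (j, z) = i then snd (l' (snd (j, z))) * eps D' (j, z) (j', z') else 0) =
       (case map_prod ?\<Phi> ?\<Phi> ((j, z), j', z') of (p, q) \<Rightarrow> if fst p = i then snd (l (snd p)) * eps D p q else 0)"
      using \<psi>\<Phi>[of "(j, z)"] by (cases "j = i") (auto simp: fst\<Phi> l'_def)
  qed
  moreover have "crossing_sum f D' i l' = crossing_sum f D i l" for f
    unfolding crossing_sum_def sum.reindex_bij_betw[OF bijX, symmetric]
  proof (rule sum.cong[OF refl], clarify)
    fix j z j' z' assume "((j, z), (j', z')) \<in> crossings D'"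
    then have d: "double D' (j, z) (j', z')" "double D' (j', z') (j, z)"
      by (auto simp: crossings_def double_sym)
    then have "eps D' (j, z) (j', z') = eps D (?\<Phi> (j, z)) (?\<Phi> (j', z'))"
      "eps D' (j', z') (j, z) = eps D (?\<Phi> (j', z')) (?\<Phi> (j, z))"
      using tr2 dp by blast+
    then show "crossing_term f D' i l' (j, z) (j', z') =
        (case map_prod ?\<Phi> ?\<Phi> ((j, z), j', z') of (p, q) \<Rightarrow> crossing_term f D i l p q)"
      using \<psi>\<Phi>[of "(j, z)"] \<psi>\<Phi>[of "(j', z')"] by (cases "j = i \<and> j' = i") (auto simp: crossing_term_def fst\<Phi> l'_def left_value_def)
  qed
  ultimately show ?thesis by blast
qed

section \<open>Tangles and their crossings\<close>

definition tcross :: "tangle \<Rightarrow> ((nat \<times> real) \<times> (nat \<times> real)) set" where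
  "tcross T = {((k, t), (l, u)). k < length (strands T) \<and> l < length (strands T) \<and>
    t \<in> {-1..1} \<and> u \<in> {-1..1} \<and> (k, t) \<noteq> (l, u) \<and> (strands T ! k) t = (strands T ! l) u \<and>
    ((k, t) \<in> tovers T \<or> (l, u) \<in> tovers T)}"

definition tvel :: "tangle \<Rightarrow> nat \<times> real \<Rightarrow> complex" where
  "tvel T p = vector_derivative (strands T ! fst p) (at (snd p))"

definition tsgn :: "tangle \<Rightarrow> nat \<times> real \<Rightarrow> nat \<times> real \<Rightarrow> int" where
  "tsgn T p q = (if det2 (tvel T p) (tvel T q) > 0 then 1 else -1)"

text \<open>The change of the first factor of the color when strand \<open>fst p\<close> is traversed from left to
  right. It depends only on the orientation \<open>s\<close> of the other strand: reversing strand \<open>fst p\<close> itself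
  exchanges the two sides of the crossing strand but also the values before and after.\<close>

definition tjump :: "(nat \<Rightarrow> int) \<Rightarrow> tangle \<Rightarrow> nat \<times> real \<Rightarrow> nat \<times> real \<Rightarrow> int" where
  "tjump s T p q = - s (fst q) * tsgn T p q"

text \<open>\<open>tsign T k A\<close> and \<open>tsum s T k A\<close> collect the bars and crossings of strand \<open>k\<close> with parameters in
  \<open>A\<close>. A color \<open>(a, e)\<close> at the left end of the strand becomes
  \<open>(\<sigma> * (a + S), \<sigma> * e)\<close> at the parameter \<open>t\<close>, with \<open>\<sigma> = tsign T k {..<t}\<close> and \<open>S = tsum s T k {..<t}\<close>.\<close>

definition tsign :: "tangle \<Rightarrow> nat \<Rightarrow> real set \<Rightarrow> int" where
  "tsign T k A = (\<Prod>x\<in>tbars T. if fst x = k \<and> snd x \<in> A then -1 else 1)"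

definition tsum :: "(nat \<Rightarrow> int) \<Rightarrow> tangle \<Rightarrow> nat \<Rightarrow> real set \<Rightarrow> int" where
  "tsum s T k A = (\<Sum>(p, q)\<in>tcross T.
    if fst p = k \<and> snd p \<in> A then tsign T k {..<snd p} * tjump s T p q else 0)"

text \<open>Crossings and bars stay away from the ends, so a strand enters and leaves with the color
  found just outside. Strands stay in \<open>rect\<close>, so they cannot meet the rest of the
  diagram.\<close>

definition tame :: "tangle \<Rightarrow> bool" where
  "tame T \<longleftrightarrow> finite (tcross T) \<and> finite (tbars T) \<and>
    (\<forall>p q. (p, q) \<in> tcross T \<longrightarrow> snd p \<in> {-1<..<1}) \<and>
    (\<forall>p\<in>tbars T. snd p \<in> {-1<..<1}) \<and>
    (\<forall>k<length (strands T). \<forall>t\<in>{-1..1}. (strands T ! k) t \<in> rect) \<and>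
    (\<forall>k<length (strands T). \<forall>t. (strands T ! k) differentiable at t)"

lemma tcross_sym: "(p, q) \<in> tcross T \<Longrightarrow> (q, p) \<in> tcross T"
  by (auto simp: tcross_def)

lemma tsign_pm: "tsign T k A \<in> {1, -1}"
proof -
  have "finite X \<Longrightarrow> (\<Prod>x\<in>X. if P x then -1 else 1) \<in> {1, -1 :: int}" for P and X :: "(nat \<times> real) set"
    by (induction X rule: finite_induct) auto
  then show ?thesis unfolding tsign_def by (cases "finite (tbars T)") auto
qed

lemma tsign_square [simp]: "tsign T k A * tsign T k A = 1" "tsign T k A * (tsign T k A * x) = x"
  using tsign_pm[of T k A] by auto

lemma tsign_cong:
  assumes "\<And>p. p \<in> tbars T \<Longrightarrow> snd p \<in> A \<longleftrightarrow> snd p \<in> B" shows "tsign T k A = tsign T k B"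
  using assms by (auto simp: tsign_def intro!: prod.cong)

lemma tsum_cong:
  assumes "\<And>p q. (p, q) \<in> tcross T \<Longrightarrow> snd p \<in> A \<longleftrightarrow> snd p \<in> B" shows "tsum s T k A = tsum s T k B"
  using assms unfolding tsum_def by (intro sum.cong) (auto split: prod.split)

text \<open>The parameters at which an accumulated sign or sum can change, with all strands merged
  into one finite set.\<close>

definition events :: "tangle \<Rightarrow> real set" where
  "events T = snd ` tbars T \<union> snd ` fst ` tcross T"

lemma events_cong:
  assumes "A \<inter> events T = B \<inter> events T"
  shows "tsign T k A = tsign T k B" "tsum s T k A = tsum s T k B"
proof -
  have *: "x \<in> A \<longleftrightarrow> x \<in> B" if "x \<in> events T" for x using assms that by blast
  show "tsign T k A = tsign T k B"
    by (rule tsign_cong, rule *) (auto simp: events_def)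
  show "tsum s T k A = tsum s T k B"
    by (rule tsum_cong, rule *) (force simp: events_def)
qed

lemma events_tame:
  assumes "tame T" shows "finite (events T)" "events T \<subseteq> {-1<..<1}"
  using assms unfolding tame_def events_def by auto

text \<open>No element of E lies immediately to the right of t. Half-lines with and without their
  end point both occur because colors before and after a parameter are needed.\<close>

lemma threshold_right:
  fixes t :: real
  assumes "finite E"
  shows "\<forall>\<^sub>F x in at_right t. {..<x} \<inter> E = {..t} \<inter> E \<and> {..x} \<inter> E = {..t} \<inter> E"
proof -
  have "\<forall>\<^sub>F x in at_right t. (u < x \<longleftrightarrow> u \<le> t) \<and> (u \<le> x \<longleftrightarrow> u \<le> t)" for u
  proof (cases "u \<le> t")
    case True
    then show ?thesis using eventually_at_right_less[of t] by (auto elim: eventually_mono)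
  next
    case False
    then show ?thesis using eventually_at_right_real[of t u] by (auto elim!: eventually_mono)
  qed
  then have "\<forall>\<^sub>F x in at_right t. \<forall>u\<in>E. (u < x \<longleftrightarrow> u \<le> t) \<and> (u \<le> x \<longleftrightarrow> u \<le> t)"
    by (intro eventually_ball_finite[OF assms]) auto
  then show ?thesis by (rule eventually_mono) auto
qed

lemma threshold_left:
  fixes t :: real
  assumes "finite E"
  shows "\<forall>\<^sub>F x in at_left t. {..<x} \<inter> E = {..<t} \<inter> E \<and> {..x} \<inter> E = {..<t} \<inter> E"
proof -
  have "\<forall>\<^sub>F x in at_left t. (u < x \<longleftrightarrow> u < t) \<and> (u \<le> x \<longleftrightarrow> u < t)" for u
  proof (cases "u < t")
    case True
    then show ?thesis using eventually_at_left_real[of u t] by (auto elim!: eventually_mono)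
  next
    case False
    have "\<forall>\<^sub>F x in at_left t. x < t" by (simp add: eventually_at_filter)
    then show ?thesis by eventually_elim (use False in auto)
  qed
  then have "\<forall>\<^sub>F x in at_left t. \<forall>u\<in>E. (u < x \<longleftrightarrow> u < t) \<and> (u \<le> x \<longleftrightarrow> u < t)"
    by (intro eventually_ball_finite[OF assms]) auto
  then show ?thesis by (rule eventually_mono) auto
qed

lemma tsign_step:
  assumes "finite (tbars T)"
  shows "(k, t) \<in> tbars T \<Longrightarrow> tsign T k {..t} = - tsign T k {..<t}"
    and "(k, t) \<notin> tbars T \<Longrightarrow> tsign T k {..t} = tsign T k {..<t}"
proof -
  assume "(k, t) \<in> tbars T"
  then have T: "tbars T = insert (k, t) (tbars T - {(k, t)})" by auto
  have "(\<Prod>x\<in>tbars T - {(k, t)}. if fst x = k \<and> snd x \<in> {..t} then -1 else 1 :: int) =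
      (\<Prod>x\<in>tbars T - {(k, t)}. if fst x = k \<and> snd x \<in> {..<t} then -1 else 1)"
    by (rule prod.cong) (auto simp: less_le)
  then show "tsign T k {..t} = - tsign T k {..<t}"
    unfolding tsign_def by (subst (1 2) T, subst (1 2) prod.insert) (use assms in auto)
next
  assume "(k, t) \<notin> tbars T"
  then show "tsign T k {..t} = tsign T k {..<t}"
    unfolding tsign_def by (intro prod.cong) (auto simp: less_le)
qed

text \<open>A point has at most one partner, so at most one summand is gained. The weight of a
  summand uses the bars before its own parameter and does not move with the threshold.\<close>

lemma tsum_step:
  assumes "finite (tcross T)" and uniq: "\<And>q q'. ((k, t), q) \<in> tcross T \<Longrightarrow> ((k, t), q') \<in> tcross T \<Longrightarrow> q = q'"
  shows "((k, t), q) \<in> tcross T \<Longrightarrow> tsum s T k {..t} = tsum s T k {..<t} + tsign T k {..<t} * tjump s T (k, t) q"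
    and "\<forall>q. ((k, t), q) \<notin> tcross T \<Longrightarrow> tsum s T k {..t} = tsum s T k {..<t}"
proof -
  let ?f = "\<lambda>A. \<lambda>(p, q). if fst p = k \<and> snd p \<in> A then tsign T k {..<snd p} * tjump s T p q else 0"
  assume q: "((k, t), q) \<in> tcross T"
  then have T: "tcross T = insert ((k, t), q) (tcross T - {((k, t), q)})" by auto
  have "sum (?f {..t}) (tcross T - {((k, t), q)}) = sum (?f {..<t}) (tcross T - {((k, t), q)})"
  proof (rule sum.cong[OF refl])
    fix x assume x: "x \<in> tcross T - {((k, t), q)}"
    then have "fst x \<noteq> (k, t)" using uniq[OF q] by (cases x) auto
    then show "?f {..t} x = ?f {..<t} x" by (auto simp: less_le prod_eq_iff case_prod_unfold)
  qed
  moreover have "sum (?f {..t}) (tcross T) = ?f {..t} ((k, t), q) + sum (?f {..t}) (tcross T - {((k, t), q)})"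
    "sum (?f {..<t}) (tcross T) = ?f {..<t} ((k, t), q) + sum (?f {..<t}) (tcross T - {((k, t), q)})"
    using sum.remove[OF assms(1) q] by blast+
  ultimately show "tsum s T k {..t} = tsum s T k {..<t} + tsign T k {..<t} * tjump s T (k, t) q"
    unfolding tsum_def by simp
next
  assume "\<forall>q. ((k, t), q) \<notin> tcross T"
  then show "tsum s T k {..t} = tsum s T k {..<t}"
    unfolding tsum_def by (intro sum.cong) (auto simp: less_le)
qed

section \<open>A tangle placed in a diagram\<close>

locale tangle_in =
  fixes D :: diagram and T :: tangle and L :: "location list"
  assumes D: "twisted_diagram D" and contains: "contains_tangle D T L" and tame: "tame T"
begin

definition comp :: "nat \<Rightarrow> nat" where "comp k = fst (L ! k)"
definition ctr :: "nat \<Rightarrow> real" where "ctr k = fst (snd (L ! k))"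
definition wid :: "nat \<Rightarrow> real" where "wid k = snd (snd (L ! k))"
definition orient :: "nat \<Rightarrow> int" where "orient k = (if wid k > 0 then 1 else -1)"
definition loc :: "nat \<times> real \<Rightarrow> pt" where "loc p = loc_pt (L ! fst p) (snd p)"

abbreviation N where "N \<equiv> length L"

lemma loc_eq: "loc (k, t) = (comp k, cis (ctr k + wid k * t))"
  by (cases "L ! k") (simp add: loc_def comp_def ctr_def wid_def)

lemma length_strands: "length (strands T) = N"
  using contains by (simp add: contains_tangle_def)

lemma valid: "k < N \<Longrightarrow> comp k \<in> {1..ncomp D} \<and> wid k \<noteq> 0 \<and> \<bar>wid k\<bar> < pi"
proof -
  assume "k < N"
  then have "valid_loc D (L ! k)" using contains by (auto simp: contains_tangle_def)
  then show ?thesis by (cases "L ! k") (auto simp: comp_def wid_def)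
qed

lemma loc_inj:
  assumes "fst p < N" "fst q < N" "snd p \<in> {-1..1}" "snd q \<in> {-1..1}" "loc p = loc q"
  shows "p = q"
proof -
  have "inj_on (\<lambda>(k, t). loc_pt (L ! k) t) ({..<N} \<times> {-1..1})"
    using contains unfolding contains_tangle_def by blast
  from inj_onD[OF this, of p q] assms show ?thesis by (cases p, cases q) (auto simp: loc_def)
qed

lemma loc_inside: "inside L = loc ` ({..<N} \<times> {-1..1})"
  unfolding inside_def loc_def by force

lemma loc_props:
  assumes "k < N" "t \<in> {-1..1}"
  shows "pos D (loc (k, t)) = (strands T ! k) t" "loc (k, t) \<in> overs D \<longleftrightarrow> (k, t) \<in> tovers T"
    "loc (k, t) \<in> bars D \<longleftrightarrow> (k, t) \<in> tbars T" "loc (k, t) \<in> points D" "pos D (loc (k, t)) \<in> rect"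
proof -
  show 1: "pos D (loc (k, t)) = (strands T ! k) t" and "loc (k, t) \<in> overs D \<longleftrightarrow> (k, t) \<in> tovers T"
    "loc (k, t) \<in> bars D \<longleftrightarrow> (k, t) \<in> tbars T"
    using contains assms by (auto simp: contains_tangle_def loc_def)
  show "loc (k, t) \<in> points D" using valid[OF assms(1)] by (auto simp: loc_eq points_def)
  show "pos D (loc (k, t)) \<in> rect" using tame assms unfolding 1 tame_def length_strands by blast
qed

lemma outside: "p \<in> points D \<Longrightarrow> p \<notin> inside L \<Longrightarrow> pos D p \<notin> rect"
  using contains by (auto simp: contains_tangle_def)

text \<open>Points of the tangle lie in \<open>rect\<close> and all others avoid it, so no crossing
  mixes the two.\<close>

lemma double_inside: "double D p q \<Longrightarrow> p \<in> inside L \<longleftrightarrow> q \<in> inside L"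
proof -
  assume d: "double D p q"
  have "pos D x \<in> rect" if "x \<in> inside L" for x
    using that loc_props(5) unfolding loc_inside by auto
  then show ?thesis using d outside unfolding double_def by metis
qed

lemma classical_loc:
  assumes "fst p < N" "fst q < N" "snd p \<in> {-1..1}" "snd q \<in> {-1..1}"
  shows "classical D (loc p) (loc q) \<longleftrightarrow> (p, q) \<in> tcross T"
  using assms loc_props[of "fst p" "snd p"] loc_props[of "fst q" "snd q"] loc_inj[OF assms]
  by (cases p, cases q) (auto simp: classical_def double_def tcross_def length_strands)

lemma tcross_range:
  assumes "(p, q) \<in> tcross T"
  shows "fst p < N" "fst q < N" "snd p \<in> {-1<..<1}" "snd q \<in> {-1<..<1}" "snd p \<in> {-1..1}" "snd q \<in> {-1..1}"
    "classical D (loc p) (loc q)"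
proof -
  show 1: "fst p < N" "fst q < N" using assms by (auto simp: tcross_def length_strands)
  show 2: "snd p \<in> {-1<..<1}" "snd q \<in> {-1<..<1}"
    using assms tcross_sym[OF assms] tame unfolding tame_def by blast+
  then show 3: "snd p \<in> {-1..1}" "snd q \<in> {-1..1}" by auto
  show "classical D (loc p) (loc q)" using classical_loc[OF 1 3] assms by blast
qed

lemma classical_loc_partner:
  assumes "fst p < N" "snd p \<in> {-1..1}" "classical D (loc p) q"
  shows "\<exists>q'. q = loc q' \<and> (p, q') \<in> tcross T"
proof -
  have "loc p \<in> inside L" using assms unfolding loc_inside by (cases p) auto
  then have "q \<in> inside L" using double_inside assms(3) unfolding classical_def by blast
  then obtain q' where "q = loc q'" "fst q' < N" "snd q' \<in> {-1..1}" unfolding loc_inside by auto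
  then show ?thesis using classical_loc[OF assms(1) _ assms(2)] assms(3) by auto
qed

lemma tcross_unique:
  assumes "(p, q) \<in> tcross T" "(p, q') \<in> tcross T" shows "q = q'"
proof -
  have "loc q = loc q'"
    using tcross_range(7)[OF assms(1)] tcross_range(7)[OF assms(2)] generic_double(2)[OF D]
    unfolding classical_def by metis
  then show ?thesis using loc_inj tcross_range[OF assms(1)] tcross_range[OF assms(2)] by blast
qed

lemma tbars_range:
  assumes "k < N" "(k, t) \<in> tbars T" shows "t \<in> {-1<..<1}" "((k, t), q) \<notin> tcross T"
proof -
  show t: "t \<in> {-1<..<1}" using assms tame unfolding tame_def by fastforce
  have "loc (k, t) \<in> bars D" using loc_props(3)[of k t] t assms by auto
  then have "\<not> double D (loc (k, t)) q'" for q' using D unfolding twisted_diagram_def by blast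
  then show "((k, t), q) \<notin> tcross T" using tcross_range(7) unfolding classical_def by blast
qed

lemma orient_pm: "orient k \<in> {1, -1}" by (simp add: orient_def)

text \<open>Near an interior parameter the component is the strand composed with the inverse f of
  the affine parametrization. At an end parameter this would hold on one side only.\<close>

lemma vel_loc:
  assumes "k < N" "t \<in> {-1<..<1}"
  shows "vel D (loc (k, t)) = (1 / wid k) *\<^sub>R tvel T (k, t)"
proof -
  define f where "f x = (x - ctr k) / wid k" for x
  define \<theta> where "\<theta> = ctr k + wid k * t"
  have w: "wid k \<noteq> 0" using valid[OF assms(1)] by auto
  have f\<theta>: "f \<theta> = t" using w by (simp add: f_def \<theta>_def)
  have "(strands T ! k has_vector_derivative tvel T (k, t)) (at t)"
    using tame assms(1) by (simp add: tame_def tvel_def length_strands vector_derivative_works)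
  moreover have "(f has_vector_derivative (1 / wid k)) (at \<theta>)"
    unfolding f_def using w by (auto intro!: derivative_eq_intros simp flip: has_real_derivative_iff_has_vector_derivative)
  ultimately have d: "(strands T ! k \<circ> f has_vector_derivative (1 / wid k) *\<^sub>R tvel T (k, t)) (at \<theta>)"
    by (intro vector_diff_chain_at) (auto simp: f\<theta>)
  have "isCont f \<theta>" unfolding f_def using w by (intro continuous_intros) auto
  then have "(f \<longlongrightarrow> t) (nhds \<theta>)"
    unfolding isCont_def tendsto_at_iff_tendsto_nhds unfolding f\<theta> .
  then have "\<forall>\<^sub>F x in nhds \<theta>. f x \<in> {-1<..<1}"
    using assms(2) by (intro topological_tendstoD) auto
  then have "\<forall>\<^sub>F x in nhds \<theta>. (strands T ! k \<circ> f) x = crv D (comp k) (cis x)"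
  proof eventually_elim
    case (elim x)
    then have "pos D (loc (k, f x)) = (strands T ! k) (f x)" by (intro loc_props[OF assms(1)]) auto
    moreover have "ctr k + wid k * f x = x" using w by (simp add: f_def)
    ultimately show ?case by (simp add: loc_eq pos_def)
  qed
  note ev = this
  have "((\<lambda>x. crv D (comp k) (cis x)) has_vector_derivative (1 / wid k) *\<^sub>R tvel T (k, t)) (at \<theta>)"
    by (rule has_vector_derivative_cong_ev[THEN iffD1, OF _ _ d])
      (use ev eventually_nhds_x_imp_x[OF ev] in \<open>auto elim: eventually_mono\<close>)
  then show ?thesis using vel_unique[OF D] valid[OF assms(1)] by (simp add: loc_eq \<theta>_def)
qed

text \<open>Each velocity is divided by its half-width, so the determinant acquires both
  orientations as signs; that of q is already part of \<open>tjump\<close>.\<close>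

lemma eps_loc:
  assumes "(p, q) \<in> tcross T"
  shows "eps D (loc p) (loc q) = orient (fst p) * tjump orient T p q"
proof -
  obtain k t l u where pq: "p = (k, t)" "q = (l, u)" by (cases p, cases q) auto
  note r = tcross_range[OF assms, unfolded pq fst_conv snd_conv]
  have v: "vel D (loc p) = (1 / wid k) *\<^sub>R tvel T p" "vel D (loc q) = (1 / wid l) *\<^sub>R tvel T q"
    unfolding pq by (rule vel_loc; fact r)+
  have "det2 (vel D (loc p)) (vel D (loc q)) \<noteq> 0"
    using tcross_range(7)[OF assms] generic_double(1)[OF D] unfolding classical_def by blast
  moreover have "det2 (vel D (loc p)) (vel D (loc q)) = (1 / (wid k * wid l)) * det2 (tvel T p) (tvel T q)"
    unfolding v by (simp add: det2_def diff_divide_distrib mult.commute)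
  ultimately show ?thesis using valid[OF r(1)] valid[OF r(2)]
    by (auto simp: eps_def crosses_left_to_right_def tjump_def tsgn_def orient_def pq
      zero_less_mult_iff mult_less_0_iff zero_less_divide_iff divide_less_0_iff)
qed

end

text \<open>A negative slope exchanges the two sides; strands placed against the orientation of
  their component are treated this way.\<close>

lemma affine_eventually:
  fixes c t :: real
  shows "w > 0 \<Longrightarrow> eventually P (at_right (c + w * t)) \<Longrightarrow> \<forall>\<^sub>F x in at_right t. P (c + w * x)"
    and "w > 0 \<Longrightarrow> eventually P (at_left (c + w * t)) \<Longrightarrow> \<forall>\<^sub>F x in at_left t. P (c + w * x)"
    and "w < 0 \<Longrightarrow> eventually P (at_right (c + w * t)) \<Longrightarrow> \<forall>\<^sub>F x in at_left t. P (c + w * x)"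
    and "w < 0 \<Longrightarrow> eventually P (at_left (c + w * t)) \<Longrightarrow> \<forall>\<^sub>F x in at_right t. P (c + w * x)"
proof -
  have "((\<lambda>x. c + w * x) \<longlongrightarrow> c + w * t) (at t within S)" for S
    by (intro tendsto_intros)
  then have *: "\<forall>\<^sub>F x in at t within S. P (c + w * x)"
    if "\<And>x. x \<in> S \<Longrightarrow> c + w * x \<in> S' - {c + w * t}" "eventually P (at (c + w * t) within S')" for S S'
    using that by (intro eventually_compose_filterlim[OF that(2)] filterlim_at_withinI)
      (auto simp: eventually_at_filter)
  show "w > 0 \<Longrightarrow> eventually P (at_right (c + w * t)) \<Longrightarrow> \<forall>\<^sub>F x in at_right t. P (c + w * x)"
    "w > 0 \<Longrightarrow> eventually P (at_left (c + w * t)) \<Longrightarrow> \<forall>\<^sub>F x in at_left t. P (c + w * x)"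
    "w < 0 \<Longrightarrow> eventually P (at_right (c + w * t)) \<Longrightarrow> \<forall>\<^sub>F x in at_left t. P (c + w * x)"
    "w < 0 \<Longrightarrow> eventually P (at_left (c + w * t)) \<Longrightarrow> \<forall>\<^sub>F x in at_right t. P (c + w * x)"
    by (rule *; auto)+
qed

text \<open>The larger of the values before and after the crossing. It does not depend on the
  direction of travel, so it agrees with \<open>left_value\<close> for both orientations of the
  strand.\<close>

definition tvalue :: "(nat \<Rightarrow> int) \<Rightarrow> tangle \<Rightarrow> (nat \<Rightarrow> int) \<Rightarrow> nat \<times> real \<Rightarrow> nat \<times> real \<Rightarrow> int" where
  "tvalue s T a p q = tsign T (fst p) {..<snd p} * (a (fst p) + tsum s T (fst p) {..<snd p}) +
    (if tjump s T p q = 1 then 1 else 0)"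

definition tangle_term :: "(int \<Rightarrow> int \<Rightarrow> int \<Rightarrow> laurent) \<Rightarrow> (nat \<Rightarrow> int) \<Rightarrow> tangle \<Rightarrow>
    (nat \<Rightarrow> int) \<Rightarrow> (nat \<Rightarrow> int) \<Rightarrow> nat \<times> real \<Rightarrow> nat \<times> real \<Rightarrow> laurent" where
  "tangle_term \<phi> s T a e p q = of_int (s (fst p) * s (fst q) * tsgn T p q) *
    \<phi> (tvalue s T a p q - tvalue s T a q p)
      (e (fst p) * tsign T (fst p) {..<snd p}) (e (fst q) * tsign T (fst q) {..<snd q})"

text \<open>K stands for the strands that lie on the component under consideration: the strands of
  one tangle may belong to any components.\<close>

definition tangle_sum :: "(int \<Rightarrow> int \<Rightarrow> int \<Rightarrow> laurent) \<Rightarrow> (nat \<Rightarrow> int) \<Rightarrow> tangle \<Rightarrow> nat set \<Rightarrow>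
    (nat \<Rightarrow> int) \<Rightarrow> (nat \<Rightarrow> int) \<Rightarrow> laurent" where
  "tangle_sum \<phi> s T K a e = (\<Sum>(p, q)\<in>tcross T.
    if p \<in> tovers T \<and> fst p \<in> K \<and> fst q \<in> K then tangle_term \<phi> s T a e p q else 0)"

text \<open>The finite check for a move, independent of its place in a diagram. It ranges over all
  orientations s, all distributions K of the strands and all colors a, e at the left ends.\<close>

definition compatible :: "tangle \<Rightarrow> tangle \<Rightarrow> bool" where
  "compatible T T' \<longleftrightarrow> (\<forall>s. (\<forall>k. s k \<in> {1, -1}) \<longrightarrow>
    (\<forall>k<length (strands T). tsign T k UNIV = tsign T' k UNIV \<and> tsum s T k UNIV = tsum s T' k UNIV) \<and>
    (\<forall>n \<phi> K a e. admissible n \<phi> \<and> (\<forall>k. e k \<in> {1, -1}) \<longrightarrow>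
      tangle_sum \<phi> s T K a e = tangle_sum \<phi> s T' K a e))"

lemma compatibleI:
  assumes "\<And>s k. (\<And>k. s k = 1 \<or> s k = -1) \<Longrightarrow> k < length (strands T) \<Longrightarrow>
      tsign T k UNIV = tsign T' k UNIV \<and> tsum s T k UNIV = tsum s T' k UNIV"
    and "\<And>s n \<phi> K a e. (\<And>k. s k = 1 \<or> s k = -1) \<Longrightarrow> admissible n \<phi> \<Longrightarrow> (\<And>k. e k = 1 \<or> e k = -1) \<Longrightarrow>
      tangle_sum \<phi> s T K a e = tangle_sum \<phi> s T' K a e"
  shows "compatible T T'"
  using assms unfolding compatible_def by blast

text \<open>Rewriting the sum over the symmetric relation lets \<open>sum_split\<close> serve this
  sum as well as \<open>defect_sum\<close>.\<close>

lemma crossings_sum: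
  assumes "twisted_diagram D"
  shows "(\<Sum>(p, q)\<in>crossings D. g p q) = (\<Sum>(p, q) | classical D p q. if p \<in> overs D then g p q else 0)"
proof -
  have "(\<Sum>x\<in>crossings D. case x of (p, q) \<Rightarrow> g p q) = (\<Sum>x\<in>crossings D. case x of (p, q) \<Rightarrow> if p \<in> overs D then g p q else 0)"
    by (rule sum.cong) (auto simp: crossings_def)
  also have "\<dots> = (\<Sum>(p, q) | classical D p q. if p \<in> overs D then g p q else 0)"
    by (rule sum.mono_neutral_left[OF crossed_finite(2)[OF assms] crossings_subset])
      (auto simp: crossings_def classical_def split: if_splits)
  finally show ?thesis .
qed

section \<open>Colors along the strands of a tangle\<close>

context tangle_in
begin

text \<open>Value before the parameter t when the strand is read from left to right, which for a
  negative half-width is against the component.\<close>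

definition at_start :: "(complex \<Rightarrow> 'a) \<Rightarrow> (complex \<Rightarrow> 'a) \<Rightarrow> nat \<Rightarrow> real \<Rightarrow> 'a" where
  "at_start l r k t = (if wid k > 0 then l else r) (cis (ctr k + wid k * t))"

definition at_end :: "(complex \<Rightarrow> 'a) \<Rightarrow> (complex \<Rightarrow> 'a) \<Rightarrow> nat \<Rightarrow> real \<Rightarrow> 'a" where
  "at_end l r k t = (if wid k > 0 then r else l) (cis (ctr k + wid k * t))"

lemma strand_germs:
  assumes g: "germs X l r" and w: "wid k \<noteq> 0"
  shows "\<forall>\<^sub>F x in at_right t. at_start l r k x = at_end l r k t \<and> at_end l r k x = at_end l r k t"
    and "\<forall>\<^sub>F x in at_left t. at_start l r k x = at_start l r k t \<and> at_end l r k x = at_start l r k t"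
proof -
  note right = germsD(1)[OF g, of "ctr k + wid k * t"] and left = germsD(2)[OF g, of "ctr k + wid k * t"]
  show "\<forall>\<^sub>F x in at_right t. at_start l r k x = at_end l r k t \<and> at_end l r k x = at_end l r k t"
    using affine_eventually(1)[OF _ right] affine_eventually(4)[OF _ left] w
    unfolding at_start_def at_end_def by (cases "wid k > 0") (auto elim!: eventually_mono)
  show "\<forall>\<^sub>F x in at_left t. at_start l r k x = at_start l r k t \<and> at_end l r k x = at_start l r k t"
    using affine_eventually(2)[OF _ left] affine_eventually(3)[OF _ right] w
    unfolding at_start_def at_end_def by (cases "wid k > 0") (auto elim!: eventually_mono)
qed

text \<open>Read backwards, the rule at a crossing has the opposite jump, which the sign of
  \<open>eps_loc\<close> compensates, and the rule at a bar is its own inverse.\<close>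

lemma strand_jump:
  assumes c: "colors n D i l r" and k: "k < N" "comp k = i" and t: "t \<in> {-1..1}"
  shows "((k, t), q) \<in> tcross T \<Longrightarrow> snd (at_end l r k t) = snd (at_start l r k t) \<and>
      [fst (at_end l r k t) = fst (at_start l r k t) + tjump orient T (k, t) q] (mod int n)"
    and "(k, t) \<in> tbars T \<Longrightarrow> snd (at_end l r k t) = - snd (at_start l r k t) \<and>
      [fst (at_end l r k t) = - fst (at_start l r k t)] (mod int n)"
    and "(k, t) \<notin> tbars T \<Longrightarrow> \<forall>q. ((k, t), q) \<notin> tcross T \<Longrightarrow> at_end l r k t = at_start l r k t"
proof -
  let ?z = "cis (ctr k + wid k * t)"
  have loc: "loc (k, t) = (i, ?z)" using k(2) by (simp add: loc_eq)
  {
    assume q: "((k, t), q) \<in> tcross T"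
    have "classical D (i, ?z) (loc q)" using tcross_range(7)[OF q] loc by simp
    then have 1: "snd (r ?z) = snd (l ?z)" "[fst (r ?z) = fst (l ?z) + eps D (loc (k, t)) (loc q)] (mod int n)"
      using c loc unfolding colors_def by auto
    show "snd (at_end l r k t) = snd (at_start l r k t) \<and>
      [fst (at_end l r k t) = fst (at_start l r k t) + tjump orient T (k, t) q] (mod int n)"
    proof (cases "wid k > 0")
      case True
      then show ?thesis using 1 unfolding eps_loc[OF q] by (simp add: at_end_def at_start_def orient_def)
    next
      case False
      have "[fst (r ?z) + tjump orient T (k, t) q =
          fst (l ?z) + - tjump orient T (k, t) q + tjump orient T (k, t) q] (mod int n)"
        using 1(2) False unfolding eps_loc[OF q] by (intro cong_add) (auto simp: orient_def)
      then show ?thesis using 1(1) False by (simp add: at_end_def at_start_def cong_sym)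
    qed
  }
  {
    assume "(k, t) \<in> tbars T"
    then have "(i, ?z) \<in> bars D" using loc_props(3)[OF k(1) t] loc by simp
    then have 1: "snd (r ?z) = - snd (l ?z)" "[fst (r ?z) = - fst (l ?z)] (mod int n)"
      using c unfolding colors_def by auto
    have "[- fst (r ?z) = - (- fst (l ?z))] (mod int n)" using 1(2) by (simp only: cong_minus_minus_iff)
    then show "snd (at_end l r k t) = - snd (at_start l r k t) \<and>
      [fst (at_end l r k t) = - fst (at_start l r k t)] (mod int n)"
      using 1 by (simp add: at_end_def at_start_def cong_sym)
  }
  assume no: "(k, t) \<notin> tbars T" "\<forall>q. ((k, t), q) \<notin> tcross T"
  have "loc (k, t) \<notin> bars D" using no(1) loc_props(3)[OF k(1) t] by blast
  moreover have "\<not> classical D (loc (k, t)) q" for q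
    using classical_loc_partner[of "(k, t)" q] no(2) k(1) t by auto
  ultimately have "?z \<notin> cuts D i" unfolding cuts_def loc by blast
  then show "at_end l r k t = at_start l r k t"
    using c germsD(3)[of "cuts D i" l r "ctr k + wid k * t"]
    unfolding colors_def at_end_def at_start_def by simp
qed

lemma tangle_finite: "finite (tbars T)" "finite (tcross T)"
  using tame by (auto simp: tame_def)

lemma step_cases:
  assumes "k < N" "t \<in> {-1..1}"
  obtains (cross) q where "((k, t), q) \<in> tcross T" "tsign T k {..t} = tsign T k {..<t}"
      "tsum s T k {..t} = tsum s T k {..<t} + tsign T k {..<t} * tjump s T (k, t) q"
  | (bar) "(k, t) \<in> tbars T" "tsign T k {..t} = - tsign T k {..<t}" "tsum s T k {..t} = tsum s T k {..<t}"
  | (none) "(k, t) \<notin> tbars T" "\<forall>q. ((k, t), q) \<notin> tcross T" "tsign T k {..t} = tsign T k {..<t}"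
      "tsum s T k {..t} = tsum s T k {..<t}"
proof (cases "(k, t) \<in> tbars T")
  case True
  then have "\<forall>q. ((k, t), q) \<notin> tcross T" using tbars_range(2)[OF assms(1)] by blast
  then show ?thesis using True bar tsign_step(1)[OF tangle_finite(1) True]
      tsum_step(2)[OF tangle_finite(2), of k t s] tcross_unique by blast
next
  case False
  show ?thesis
  proof (cases "\<exists>q. ((k, t), q) \<in> tcross T")
    case True
    then obtain q where q: "((k, t), q) \<in> tcross T" by blast
    show ?thesis
      by (rule cross[OF q tsign_step(2)[OF tangle_finite(1) False]
        tsum_step(1)[OF tangle_finite(2) _ q]]) (rule tcross_unique)
  next
    case no: False
    then show ?thesis using False none tsign_step(2)[OF tangle_finite(1) False]
      tsum_step(2)[OF tangle_finite(2), of k t s] tcross_unique by blast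
  qed
qed

lemma strand_color:
  assumes c: "colors n D i l r" and k: "k < N" "comp k = i" and t: "t \<in> {-1..1}"
  shows "snd (at_start l r k t) = snd (at_start l r k (-1)) * tsign T k {..<t}"
    and "[fst (at_start l r k t) = tsign T k {..<t} * (fst (at_start l r k (-1)) + tsum orient T k {..<t})] (mod int n)"
proof -
  \<comment> \<open>f undoes the bars and crossings in A. Applied to the color at t with everything
    before t, it returns the color at the left end.\<close>
  define f where "f x A = (tsign T k A * snd x, (tsign T k A * fst x - tsum orient T k A) mod int n)"
    for x :: "int \<times> int" and A
  have w: "wid k \<noteq> 0" using valid[OF k(1)] by auto
  note g = colorsD(1)[OF c]
  \<comment> \<open>Passing the parameter u itself enlarges the set of events from those before u to
    those up to u.\<close>
  have eq: "f (at_end l r k u) {..u} = f (at_start l r k u) {..<u}" if u: "u \<in> {-1..1}" for u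
    using k(1) u
  proof (cases rule: step_cases[where s = orient])
    case (cross q)
    note j = strand_jump(1)[OF c k u cross(1)]
    have "[tsign T k {..<u} * fst (at_end l r k u) - tsum orient T k {..u} =
        tsign T k {..<u} * (fst (at_start l r k u) + tjump orient T (k, u) q) - tsum orient T k {..u}] (mod int n)"
      using j by (intro cong_diff cong_mult) auto
    then show ?thesis using j by (simp add: f_def cross cong_def algebra_simps)
  next
    case bar
    note j = strand_jump(2)[OF c k u bar(1)]
    have "[- tsign T k {..<u} * fst (at_end l r k u) - tsum orient T k {..<u} =
        - tsign T k {..<u} * (- fst (at_start l r k u)) - tsum orient T k {..<u}] (mod int n)"
      using j by (intro cong_diff cong_mult) auto
    then show ?thesis using j by (simp add: f_def bar cong_def)
  next
    case none
    then show ?thesis using strand_jump(3)[OF c k u] by (simp add: f_def)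
  qed
  have fcong': "tsign T k A = tsign T k B \<and> tsum orient T k A = tsum orient T k B"
    if "A \<inter> events T = B \<inter> events T" for A B
    using events_cong[OF that] by blast
  have fcong: "f x A = f x B" if "A \<inter> events T = B \<inter> events T" for x A B
    using events_cong[OF that] by (simp add: f_def)
  have "f (at_start l r k t) {..<t} = f (at_start l r k (-1)) {..<-1}"
  proof (rule locally_const_imp_const[of "{-1..1}" "\<lambda>t. f (at_start l r k t) {..<t}"])
    fix u :: real assume u: "u \<in> {-1..1}"
    show "\<forall>\<^sub>F x in nhds u. f (at_start l r k x) {..<x} = f (at_start l r k u) {..<u}"
      unfolding eventually_nhds_split
    proof (intro conjI)
      show "\<forall>\<^sub>F x in at_left u. f (at_start l r k x) {..<x} = f (at_start l r k u) {..<u}"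
        using strand_germs(2)[OF g w, of u] threshold_left[OF events_tame(1)[OF tame], of u]
        by eventually_elim (metis fcong)
      show "\<forall>\<^sub>F x in at_right u. f (at_start l r k x) {..<x} = f (at_start l r k u) {..<u}"
        using strand_germs(1)[OF g w, of u] threshold_right[OF events_tame(1)[OF tame], of u]
        by eventually_elim (metis fcong eq[OF u])
    qed simp
  qed (use t in auto)
  \<comment> \<open>No event precedes the left end, so there the accumulated sign is 1 and the sum
    0.\<close>
  moreover have "{..<-1} \<inter> events T = {} \<inter> events T" using events_tame(2)[OF tame] by force
  then have "tsign T k {..<-1} = 1" "tsum orient T k {..<-1} = 0"
    using fcong'[of "{..<-1}" "{}"] by (simp_all add: tsign_def tsum_def case_prod_unfold)
  ultimately have *: "tsign T k {..<t} * snd (at_start l r k t) = snd (at_start l r k (-1))"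
    "[tsign T k {..<t} * fst (at_start l r k t) - tsum orient T k {..<t} = fst (at_start l r k (-1))] (mod int n)"
    by (simp_all add: f_def cong_def)
  show "snd (at_start l r k t) = snd (at_start l r k (-1)) * tsign T k {..<t}"
    unfolding *(1)[symmetric] by (simp add: mult.commute)
  have "[tsign T k {..<t} * (tsign T k {..<t} * fst (at_start l r k t) - tsum orient T k {..<t} + tsum orient T k {..<t}) =
      tsign T k {..<t} * (fst (at_start l r k (-1)) + tsum orient T k {..<t})] (mod int n)"
    by (intro cong_mult cong_add cong_refl *(2))
  then show "[fst (at_start l r k t) = tsign T k {..<t} * (fst (at_start l r k (-1)) + tsum orient T k {..<t})] (mod int n)"
    by simp
qed

text \<open>The start value a is fixed only up to congruence, so that the same a can later describe
  an unreduced and a reduced coloring.\<close>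

lemma crossing_color:
  assumes c: "colors n D i l r" and pq: "(p, q) \<in> tcross T" and i: "comp (fst p) = i"
    and a: "[a (fst p) = fst (at_start l r (fst p) (-1))] (mod int n)" and e: "e (fst p) = snd (at_start l r (fst p) (-1))"
  shows "snd (l (snd (loc p))) = e (fst p) * tsign T (fst p) {..<snd p}"
    and "[left_value D l (loc p) (loc q) = tvalue orient T a p q] (mod int n)"
proof -
  obtain k t where p: "p = (k, t)" by (cases p)
  note r = tcross_range[OF pq, unfolded p fst_conv snd_conv]
  have k: "k < N" "comp k = i" using r i p by auto
  note s = strand_color[OF c k r(5)]
  note j = strand_jump(1)[OF c k r(5) pq[unfolded p]]
  have l: "l (snd (loc p)) = (if wid k > 0 then at_start l r k t else at_end l r k t)"
    by (simp add: p loc_eq at_start_def at_end_def)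
  show "snd (l (snd (loc p))) = e (fst p) * tsign T (fst p) {..<snd p}"
    unfolding l using s(1) j e by (simp add: p)
  have 1: "[fst (at_start l r k t) = tsign T k {..<t} * (a k + tsum orient T k {..<t})] (mod int n)"
  proof (rule cong_trans[OF s(2)])
    show "[tsign T k {..<t} * (fst (at_start l r k (- 1)) + tsum orient T k {..<t}) =
        tsign T k {..<t} * (a k + tsum orient T k {..<t})] (mod int n)"
      using cong_sym[OF a] by (intro cong_mult cong_add) (auto simp: p)
  qed
  have pm: "tjump orient T (k, t) q \<in> {1, -1}"
    using orient_pm[of "fst q"] by (auto simp: tjump_def tsgn_def)
  have "[left_value D l (loc p) (loc q) = fst (at_start l r k t) + (if tjump orient T (k, t) q = 1 then 1 else 0)] (mod int n)"
  proof (cases "wid k > 0")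
    case True
    then show ?thesis unfolding left_value_def eps_loc[OF pq] l by (simp add: p orient_def)
  next
    case False
    \<comment> \<open>Here l is the value after the crossing in strand direction and
      \<open>eps\<close> is minus the jump; the larger of the two values is still the same.\<close>
    have "[fst (at_end l r k t) + (if tjump orient T (k, t) q = -1 then 1 else 0) =
        fst (at_start l r k t) + tjump orient T (k, t) q + (if tjump orient T (k, t) q = -1 then 1 else 0)] (mod int n)"
      using j by (intro cong_add) auto
    then show ?thesis using False pm unfolding left_value_def eps_loc[OF pq] l by (auto simp: p orient_def)
  qed
  also have "[fst (at_start l r k t) + (if tjump orient T (k, t) q = 1 then 1 else 0) = tvalue orient T a p q] (mod int n)"
    unfolding tvalue_def p fst_conv snd_conv using 1 by (intro cong_add) auto
  finally show "[left_value D l (loc p) (loc q) = tvalue orient T a p q] (mod int n)" .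
qed

text \<open>By \<open>double_inside\<close> it suffices to test one point of a pair.\<close>

lemma sum_split:
  "(\<Sum>(p, q) | classical D p q. g p q) =
    (\<Sum>(p, q) | classical D p q \<and> p \<notin> inside L. g p q) + (\<Sum>(p, q)\<in>tcross T. g (loc p) (loc q))"
proof -
  let ?O = "{(p, q). classical D p q \<and> p \<notin> inside L}" and ?I = "{(p, q). classical D p q \<and> p \<in> inside L}"
  have I: "?I = map_prod loc loc ` tcross T"
  proof (intro equalityI subsetI)
    fix x assume "x \<in> ?I"
    then obtain p q where x: "x = (p, q)" "classical D p q" "p \<in> inside L" by auto
    then obtain p' where p': "p = loc p'" "fst p' < N" "snd p' \<in> {-1..1}" unfolding loc_inside by auto
    with x classical_loc_partner[of p' q] show "x \<in> map_prod loc loc ` tcross T" by force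
  next
    fix x assume "x \<in> map_prod loc loc ` tcross T"
    then obtain p q where x: "x = (loc p, loc q)" "(p, q) \<in> tcross T" by auto
    have "loc p \<in> inside L" using tcross_range[OF x(2)] unfolding loc_inside by (cases p) auto
    then show "x \<in> ?I" using tcross_range(7)[OF x(2)] x by auto
  qed
  have inj: "inj_on (map_prod loc loc) (tcross T)"
  proof (rule inj_onI, clarify)
    fix p1 p2 q1 q2 assume 1: "(p1, p2) \<in> tcross T" "(q1, q2) \<in> tcross T"
      "map_prod loc loc (p1, p2) = map_prod loc loc (q1, q2)"
    then show "p1 = q1 \<and> p2 = q2" using loc_inj tcross_range[OF 1(1)] tcross_range[OF 1(2)] by simp
  qed
  have "{(p, q). classical D p q} = ?O \<union> ?I" by auto
  moreover have "finite ?O" "finite ?I"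
    by (rule finite_subset[OF _ crossed_finite(2)[OF D]]; auto)+
  moreover have "?O \<inter> ?I = {}" by auto
  ultimately have "(\<Sum>(p, q) | classical D p q. g p q) = (\<Sum>(p, q)\<in>?O. g p q) + (\<Sum>(p, q)\<in>?I. g p q)"
    by (metis (no_types, lifting) sum.union_disjoint)
  also have "(\<Sum>(p, q)\<in>?I. g p q) = (\<Sum>(p, q)\<in>tcross T. g (loc p) (loc q))"
    unfolding I sum.reindex[OF inj] by (rule sum.cong) auto
  finally show ?thesis .
qed

text \<open>The tangle contributes only through the sums over entire strands, which are among the
  data compared by \<open>compatible\<close>.\<close>

lemma defect_sum_split:
  assumes c: "colors n D i l r" and e: "\<And>k. k < N \<Longrightarrow> comp k = i \<Longrightarrow> e k = snd (at_start l r k (-1))"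
  shows "defect_sum D i (\<lambda>z. snd (l z)) =
    (\<Sum>(p, q) | classical D p q \<and> p \<notin> inside L. if fst p = i then snd (l (snd p)) * eps D p q else 0) +
    (\<Sum>k<N. if comp k = i then e k * orient k * tsum orient T k UNIV else 0)"
proof -
  let ?h = "\<lambda>k. if comp k = i then e k * orient k else 0"
  have "(\<Sum>(p, q)\<in>tcross T. if fst (loc p) = i then snd (l (snd (loc p))) * eps D (loc p) (loc q) else 0) =
      (\<Sum>(p, q)\<in>tcross T. ?h (fst p) * (tsign T (fst p) {..<snd p} * tjump orient T p q))"
  proof (rule sum.cong[OF refl])
    fix x assume "x \<in> tcross T"
    then obtain p q where x: "x = (p, q)" "(p, q) \<in> tcross T" by (cases x) auto
    have "fst (loc p) = comp (fst p)" by (cases p) (simp add: loc_eq)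
    moreover have "snd (l (snd (loc p))) = e (fst p) * tsign T (fst p) {..<snd p}" if "comp (fst p) = i"
      by (rule crossing_color(1)[OF c x(2) that, where a = "\<lambda>k. fst (at_start l r k (-1))"])
        (use e[OF tcross_range(1)[OF x(2)] that] in auto)
    ultimately show "(case x of (p, q) \<Rightarrow> if fst (loc p) = i then snd (l (snd (loc p))) * eps D (loc p) (loc q) else 0) =
      (case x of (p, q) \<Rightarrow> ?h (fst p) * (tsign T (fst p) {..<snd p} * tjump orient T p q))"
      using eps_loc[OF x(2)] by (simp add: x(1))
  qed
  \<comment> \<open>Every passage belongs to exactly one strand; inserting the sum over k allows an
    exchange of sums that collects \<open>tsum\<close> strand by strand.\<close>
  also have "\<dots> = (\<Sum>(p, q)\<in>tcross T. \<Sum>k<N. ?h k * (if fst p = k \<and> snd p \<in> UNIV then tsign T k {..<snd p} * tjump orient T p q else 0))"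
  proof (rule sum.cong[OF refl])
    fix x assume "x \<in> tcross T"
    then obtain p q where x: "x = (p, q)" "(p, q) \<in> tcross T" by (cases x) auto
    have "(\<Sum>k<N. ?h k * (if fst p = k \<and> snd p \<in> UNIV then tsign T k {..<snd p} * tjump orient T p q else 0)) =
        (\<Sum>k<N. if fst p = k then ?h (fst p) * (tsign T (fst p) {..<snd p} * tjump orient T p q) else 0)"
      by (rule sum.cong) auto
    also have "\<dots> = ?h (fst p) * (tsign T (fst p) {..<snd p} * tjump orient T p q)"
      using tcross_range(1)[OF x(2)] by (subst sum.delta') auto
    finally show "(case x of (p, q) \<Rightarrow> ?h (fst p) * (tsign T (fst p) {..<snd p} * tjump orient T p q)) =
      (case x of (p, q) \<Rightarrow> \<Sum>k<N. ?h k * (if fst p = k \<and> snd p \<in> UNIV then tsign T k {..<snd p} * tjump orient T p q else 0))"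
      by (simp add: x(1))
  qed
  also have "\<dots> = (\<Sum>k<N. ?h k * tsum orient T k UNIV)"
    unfolding tsum_def sum_distrib_left case_prod_unfold by (rule sum.swap)
  also have "\<dots> = (\<Sum>k<N. if comp k = i then e k * orient k * tsum orient T k UNIV else 0)"
    by (rule sum.cong) auto
  finally show ?thesis unfolding defect_sum_def by (subst sum_split) simp
qed

lemma crossing_sum_split:
  assumes c: "colors n D i l r" and \<phi>: "admissible n \<phi>"
    and e: "\<And>k. k < N \<Longrightarrow> comp k = i \<Longrightarrow> e k = snd (at_start l r k (-1))"
    and a: "\<And>k. k < N \<Longrightarrow> comp k = i \<Longrightarrow> [a k = fst (at_start l r k (-1))] (mod int n)"
  shows "crossing_sum \<phi> D i l =
    (\<Sum>(p, q) | classical D p q \<and> p \<notin> inside L. if p \<in> overs D then crossing_term \<phi> D i l p q else 0) +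
    tangle_sum \<phi> orient T {k. comp k = i} a e"
proof -
  have "(\<Sum>(p, q)\<in>tcross T. if loc p \<in> overs D then crossing_term \<phi> D i l (loc p) (loc q) else 0) =
      tangle_sum \<phi> orient T {k. comp k = i} a e"
    unfolding tangle_sum_def
  proof (rule sum.cong[OF refl])
    fix x assume "x \<in> tcross T"
    then obtain p q where x: "x = (p, q)" "(p, q) \<in> tcross T" by (cases x) auto
    note x' = tcross_sym[OF x(2)]
    have f: "fst (loc y) = comp (fst y)" for y by (cases y) (simp add: loc_eq)
    have over: "loc p \<in> overs D \<longleftrightarrow> p \<in> tovers T"
      using loc_props(2)[OF tcross_range(1,5)[OF x(2)]] by simp
    have sgn: "- eps D (loc p) (loc q) = orient (fst p) * orient (fst q) * tsgn T p q"
      unfolding eps_loc[OF x(2)] by (simp add: tjump_def)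
    have "crossing_term \<phi> D i l (loc p) (loc q) = tangle_term \<phi> orient T a e p q"
      if i: "comp (fst p) = i" "comp (fst q) = i"
    proof -
      note p = crossing_color[where a = a and e = e, OF c x(2) i(1)
          a[OF tcross_range(1)[OF x(2)] i(1)] e[OF tcross_range(1)[OF x(2)] i(1)]]
      note q = crossing_color[where a = a and e = e, OF c x' i(2)
          a[OF tcross_range(1)[OF x'] i(2)] e[OF tcross_range(1)[OF x'] i(2)]]
      have "\<phi> (left_value D l (loc p) (loc q) - left_value D l (loc q) (loc p)) u v =
          \<phi> (tvalue orient T a p q - tvalue orient T a q p) u v" for u v
        using \<phi> cong_diff[OF p(2) q(2)] unfolding admissible_def by blast
      then show ?thesis using i p(1) q(1) by (simp add: crossing_term_def tangle_term_def f sgn)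
    qed
    then show "(case x of (p, q) \<Rightarrow> if loc p \<in> overs D then crossing_term \<phi> D i l (loc p) (loc q) else 0) =
      (case x of (p, q) \<Rightarrow> if p \<in> tovers T \<and> fst p \<in> {k. comp k = i} \<and> fst q \<in> {k. comp k = i}
        then tangle_term \<phi> orient T a e p q else 0)"
      by (auto simp: x(1) over f crossing_term_def)
  qed
  then show ?thesis unfolding crossing_sum_def crossings_sum[OF D] by (subst sum_split) simp
qed

end

section \<open>Replacing a tangle\<close>

text \<open>The angle of a point and the angle given by the location of a strand may differ by full
  turns.\<close>

lemma eventually_cis_cong:
  assumes "cis \<theta> = cis \<theta>'"
  shows "(\<forall>\<^sub>F x in at_right \<theta>. P (cis x)) \<longleftrightarrow> (\<forall>\<^sub>F x in at_right \<theta>'. P (cis x))"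
    and "(\<forall>\<^sub>F x in at_left \<theta>. P (cis x)) \<longleftrightarrow> (\<forall>\<^sub>F x in at_left \<theta>'. P (cis x))"
proof -
  have eq: "cis (\<theta> + s * \<epsilon>) = cis (\<theta>' + s * \<epsilon>)" for s \<epsilon>
    using assms by (simp flip: cis_mult)
  show "(\<forall>\<^sub>F x in at_right \<theta>. P (cis x)) \<longleftrightarrow> (\<forall>\<^sub>F x in at_right \<theta>'. P (cis x))"
    unfolding at_right_shift[of _ \<theta>] at_right_shift[of _ \<theta>'] eq ..
  show "(\<forall>\<^sub>F x in at_left \<theta>. P (cis x)) \<longleftrightarrow> (\<forall>\<^sub>F x in at_left \<theta>'. P (cis x))"
    unfolding at_left_shift[of _ \<theta>] at_left_shift[of _ \<theta>'] eq ..
qed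

context tangle_in
begin

lemma inside_closed: "closed {z. (i, z) \<in> inside L}" (is "closed ?S")
proof -
  have "?S = (\<Union>k\<in>{k. k < N \<and> comp k = i}. (\<lambda>t. cis (ctr k + wid k * t)) ` {-1..1})"
    unfolding loc_inside by (force simp: loc_eq)
  moreover have "compact ((\<lambda>t. cis (ctr k + wid k * t)) ` {-1..1})" for k
    by (intro compact_continuous_image continuous_intros) auto
  ultimately show ?thesis by (auto intro!: compact_imp_closed compact_UN)
qed

lemma outside_nhds:
  assumes "(i, cis \<theta>) \<notin> inside L"
  shows "\<forall>\<^sub>F x in nhds \<theta>. (i, cis x) \<notin> inside L"
proof -
  have "continuous_on UNIV (\<lambda>x::real. cis x)" by (intro continuous_intros)
  then have "closed (cis -` {z. (i, z) \<in> inside L})"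
    using inside_closed continuous_closed_vimage[of "{z. (i, z) \<in> inside L}" "\<lambda>x::real. cis x"]
    by (auto simp: continuous_on_eq_continuous_at vimage_def)
  then have "open (- (cis -` {z. (i, z) \<in> inside L}))" by auto
  from eventually_nhds_in_open[OF this, of \<theta>] assms show ?thesis by auto
qed

text \<open>Past its end a strand runs outside the tangle: the arcs of the other strands are closed
  and miss the end point by injectivity, and the half-width below pi keeps the strand from closing
  up with itself.\<close>

lemma beyond_end:
  assumes k: "k < N" "comp k = i"
  shows "\<forall>\<^sub>F x in at_right 1. (i, cis (ctr k + wid k * x)) \<notin> inside L"
    and "\<forall>\<^sub>F x in at_left (-1). (i, cis (ctr k + wid k * x)) \<notin> inside L"
proof -
  have w: "wid k \<noteq> 0" "\<bar>wid k\<bar> < pi" using valid[OF k(1)] by auto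
  let ?S = "\<Union>m\<in>{m. m < N \<and> m \<noteq> k \<and> comp m = i}. (\<lambda>t. cis (ctr m + wid m * t)) ` {-1..1}"
  define f where "f x = cis (ctr k + wid k * x)" for x
  have in_iff: "(i, z) \<in> inside L \<longleftrightarrow> z \<in> ?S \<or> z \<in> f ` {-1..1}" for z
  proof -
    have "(i, z) \<in> inside L \<longleftrightarrow> (\<exists>m. m < N \<and> comp m = i \<and> (\<exists>t\<in>{-1..1}. z = cis (ctr m + wid m * t)))"
    proof
      assume "(i, z) \<in> inside L"
      then obtain m t where "m < N" "t \<in> {-1..1}" "(i, z) = loc (m, t)" unfolding loc_inside by auto
      then show "\<exists>m. m < N \<and> comp m = i \<and> (\<exists>t\<in>{-1..1}. z = cis (ctr m + wid m * t))"
        by (intro exI[of _ m]) (auto simp: loc_eq)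
    next
      assume "\<exists>m. m < N \<and> comp m = i \<and> (\<exists>t\<in>{-1..1}. z = cis (ctr m + wid m * t))"
      then obtain m t where "m < N" "comp m = i" "t \<in> {-1..1}" "z = cis (ctr m + wid m * t)" by blast
      then show "(i, z) \<in> inside L" unfolding loc_inside by (intro image_eqI[of _ _ "(m, t)"]) (auto simp: loc_eq)
    qed
    also have "\<dots> \<longleftrightarrow> z \<in> ?S \<or> z \<in> f ` {-1..1}"
      using k unfolding f_def image_iff UN_iff mem_Collect_eq by blast
    finally show ?thesis .
  qed
  have "compact ((\<lambda>t. cis (ctr m + wid m * t)) ` {-1..1})" for m
    by (intro compact_continuous_image continuous_intros) auto
  then have cl: "closed ?S" by (auto intro!: compact_imp_closed compact_UN)
  have notS: "f x \<notin> ?S" if "x \<in> {-1..1}" for x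
  proof
    assume "f x \<in> ?S"
    then obtain m t where "m < N" "m \<noteq> k" "comp m = i" "t \<in> {-1..1}" "f x = cis (ctr m + wid m * t)" by auto
    then show False using loc_inj[of "(k, x)" "(m, t)"] k that by (auto simp: loc_eq f_def)
  qed
  \<comment> \<open>For |x| < 1 + \<delta> and |u| <= 1 one has |x - u| < 2 + \<delta> < 2 * pi /
    |wid k|, less than a full turn in the angle. Positivity of \<delta> is the bound |wid k| <
    pi.\<close>
  define \<delta> where "\<delta> = pi / \<bar>wid k\<bar> - 1"
  have \<delta>: "\<delta> > 0" using w by (simp add: \<delta>_def field_simps)
  have near: "\<forall>\<^sub>F x in at u within A. f x \<notin> ?S" if "u \<in> {-1..1}" for u A
  proof (rule topological_tendstoD[of f "f u" _ "- ?S", simplified Compl_iff])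
    show "(f \<longlongrightarrow> f u) (at u within A)" unfolding f_def by (intro tendsto_intros)
    show "open (- ?S)" using cl by (rule open_Compl)
    show "f u \<notin> ?S" by (rule notS[OF that])
  qed
  have own: "f x \<notin> f ` {-1..1}" if "x \<notin> {-1..1}" "\<bar>x\<bar> < 1 + \<delta>" for x
  proof
    assume "f x \<in> f ` {-1..1}"
    then obtain u where u: "u \<in> {-1..1}" "f x = f u" by auto
    have "\<bar>x - u\<bar> < 2 * pi / \<bar>wid k\<bar>" using that u(1) \<delta> by (auto simp: \<delta>_def)
    then have "\<bar>ctr k + wid k * x - (ctr k + wid k * u)\<bar> < 2 * pi"
      using w abs_mult[of "wid k" "x - u"] by (simp add: field_simps)
    then have "wid k * x = wid k * u" using cis_inj_close u(2) unfolding f_def by fastforce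
    then show False using that u w by auto
  qed
  have "\<forall>\<^sub>F x in at_right 1. x \<in> {1<..<1 + \<delta>}" using \<delta> by (intro eventually_at_right_real) auto
  then show "\<forall>\<^sub>F x in at_right 1. (i, cis (ctr k + wid k * x)) \<notin> inside L"
    using near[of 1 "{1<..}", simplified] unfolding in_iff f_def[symmetric]
    by eventually_elim (use own in auto)
  have "\<forall>\<^sub>F x in at_left (-1). x \<in> {-1 - \<delta><..<-1}" using \<delta> by (intro eventually_at_left_real) auto
  then show "\<forall>\<^sub>F x in at_left (-1). (i, cis (ctr k + wid k * x)) \<notin> inside L"
    using near[of "-1" "{..<-1}", simplified] unfolding in_iff f_def[symmetric]
    by eventually_elim (use own in auto)
qed

end

section \<open>Diagrams that differ in one tangle\<close>

locale tangle_swap = A: tangle_in D T L + B: tangle_in D' T' L for D T D' T' L +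
  assumes same_ncomp: "ncomp D' = ncomp D"
    and same: "\<And>p. p \<in> points D - inside L \<Longrightarrow> pos D' p = pos D p \<and>
        (p \<in> overs D' \<longleftrightarrow> p \<in> overs D) \<and> (p \<in> bars D' \<longleftrightarrow> p \<in> bars D)"
    and compatible: "compatible T T'"
begin

abbreviation N where "N \<equiv> length L"

lemma points_eq: "points D' = points D"
  by (simp add: points_def same_ncomp)

lemma double_outside:
  assumes "p \<notin> inside L" shows "double D' p q \<longleftrightarrow> double D p q"
proof -
  have "double D' p q \<longleftrightarrow> double D p q" if "q \<notin> inside L"
    using same[of p] same[of q] assms that unfolding double_def points_eq by auto
  then show ?thesis using A.double_inside B.double_inside assms by blast
qed

lemma classical_outside:
  assumes "p \<notin> inside L" shows "classical D' p q \<longleftrightarrow> classical D p q"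
proof -
  have "(p \<in> overs D' \<or> q \<in> overs D') \<longleftrightarrow> (p \<in> overs D \<or> q \<in> overs D)" if "double D p q"
  proof -
    have "q \<notin> inside L" "p \<in> points D" "q \<in> points D"
      using that A.double_inside[of p q] assms unfolding double_def by blast+
    then show ?thesis using same[of p] same[of q] assms by blast
  qed
  then show ?thesis unfolding classical_def double_outside[OF assms] by blast
qed

text \<open>The inside is closed, so the two curves agree on a whole neighbourhood and not just at
  p.\<close>

lemma vel_outside:
  assumes "p \<in> points D" "p \<notin> inside L" shows "vel D' p = vel D p"
proof -
  have "fst p \<in> {1..ncomp D}" "snd p \<in> sphere 0 1" using assms(1) by (auto simp: points_def)
  obtain \<theta> where "snd p = cis \<theta>" using sphere_cisE[OF \<open>snd p \<in> sphere 0 1\<close>] .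
  then obtain i where p: "p = (i, cis \<theta>)" "i \<in> {1..ncomp D}"
    using \<open>fst p \<in> {1..ncomp D}\<close> by (metis prod.collapse)
  have ev: "\<forall>\<^sub>F x in nhds \<theta>. crv D' i (cis x) = crv D i (cis x)"
    using A.outside_nhds[OF assms(2)[unfolded p(1)]]
  proof eventually_elim
    case (elim x)
    then have "(i, cis x) \<in> points D - inside L" using p(2) by (auto simp: points_def)
    then show ?case using same unfolding pos_def by fastforce
  qed
  have "((\<lambda>x. crv D' i (cis x)) has_vector_derivative vel D (i, cis \<theta>)) (at \<theta>)"
    by (rule has_vector_derivative_cong_ev[THEN iffD2, OF _ _ has_vel[OF A.D p(2)]])
      (use ev eventually_nhds_x_imp_x[OF ev] in \<open>auto elim: eventually_mono\<close>)
  then show ?thesis using vel_unique[OF B.D] p same_ncomp by auto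
qed

lemma eps_outside:
  assumes "double D p q" "p \<notin> inside L" shows "eps D' p q = eps D p q"
proof -
  have "q \<notin> inside L" "p \<in> points D" "q \<in> points D"
    using A.double_inside[of p q] assms unfolding double_def by blast+
  then show ?thesis using assms(2) vel_outside by (intro eps_sgn) simp
qed

end

section \<open>The coloring carried over to the new tangle\<close>

locale colored_swap = tangle_swap +
  fixes n i l r
  assumes i: "i \<in> {1..ncomp D}" and colors: "colors n D i l r"
begin

definition a where "a k = fst (A.at_start l r k (-1))"
text \<open>Strands of other components receive the default 1, because \<open>compatible\<close>
  expects a sign for every strand.\<close>

definition e where "e k = (if A.comp k = i then snd (A.at_start l r k (-1)) else 1)"
text \<open>The color forced on strand k of the new tangle by its old left end, once the events in X
  have been passed.\<close>

definition F where "F k X = ((tsign T' k X * (a k + tsum A.orient T' k X)) mod int n, e k * tsign T' k X)"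
text \<open>At the right end the forced and the old color are only congruent, while germs require
  equality; the same residues are therefore used inside and outside.\<close>

definition reduced where "reduced x = (fst x mod int n, snd x)" for x :: "int \<times> int"

definition param where "param z = (SOME p. fst p < N \<and> snd p \<in> {-1..1} \<and> A.loc p = (i, z))"

text \<open>Against the component, a strand is reached from its right end, so its events up to and
  including the parameter are those counted on arrival.\<close>

definition new_l where "new_l z = (if (i, z) \<in> inside L
  then F (fst (param z)) (if A.wid (fst (param z)) > 0 then {..<snd (param z)} else {..snd (param z)})
  else reduced (l z))"

definition new_r where "new_r z = (if (i, z) \<in> inside L
  then F (fst (param z)) (if A.wid (fst (param z)) > 0 then {..snd (param z)} else {..<snd (param z)})
  else reduced (r z))"

lemma param_eq:
  assumes "k < N" "A.comp k = i" "t \<in> {-1..1}"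
  shows "param (cis (A.ctr k + A.wid k * t)) = (k, t)" "(i, cis (A.ctr k + A.wid k * t)) \<in> inside L"
proof -
  have loc: "A.loc (k, t) = (i, cis (A.ctr k + A.wid k * t))" using assms(2) by (simp add: A.loc_eq)
  show "(i, cis (A.ctr k + A.wid k * t)) \<in> inside L"
    unfolding A.loc_inside loc[symmetric] using assms by auto
  have ex: "fst (k, t) < N \<and> snd (k, t) \<in> {-1..1} \<and> A.loc (k, t) = (i, cis (A.ctr k + A.wid k * t))"
    using assms loc by auto
  from someI[of "\<lambda>p. fst p < N \<and> snd p \<in> {-1..1} \<and> A.loc p = (i, cis (A.ctr k + A.wid k * t))", OF ex]
  show "param (cis (A.ctr k + A.wid k * t)) = (k, t)"
    unfolding param_def using A.loc_inj[of _ "(k, t)"] assms loc by auto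
qed

lemma on_strand:
  assumes "k < N" "A.comp k = i" "t \<in> {-1..1}"
  shows "A.at_start new_l new_r k t = F k {..<t}" "A.at_end new_l new_r k t = F k {..t}"
  using param_eq[OF assms] by (auto simp: A.at_start_def A.at_end_def new_l_def new_r_def)

lemma F_cong: "X \<inter> events T' = Y \<inter> events T' \<Longrightarrow> F k X = F k Y"
  using events_cong[of X T' Y] by (simp add: F_def)

lemma no_event_at_ends: "A.at_end l r k (-1) = A.at_start l r k (-1)" "A.at_end l r k 1 = A.at_start l r k 1"
  if "k < N" "A.comp k = i"
proof -
  have "(k, t) \<notin> tbars T \<and> (\<forall>q. ((k, t), q) \<notin> tcross T)" if "t \<in> {-1, 1}" for t
    using that A.tbars_range(1)[OF \<open>k < N\<close>, of t] A.tcross_range(3) by fastforce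
  then show "A.at_end l r k (-1) = A.at_start l r k (-1)" "A.at_end l r k 1 = A.at_start l r k 1"
    using A.strand_jump(3)[OF colors that, of "-1"] A.strand_jump(3)[OF colors that, of 1] by auto
qed

lemma start_value:
  assumes "k < N" "A.comp k = i"
  shows "reduced (A.at_start l r k (-1)) = F k {}"
  using assms by (simp add: reduced_def F_def a_def e_def tsign_def tsum_def case_prod_unfold)

text \<open>The gluing condition: equality of \<open>tsign\<close> and \<open>tsum\<close> over
  whole strands makes the old color at the right end fit the new strand.\<close>

lemma end_value:
  assumes "k < N" "A.comp k = i"
  shows "reduced (A.at_start l r k 1) = F k UNIV"
proof -
  have E: "{..<1} \<inter> events T = UNIV \<inter> events T" using events_tame(2)[OF A.tame] by auto
  have "tsign T k UNIV = tsign T' k UNIV \<and> tsum A.orient T k UNIV = tsum A.orient T' k UNIV"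
    using compatible A.orient_pm assms(1) unfolding compatible_def A.length_strands by blast
  then show ?thesis
    using A.strand_color[OF colors assms, of 1] events_cong[OF E] assms(2)
    by (simp add: reduced_def F_def a_def e_def cong_def)
qed

text \<open>The formula F persists slightly beyond both ends: there the reduced old color equals F
  for no events or for all events. The ends thus need no separate treatment as germs.\<close>

lemma near_strand:
  assumes k: "k < N" "A.comp k = i" and t: "t \<in> {-1..1}"
  shows "\<forall>\<^sub>F x in nhds t. A.at_start new_l new_r k x = F k {..<x} \<and> A.at_end new_l new_r k x = F k {..x}"
    (is "eventually ?P _")
proof -
  have w: "A.wid k \<noteq> 0" using A.valid[OF k(1)] by auto
  note g = colorsD(1)[OF colors]
  have new: "A.at_start new_l new_r k x = reduced (A.at_start l r k x)"
    "A.at_end new_l new_r k x = reduced (A.at_end l r k x)"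
    if "(i, cis (A.ctr k + A.wid k * x)) \<notin> inside L" for x
    using that by (auto simp: A.at_start_def A.at_end_def new_l_def new_r_def)
  have in_int: "?P x" if "x \<in> {-1..1}" for x using on_strand[OF k that] by blast
  have ev: "events T' \<subseteq> {-1<..<1}" by (rule events_tame(2)[OF B.tame])
  have right: "eventually ?P (at_right t)"
  proof (cases "t = 1")
    case False
    have "\<forall>\<^sub>F x in at_right t. x \<in> {t<..<1}" using False t by (intro eventually_at_right_real) auto
    then show ?thesis by eventually_elim (rule in_int, use t in auto)
  next
    case True
    have x1: "\<forall>\<^sub>F x in at_right 1. x > (1::real)" by (simp add: eventually_at_filter)
    show ?thesis unfolding True
      using A.beyond_end(1)[OF k] A.strand_germs(1)[OF g w, of 1] x1
    proof eventually_elim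
      case (elim x)
      have "{..<x} \<inter> events T' = UNIV \<inter> events T'" "{..x} \<inter> events T' = UNIV \<inter> events T'"
        using ev elim(3) by auto
      then have "F k {..<x} = F k UNIV" "F k {..x} = F k UNIV" by (intro F_cong; simp)+
      then show ?case using new[OF elim(1)] elim(2) no_event_at_ends(2)[OF k] end_value[OF k] by simp
    qed
  qed
  have left: "eventually ?P (at_left t)"
  proof (cases "t = -1")
    case False
    have "\<forall>\<^sub>F x in at_left t. x \<in> {-1<..<t}" using False t by (intro eventually_at_left_real) auto
    then show ?thesis by eventually_elim (rule in_int, use t in auto)
  next
    case True
    have x1: "\<forall>\<^sub>F x in at_left (-1). x < (-1::real)" by (simp add: eventually_at_filter)
    show ?thesis unfolding True
      using A.beyond_end(2)[OF k] A.strand_germs(2)[OF g w, of "-1"] x1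
    proof eventually_elim
      case (elim x)
      have "{..<x} \<inter> events T' = {} \<inter> events T'" "{..x} \<inter> events T' = {} \<inter> events T'"
        using ev elim(3) by auto
      then have "F k {..<x} = F k {}" "F k {..x} = F k {}" by (intro F_cong; simp)+
      then show ?case using new[OF elim(1)] elim(2) start_value[OF k] by simp
    qed
  qed
  show ?thesis unfolding eventually_nhds_split using left right in_int[OF t] by blast
qed

lemma strand_line_germs:
  assumes k: "k < N" "A.comp k = i" and t: "t \<in> {-1..1}"
  shows "\<forall>\<^sub>F x in at_right t. A.at_start new_l new_r k x = F k {..t} \<and> A.at_end new_l new_r k x = F k {..t}"
    and "\<forall>\<^sub>F x in at_left t. A.at_start new_l new_r k x = F k {..<t} \<and> A.at_end new_l new_r k x = F k {..<t}"
proof -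
  note E = events_tame(1)[OF B.tame]
  have r: "\<forall>\<^sub>F x in at_right t. A.at_start new_l new_r k x = F k {..<x} \<and> A.at_end new_l new_r k x = F k {..x}"
    and l: "\<forall>\<^sub>F x in at_left t. A.at_start new_l new_r k x = F k {..<x} \<and> A.at_end new_l new_r k x = F k {..x}"
    using near_strand[OF assms] unfolding eventually_nhds_split by blast+
  show "\<forall>\<^sub>F x in at_right t. A.at_start new_l new_r k x = F k {..t} \<and> A.at_end new_l new_r k x = F k {..t}"
    using r threshold_right[OF E, of t] by eventually_elim (metis F_cong)
  show "\<forall>\<^sub>F x in at_left t. A.at_start new_l new_r k x = F k {..<t} \<and> A.at_end new_l new_r k x = F k {..<t}"
    using l threshold_left[OF E, of t] by eventually_elim (metis F_cong)
qed

text \<open>The converse of \<open>strand_jump\<close>: the accumulated sign and sum were designed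
  so that F obeys the coloring rules.\<close>

lemma F_step:
  assumes k: "k < N" and t: "t \<in> {-1..1}"
  shows "((k, t), q) \<in> tcross T' \<Longrightarrow> snd (F k {..t}) = snd (F k {..<t}) \<and>
      [fst (F k {..t}) = fst (F k {..<t}) + tjump A.orient T' (k, t) q] (mod int n)"
    and "(k, t) \<in> tbars T' \<Longrightarrow> snd (F k {..t}) = - snd (F k {..<t}) \<and>
      [fst (F k {..t}) = - fst (F k {..<t})] (mod int n)"
    and "(k, t) \<notin> tbars T' \<Longrightarrow> \<forall>q. ((k, t), q) \<notin> tcross T' \<Longrightarrow> F k {..t} = F k {..<t}"
proof -
  note steps = B.step_cases[where s = A.orient, OF k t]
  show "snd (F k {..t}) = snd (F k {..<t}) \<and>
      [fst (F k {..t}) = fst (F k {..<t}) + tjump A.orient T' (k, t) q] (mod int n)"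
    if q: "((k, t), q) \<in> tcross T'"
  proof (cases rule: steps)
    case (1 q')
    then have "q' = q" using q B.tcross_unique by blast
    then show ?thesis by (simp add: F_def 1 cong_def mod_add_right_eq algebra_simps)
  qed (use q B.tbars_range(2)[OF k] in blast)+
  show "snd (F k {..t}) = - snd (F k {..<t}) \<and> [fst (F k {..t}) = - fst (F k {..<t})] (mod int n)"
    if b: "(k, t) \<in> tbars T'"
  proof (cases rule: steps)
    case 2
    then show ?thesis by (simp add: F_def cong_def mod_minus_eq)
  qed (use b B.tbars_range(2)[OF k] in blast)+
  show "F k {..t} = F k {..<t}" if "(k, t) \<notin> tbars T'" "\<forall>q. ((k, t), q) \<notin> tcross T'"
  proof (cases rule: steps)
    case 3
    then show ?thesis by (simp add: F_def)
  qed (use that in blast)+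
qed

lemma inside_strand:
  assumes "(i, z) \<in> inside L"
  obtains k t where "k < N" "A.comp k = i" "t \<in> {-1..1}" "z = cis (A.ctr k + A.wid k * t)" "A.loc (k, t) = (i, z)"
  using assms unfolding A.loc_inside by (auto simp: A.loc_eq)

lemma new_germs: "germs (cuts D' i) new_l new_r"
  unfolding germs_def
proof
  fix \<theta>
  note g = colorsD(1)[OF colors]
  show "(\<forall>\<^sub>F x in at_right \<theta>. new_l (cis x) = new_r (cis \<theta>) \<and> new_r (cis x) = new_r (cis \<theta>)) \<and>
    (\<forall>\<^sub>F x in at_left \<theta>. new_l (cis x) = new_l (cis \<theta>) \<and> new_r (cis x) = new_l (cis \<theta>)) \<and>
    (cis \<theta> \<notin> cuts D' i \<longrightarrow> new_l (cis \<theta>) = new_r (cis \<theta>))"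
  proof (cases "(i, cis \<theta>) \<in> inside L")
    case False
    have new: "new_l (cis x) = reduced (l (cis x))" "new_r (cis x) = reduced (r (cis x))"
      if "(i, cis x) \<notin> inside L" for x
      using that by (auto simp: new_l_def new_r_def)
    have out: "\<forall>\<^sub>F x in at_right \<theta>. (i, cis x) \<notin> inside L" "\<forall>\<^sub>F x in at_left \<theta>. (i, cis x) \<notin> inside L"
      using A.outside_nhds[OF False] unfolding eventually_nhds_split by auto
    have "cis \<theta> \<notin> cuts D i" if "cis \<theta> \<notin> cuts D' i"
    proof -
      have "(i, cis \<theta>) \<in> points D - inside L" using i False by (auto simp: points_def)
      then show ?thesis using that same[of "(i, cis \<theta>)"] classical_outside[OF False] unfolding cuts_def by blast
    qed
    moreover have "\<forall>\<^sub>F x in at_right \<theta>. new_l (cis x) = new_r (cis \<theta>) \<and> new_r (cis x) = new_r (cis \<theta>)"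
      using out(1) germsD(1)[OF g, of \<theta>] by eventually_elim (simp add: new new[OF False])
    moreover have "\<forall>\<^sub>F x in at_left \<theta>. new_l (cis x) = new_l (cis \<theta>) \<and> new_r (cis x) = new_l (cis \<theta>)"
      using out(2) germsD(2)[OF g, of \<theta>] by eventually_elim (simp add: new new[OF False])
    ultimately show ?thesis using germsD(3)[OF g, of \<theta>] by (auto simp: new[OF False])
  next
    case True
    then obtain k t where k: "k < N" "A.comp k = i" and t: "t \<in> {-1..1}"
      and z: "cis \<theta> = cis (A.ctr k + A.wid k * t)" and loc: "A.loc (k, t) = (i, cis \<theta>)"
      by (rule inside_strand)
    define w c where "w = A.wid k" and "c = A.ctr k"
    have w: "w \<noteq> 0" using A.valid[OF k(1)] by (auto simp: w_def)
    \<comment> \<open>The germs R and Lf are in the strand parameter. The affine map of slope 1 / w,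
      inverse to the parametrization, turns them into germs at the angle y, exchanging sides if w <
      0.\<close>
    define y where "y = c + w * t"
    have y: "- c / w + (1 / w) * y = t" using w by (simp add: y_def field_simps)
    have undo: "c + w * (- c / w + (1 / w) * x) = x" for x using w by (simp add: field_simps)
    have start': "A.at_start new_l new_r k (- c / w + (1 / w) * x) = (if w > 0 then new_l else new_r) (cis x)"
      and finish': "A.at_end new_l new_r k (- c / w + (1 / w) * x) = (if w > 0 then new_r else new_l) (cis x)" for x
      unfolding A.at_start_def A.at_end_def c_def[symmetric] w_def[symmetric] undo by auto
    note R = strand_line_germs(1)[OF k t] and Lf = strand_line_germs(2)[OF k t]
    have R': "\<forall>\<^sub>F x in (if w > 0 then at_right y else at_left y). new_l (cis x) = F k {..t} \<and> new_r (cis x) = F k {..t}"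
      using affine_eventually(1)[where c = "- c / w" and w = "1 / w" and t = y, unfolded y, OF _ R, unfolded start' finish']
        affine_eventually(3)[where c = "- c / w" and w = "1 / w" and t = y, unfolded y, OF _ R, unfolded start' finish'] w
      by (cases "w > 0") (auto elim: eventually_mono)
    have L': "\<forall>\<^sub>F x in (if w > 0 then at_left y else at_right y). new_l (cis x) = F k {..<t} \<and> new_r (cis x) = F k {..<t}"
      using affine_eventually(2)[where c = "- c / w" and w = "1 / w" and t = y, unfolded y, OF _ Lf, unfolded start' finish']
        affine_eventually(4)[where c = "- c / w" and w = "1 / w" and t = y, unfolded y, OF _ Lf, unfolded start' finish'] w
      by (cases "w > 0") (auto elim: eventually_mono)
    have val: "new_l (cis \<theta>) = F k (if w > 0 then {..<t} else {..t})" "new_r (cis \<theta>) = F k (if w > 0 then {..t} else {..<t})"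
      using param_eq[OF k t] unfolding z by (auto simp: new_l_def new_r_def w_def)
    have zy: "cis \<theta> = cis y" unfolding z y_def c_def w_def ..
    have "new_l (cis \<theta>) = new_r (cis \<theta>)" if "cis \<theta> \<notin> cuts D' i"
    proof -
      have "(k, t) \<notin> tbars T'" using that B.loc_props(3)[OF k(1) t] loc unfolding cuts_def by auto
      moreover have "((k, t), q) \<notin> tcross T'" for q
        using that B.tcross_range(7)[of "(k, t)" q] loc unfolding cuts_def by auto
      ultimately show ?thesis using F_step(3)[OF k(1) t] by (simp add: val)
    qed
    moreover have "\<forall>\<^sub>F x in at_right y. new_l (cis x) = new_r (cis \<theta>) \<and> new_r (cis x) = new_r (cis \<theta>)"
      "\<forall>\<^sub>F x in at_left y. new_l (cis x) = new_l (cis \<theta>) \<and> new_r (cis x) = new_l (cis \<theta>)"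
      using R' L' unfolding val by (auto split: if_splits)
    ultimately show ?thesis
      using eventually_cis_cong(1)[OF zy, of "\<lambda>u. new_l u = new_r (cis \<theta>) \<and> new_r u = new_r (cis \<theta>)"]
        eventually_cis_cong(2)[OF zy, of "\<lambda>u. new_l u = new_l (cis \<theta>) \<and> new_r u = new_l (cis \<theta>)"] by blast
  qed
qed

lemma new_values:
  assumes "k < N" "A.comp k = i" "t \<in> {-1..1}" "z = cis (A.ctr k + A.wid k * t)"
  shows "new_l z = F k (if A.wid k > 0 then {..<t} else {..t})" "new_r z = F k (if A.wid k > 0 then {..t} else {..<t})"
  using param_eq[OF assms(1-3)] by (auto simp: new_l_def new_r_def assms(4))

lemma cong_reduced:
  "[fst (reduced x) = fst (reduced y) + d] (mod int n) \<longleftrightarrow> [fst x = fst y + d] (mod int n)"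
  "[fst (reduced x) = - fst (reduced y)] (mod int n) \<longleftrightarrow> [fst x = - fst y] (mod int n)"
  by (simp_all add: reduced_def cong_def mod_add_left_eq mod_minus_eq)

lemma e_pm: "e k \<in> {1, -1}"
  using sign_pm[OF colors, of "cis (A.ctr k + A.wid k * -1)"] by (auto simp: e_def A.at_start_def)

lemma new_colors: "colors n D' i new_l new_r"
  unfolding colors_def
proof (intro conjI allI impI ballI)
  show "germs (cuts D' i) new_l new_r" by (rule new_germs)
  show "snd (new_l z) \<in> {1, -1}" if z: "z \<in> sphere 0 1" for z
  proof (cases "(i, z) \<in> inside L")
    case True
    then obtain k t where k: "k < N" "A.comp k = i" "t \<in> {-1..1}" "z = cis (A.ctr k + A.wid k * t)"
      by (rule inside_strand)
    have "snd (F k X) \<in> {1, -1}" for X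
      using e_pm[of k] tsign_pm[of T' k X] by (auto simp: F_def)
    then show ?thesis unfolding new_values(1)[OF k] by blast
  next
    case False
    then show ?thesis using sign_pm(1)[OF colors z] by (simp add: new_l_def reduced_def)
  qed
  {
    fix z q assume q: "classical D' (i, z) q"
    have "snd (new_r z) = snd (new_l z) \<and> [fst (new_r z) = fst (new_l z) + eps D' (i, z) q] (mod int n)"
    proof (cases "(i, z) \<in> inside L")
      case True
      then obtain k t where k: "k < N" "A.comp k = i" "t \<in> {-1..1}" "z = cis (A.ctr k + A.wid k * t)"
        and loc: "A.loc (k, t) = (i, z)" by (rule inside_strand)
      obtain q' where q': "q = A.loc q'" "((k, t), q') \<in> tcross T'"
        using B.classical_loc_partner[of "(k, t)" q] k q loc by auto
      have eps: "eps D' (i, z) q = A.orient k * tjump A.orient T' (k, t) q'"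
        using B.eps_loc[OF q'(2)] unfolding q'(1) loc by simp
      note F = F_step(1)[OF k(1,3) q'(2)]
      show ?thesis
      proof (cases "A.wid k > 0")
        case True
        then show ?thesis using F unfolding new_values[OF k] eps by (simp add: A.orient_def)
      next
        case False
        have "[fst (F k {..t}) + - tjump A.orient T' (k, t) q' =
            fst (F k {..<t}) + tjump A.orient T' (k, t) q' + - tjump A.orient T' (k, t) q'] (mod int n)"
          using F by (intro cong_add) auto
        then show ?thesis using F False unfolding new_values[OF k] eps by (simp add: A.orient_def cong_sym)
      qed
    next
      case False
      have c: "classical D (i, z) q" using q classical_outside[OF False] by blast
      then have "eps D' (i, z) q = eps D (i, z) q" using eps_outside False unfolding classical_def by blast
      moreover have "snd (r z) = snd (l z)" "[fst (r z) = fst (l z) + eps D (i, z) q] (mod int n)"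
        using colorsD(3)[OF colors c] by blast+
      ultimately show ?thesis
        using False by (simp add: new_l_def new_r_def cong_reduced) (simp add: reduced_def)
    qed
  }
  then show "snd (new_r z) = snd (new_l z)" "[fst (new_r z) = fst (new_l z) + eps D' (i, z) q] (mod int n)"
    if "classical D' (i, z) q" for z q using that by blast+
  {
    fix z assume b: "(i, z) \<in> bars D'"
    have "snd (new_r z) = - snd (new_l z) \<and> [fst (new_r z) = - fst (new_l z)] (mod int n)"
    proof (cases "(i, z) \<in> inside L")
      case True
      then obtain k t where k: "k < N" "A.comp k = i" "t \<in> {-1..1}" "z = cis (A.ctr k + A.wid k * t)"
        and loc: "A.loc (k, t) = (i, z)" by (rule inside_strand)
      have "(k, t) \<in> tbars T'" using B.loc_props(3)[OF k(1,3)] b loc by simp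
      note F = F_step(2)[OF k(1,3) this]
      show ?thesis
      proof (cases "A.wid k > 0")
        case True
        then show ?thesis using F unfolding new_values[OF k] by simp
      next
        case False
        have "[- fst (F k {..t}) = - (- fst (F k {..<t}))] (mod int n)"
          using F by (simp only: cong_minus_minus_iff)
        then show ?thesis using F False unfolding new_values[OF k] by (simp add: cong_sym)
      qed
    next
      case False
      have "(i, z) \<in> points D - inside L" using b B.D False points_eq unfolding twisted_diagram_def by blast
      then have "(i, z) \<in> bars D" using same b by blast
      then have "snd (r z) = - snd (l z)" "[fst (r z) = - fst (l z)] (mod int n)"
        using colorsD(4)[OF colors] by blast+
      then show ?thesis
        using False by (simp add: new_l_def new_r_def cong_reduced) (simp add: reduced_def)
    qed
  }
  then show "snd (new_r z) = - snd (new_l z)" "[fst (new_r z) = - fst (new_l z)] (mod int n)"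
    if "(i, z) \<in> bars D'" for z using that by blast+
qed

lemma new_start:
  assumes "k < N" "A.comp k = i"
  shows "B.at_start new_l new_r k (-1) = F k {}"
proof -
  have "{..<-1} \<inter> events T' = {} \<inter> events T'" using events_tame(2)[OF B.tame] by force
  then show ?thesis using on_strand(1)[OF assms, of "-1"] F_cong by simp
qed

text \<open>Old and new coloring share their left-end data, so the splittings of both diagrams can
  be written with the same a and e.\<close>

lemma e_start:
  assumes "k < N" "A.comp k = i"
  shows "e k = snd (A.at_start l r k (-1))" "e k = snd (B.at_start new_l new_r k (-1))"
    "[a k = fst (A.at_start l r k (-1))] (mod int n)" "[a k = fst (B.at_start new_l new_r k (-1))] (mod int n)"
proof -
  have "B.at_start new_l new_r k (-1) = reduced (A.at_start l r k (-1))"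
    using new_start[OF assms] start_value[OF assms] by (rule trans[OF _ sym])
  then show "e k = snd (A.at_start l r k (-1))" "e k = snd (B.at_start new_l new_r k (-1))"
    "[a k = fst (A.at_start l r k (-1))] (mod int n)" "[a k = fst (B.at_start new_l new_r k (-1))] (mod int n)"
    using assms(2) by (simp_all add: e_def a_def reduced_def cong_def)
qed

lemma classical_outside_set:
  "{(p, q). classical D' p q \<and> p \<notin> inside L} = {(p, q). classical D p q \<and> p \<notin> inside L}"
  using classical_outside by auto

lemma new_defect_sum: "defect_sum D' i (\<lambda>z. snd (new_l z)) = defect_sum D i (\<lambda>z. snd (l z))"
proof -
  have "(\<Sum>(p, q) | classical D' p q \<and> p \<notin> inside L. if fst p = i then snd (new_l (snd p)) * eps D' p q else 0) =
    (\<Sum>(p, q) | classical D p q \<and> p \<notin> inside L. if fst p = i then snd (l (snd p)) * eps D p q else 0)"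
    unfolding classical_outside_set
  proof (rule sum.cong[OF refl])
    fix x assume "x \<in> {(p, q). classical D p q \<and> p \<notin> inside L}"
    then obtain p q where x: "x = (p, q)" "classical D p q" "p \<notin> inside L" by auto
    then have "eps D' p q = eps D p q" using eps_outside unfolding classical_def by blast
    moreover have "snd (new_l (snd p)) = snd (l (snd p))" if "fst p = i"
      using x(3) that by (cases p) (auto simp: new_l_def reduced_def)
    ultimately show "(case x of (p, q) \<Rightarrow> if fst p = i then snd (new_l (snd p)) * eps D' p q else 0) =
      (case x of (p, q) \<Rightarrow> if fst p = i then snd (l (snd p)) * eps D p q else 0)" by (simp add: x(1))
  qed
  moreover have "tsum A.orient T k UNIV = tsum A.orient T' k UNIV" if "k < N" for k
    using compatible A.orient_pm that unfolding compatible_def A.length_strands by blast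
  then have "(\<Sum>k<N. if A.comp k = i then e k * A.orient k * tsum A.orient T k UNIV else 0) =
      (\<Sum>k<N. if A.comp k = i then e k * A.orient k * tsum A.orient T' k UNIV else 0)"
    by (intro sum.cong) auto
  moreover note A.defect_sum_split[where e = e, OF colors] B.defect_sum_split[where e = e, OF new_colors]
  ultimately show ?thesis using e_start(1,2) by simp
qed

lemma new_crossing_sum:
  assumes \<phi>: "admissible n \<phi>"
  shows "crossing_sum \<phi> D' i new_l = crossing_sum \<phi> D i l"
proof -
  let ?g = "\<lambda>D l. \<lambda>(p, q). if p \<in> overs D then crossing_term \<phi> D i l p q else 0"
  have "sum (?g D' new_l) {(p, q). classical D' p q \<and> p \<notin> inside L} =
      sum (?g D l) {(p, q). classical D p q \<and> p \<notin> inside L}"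
    unfolding classical_outside_set
  proof (rule sum.cong[OF refl])
    fix x assume "x \<in> {(p, q). classical D p q \<and> p \<notin> inside L}"
    then obtain p q where x: "x = (p, q)" "classical D p q" "p \<notin> inside L" by auto
    have d: "double D p q" "double D q p" using x(2) double_sym unfolding classical_def by blast+
    have q: "q \<notin> inside L" "p \<in> points D" using d x(3) A.double_inside unfolding double_def by blast+
    have eps: "eps D' p q = eps D p q" "eps D' q p = eps D q p"
      using eps_outside d x(3) q(1) by blast+
    have over: "p \<in> overs D' \<longleftrightarrow> p \<in> overs D" using same[of p] q(2) x(3) by blast
    show "?g D' new_l x = ?g D l x"
    proof (cases "fst p = i \<and> fst q = i")
      case True
      then have new: "new_l (snd p) = reduced (l (snd p))" "new_l (snd q) = reduced (l (snd q))"
        using x(3) q(1) unfolding new_l_def by (metis prod.collapse)+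
      \<comment> \<open>Reduction has changed the first factors outside as well, so the weights
        agree only mod n, which \<open>admissible\<close> absorbs.\<close>
      have "[left_value D' new_l p q - left_value D' new_l q p = left_value D l p q - left_value D l q p] (mod int n)"
        unfolding left_value_def eps new by (intro cong_diff cong_add) (auto simp: reduced_def cong_def)
      then have "\<phi> (left_value D' new_l p q - left_value D' new_l q p) u v = \<phi> (left_value D l p q - left_value D l q p) u v" for u v
        using \<phi> unfolding admissible_def by blast
      then show ?thesis by (simp add: x(1) crossing_term_def eps over) (simp add: new reduced_def)
    qed (auto simp: x(1) crossing_term_def)
  qed
  moreover have "e k \<in> {1, -1}" for k by (rule e_pm)
  then have "tangle_sum \<phi> A.orient T {k. A.comp k = i} a e = tangle_sum \<phi> A.orient T' {k. A.comp k = i} a e"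
    using compatible A.orient_pm \<phi> unfolding compatible_def by blast
  ultimately show ?thesis
    using A.crossing_sum_split[where e = e and a = a, OF colors \<phi>]
      B.crossing_sum_split[where e = e and a = a, OF new_colors \<phi>] e_start by simp
qed

end

lemma replaces_colors:
  assumes "twisted_diagram D" "twisted_diagram D'" "replaces T T' D D'" "tame T" "tame T'" "compatible T T'"
    and "i \<in> {1..ncomp D}" "colors n D i l r"
  shows "\<exists>l' r'. colors n D' i l' r' \<and> defect_sum D' i (\<lambda>z. snd (l' z)) = defect_sum D i (\<lambda>z. snd (l z)) \<and>
    (\<forall>\<phi>. admissible n \<phi> \<longrightarrow> crossing_sum \<phi> D' i l' = crossing_sum \<phi> D i l)"
proof -
  obtain L where L: "contains_tangle D T L" "contains_tangle D' T' L"
    "\<forall>p\<in>points D - inside L. pos D' p = pos D p \<and>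
        (p \<in> overs D' \<longleftrightarrow> p \<in> overs D) \<and> (p \<in> bars D' \<longleftrightarrow> p \<in> bars D)" "ncomp D' = ncomp D"
    using assms(3) unfolding replaces_def by blast
  interpret colored_swap D T D' T' L n i l r
    by unfold_locales (use L assms in auto)
  show ?thesis using new_colors new_defect_sum new_crossing_sum by blast
qed

lemma replaces_sym:
  assumes "replaces T T' D D'" shows "replaces T' T D' D"
proof -
  have "points D' = points D" using assms by (auto simp: replaces_def points_def)
  then show ?thesis using assms unfolding replaces_def by metis
qed

lemma compatible_sym:
  assumes "compatible T T'" "length (strands T) = length (strands T')" shows "compatible T' T"
  using assms unfolding compatible_def by metis

section \<open>The tangles of the extended Reidemeister moves\<close>

lemma bump_deriv: "(bump has_real_derivative - 4 * t * (1 - t\<^sup>2)) (at t)"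
  unfolding bump_def by (auto intro!: derivative_eq_intros simp: algebra_simps power2_eq_square)

lemma wave_deriv: "(wave has_real_derivative 1 - 16 / 9 * (bump t - 4 * t\<^sup>2 * (1 - t\<^sup>2))) (at t)"
proof -
  have "((\<lambda>t. t - 16 / 9 * t * bump t) has_real_derivative 1 - 16 / 9 * (bump t - 4 * t\<^sup>2 * (1 - t\<^sup>2))) (at t)"
    by (rule DERIV_cong, (rule derivative_intros bump_deriv)+) (simp add: field_simps power2_eq_square)
  then show ?thesis by (simp add: wave_def[abs_def])
qed

lemma Complex_deriv:
  assumes "(f has_real_derivative a) (at t)" "(g has_real_derivative b) (at t)"
  shows "((\<lambda>t. Complex (f t) (g t)) has_vector_derivative Complex a b) (at t)"
proof -
  have "((\<lambda>t. of_real (f t) + \<i> * of_real (g t)) has_vector_derivative (of_real a + \<i> * of_real b)) (at t)"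
    using assms by (auto intro!: derivative_eq_intros has_vector_derivative_of_real)
  then show ?thesis by (simp add: Complex_eq)
qed

lemma strand_derivs:
  "(straight has_vector_derivative Complex 1 0) (at t)"
  "(kink \<sigma> has_vector_derivative Complex (1 - 16 / 9 * (bump t - 4 * t\<^sup>2 * (1 - t\<^sup>2))) (\<sigma> * (- 4 * t * (1 - t\<^sup>2)))) (at t)"
  "((\<lambda>t. Complex t c) has_vector_derivative Complex 1 0) (at t)"
  "((\<lambda>t. Complex t (c - bump t)) has_vector_derivative Complex 1 (4 * t * (1 - t\<^sup>2))) (at t)"
  "((\<lambda>t. Complex t t) has_vector_derivative Complex 1 1) (at t)"
  "((\<lambda>t. Complex t (- t)) has_vector_derivative Complex 1 (- 1)) (at t)"
  "((\<lambda>t. Complex t (c * bump t)) has_vector_derivative Complex 1 (c * (- 4 * t * (1 - t\<^sup>2)))) (at t)"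
  "((\<lambda>t. Complex t (wave t)) has_vector_derivative Complex 1 (1 - 16 / 9 * (bump t - 4 * t\<^sup>2 * (1 - t\<^sup>2)))) (at t)"
  "((\<lambda>t. Complex t (- wave t)) has_vector_derivative Complex 1 (- (1 - 16 / 9 * (bump t - 4 * t\<^sup>2 * (1 - t\<^sup>2))))) (at t)"
  using Complex_deriv[OF DERIV_ident DERIV_const] Complex_deriv[OF wave_deriv DERIV_cmult[OF bump_deriv]]
    Complex_deriv[OF DERIV_ident DERIV_diff[OF DERIV_const bump_deriv]]
    Complex_deriv[OF DERIV_ident DERIV_ident] Complex_deriv[OF DERIV_ident DERIV_minus[OF DERIV_ident]]
    Complex_deriv[OF DERIV_ident DERIV_cmult[OF bump_deriv]] Complex_deriv[OF DERIV_ident wave_deriv]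
    Complex_deriv[OF DERIV_ident DERIV_minus[OF wave_deriv]]
  by (simp_all add: straight_def[abs_def] kink_def[abs_def])

lemmas strand_vels = strand_derivs[THEN vector_derivative_at]

lemma bump_bounds: "\<bar>t\<bar> \<le> 1 \<Longrightarrow> 0 \<le> bump t \<and> bump t \<le> 1"
  using power_le_one[of "1 - t\<^sup>2" 2] abs_square_le_1[of t] by (simp add: bump_def)

lemma wave_bound: "\<bar>t\<bar> \<le> 1 \<Longrightarrow> \<bar>wave t\<bar> \<le> 1"
proof -
  assume t: "\<bar>t\<bar> \<le> 1"
  have "wave t = t * (1 - 16 / 9 * bump t)" by (simp add: wave_def algebra_simps)
  moreover have "\<bar>1 - 16 / 9 * bump t\<bar> \<le> 1" using bump_bounds[OF t] by linarith
  ultimately show ?thesis using t by (metis abs_ge_zero abs_mult mult_le_one)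
qed

lemma half_values:
  assumes "t = 1/2 \<or> t = -1/2" shows "bump t = 9/16" "wave t = 0"
proof -
  have "t\<^sup>2 = 1/4" using assms by (elim disjE; hypsubst; simp add: power2_eq_square)
  then show "bump t = 9/16" unfolding bump_def by (simp only:) (simp add: power2_eq_square)
  then show "wave t = 0" by (simp add: wave_def)
qed

lemma zero_values: "bump 0 = 1" "wave 0 = 0"
  by (simp_all add: bump_def wave_def)

lemma bump_eq_iff:
  assumes "\<bar>u\<bar> \<le> 1" shows "bump u = 9/16 \<longleftrightarrow> u = 1/2 \<or> u = -1/2"
proof
  assume "bump u = 9/16"
  then have "(1 - u\<^sup>2)\<^sup>2 = (3/4)\<^sup>2" by (simp add: bump_def power2_eq_square)
  moreover have "1 - u\<^sup>2 \<ge> 0" using abs_square_le_1[of u] assms by simp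
  ultimately have "1 - u\<^sup>2 = 3/4" by (simp add: power2_eq_iff_nonneg)
  then have "u\<^sup>2 = (1/2)\<^sup>2" by (simp add: power2_eq_square)
  then show "u = 1/2 \<or> u = -1/2" by (simp only: power2_eq_iff) auto
qed (rule half_values(1))

lemma triple_eq_iff:
  assumes "\<bar>t\<bar> \<le> 1" shows "t = 8/9 * bump t \<longleftrightarrow> t = 1/2"
proof
  assume eq: "t = 8/9 * bump t"
  then have t: "0 \<le> t" using bump_bounds[OF assms] by linarith
  \<comment> \<open>The constant 8/9 places a root of the quartic at 1/2. On [0, 1] the cubic
    cofactor is at most 4t + 2t - 7t - 8, which is negative, so there is no other root.\<close>
  have "(2 * t - 1) * (4 * t^3 + 2 * t\<^sup>2 - 7 * t - 8) = 0"
    using eq by (simp add: bump_def algebra_simps power2_eq_square power3_eq_cube)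
  moreover have "t^3 \<le> 1" "t\<^sup>2 \<le> 1" "t\<^sup>2 \<le> t" "t^3 \<le> t"
    using assms t power_le_one[of t] power_decreasing[of 1 2 t] power_decreasing[of 1 3 t] by auto
  then have "4 * t^3 + 2 * t\<^sup>2 - 7 * t - 8 < 0" using t by linarith
  ultimately show "t = 1/2" by auto
next
  assume t: "t = 1/2"
  then have "bump t = 9/16" by (intro half_values(1) disjI1)
  then show "t = 8/9 * bump t" using t by linarith
qed

lemma tcross_no_overs: "tovers T = {} \<Longrightarrow> tcross T = {}"
  by (auto simp: tcross_def)

text \<open>The requirement of equal bars is attached to a crossing, so it is vacuous for tangles
  without classical crossings; this covers T1 and T2, whose bars differ.\<close>

lemma compatible_cong:
  assumes "tcross T = tcross T'" and "\<And>k. k < length (strands T) \<Longrightarrow> tsign T k UNIV = tsign T' k UNIV"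
    and "\<And>p q. (p, q) \<in> tcross T \<Longrightarrow> tsgn T p q = tsgn T' p q \<and> (p \<in> tovers T \<longleftrightarrow> p \<in> tovers T') \<and>
      tbars T = tbars T'"
  shows "compatible T T'"
proof -
  have sgn: "tsign T k X = tsign T' k X" if "(p, q) \<in> tcross T" for p q k X
    using assms(3)[OF that] by (simp add: tsign_def)
  have jump: "tjump s T p q = tjump s T' p q" if "(p, q) \<in> tcross T" for p q s
    using assms(3)[OF that] by (simp add: tjump_def)
  have sum: "tsum s T k X = tsum s T' k X" for s k X
    unfolding tsum_def assms(1)[symmetric]
    by (intro sum.cong refl) (auto simp: sgn jump)
  have val: "tvalue s T a p q = tvalue s T' a p q" if "(p, q) \<in> tcross T" for s a p q
    unfolding tvalue_def using sgn[OF that] jump[OF that] sum by simp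
  have "tangle_sum \<phi> s T K a e = tangle_sum \<phi> s T' K a e" for \<phi> s K a e
    unfolding tangle_sum_def assms(1)[symmetric]
  proof (rule sum.cong[OF refl])
    fix x assume x: "x \<in> tcross T"
    obtain p q where pq: "x = (p, q)" by (cases x)
    note 1 = x[unfolded pq] and 2 = tcross_sym[OF x[unfolded pq]]
    show "(case x of (p, q) \<Rightarrow> if p \<in> tovers T \<and> fst p \<in> K \<and> fst q \<in> K then tangle_term \<phi> s T a e p q else 0) =
      (case x of (p, q) \<Rightarrow> if p \<in> tovers T' \<and> fst p \<in> K \<and> fst q \<in> K then tangle_term \<phi> s T' a e p q else 0)"
      using assms(3)[OF 1] by (simp add: pq tangle_term_def val[OF 1] val[OF 2] sgn[OF 1])
  qed
  then show ?thesis using assms(2) sum by (simp add: compatible_def)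
qed

lemma tsign_no_bars: "tbars T = {} \<Longrightarrow> tsign T k X = 1"
  by (simp add: tsign_def)

lemma tameI:
  assumes "finite (tcross T)" "finite (tbars T)" "\<And>p q. (p, q) \<in> tcross T \<Longrightarrow> snd p \<in> {-1<..<1}"
    "\<And>p. p \<in> tbars T \<Longrightarrow> snd p \<in> {-1<..<1}"
    "\<And>f t. f \<in> set (strands T) \<Longrightarrow> \<bar>t\<bar> \<le> 1 \<Longrightarrow> f t \<in> rect"
    "\<And>f t. f \<in> set (strands T) \<Longrightarrow> f differentiable at t"
  shows "tame T"
  using assms unfolding tame_def by auto

lemma strands_in_rect:
  assumes "\<bar>t\<bar> \<le> 1" "\<sigma> \<in> {1, -1}"
  shows "straight t \<in> rect" "kink \<sigma> t \<in> rect" "Complex t (9/16) \<in> rect" "Complex t (9/16 - bump t) \<in> rect"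
    "Complex t t \<in> rect" "Complex t (- t) \<in> rect" "Complex t (\<sigma> * (8/9) * bump t) \<in> rect"
    "Complex t (wave t) \<in> rect" "Complex t (- wave t) \<in> rect"
  using assms bump_bounds[OF assms(1)] wave_bound[OF assms(1)]
  by (auto simp: rect_def straight_def kink_def abs_mult)

lemmas strand_diff = strand_derivs[THEN differentiableI_vector]

section \<open>The classical crossings of the explicit tangles\<close>

lemma tcross_kink:
  assumes "\<sigma> \<in> {1, -1}" "s \<in> {1/2, -1/2}"
  shows "tcross \<lparr>strands = [kink \<sigma>], tovers = {(0, s)}, tbars = B\<rparr> = {((0, 1/2), (0, -1/2)), ((0, -1/2), (0, 1/2))}"
proof -
  \<comment> \<open>One point of a classical crossing is the over point s, so only partners of 1/2
    and -1/2 have to be found; a partner shares the value of \<open>bump\<close>, which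
    \<open>bump_eq_iff\<close> solves.\<close>
  have *: "kink \<sigma> t = kink \<sigma> u \<and> t \<noteq> u \<and> \<bar>u\<bar> \<le> 1 \<longleftrightarrow> u = - t" if t: "t \<in> {1/2, -1/2}" for t u
  proof -
    have T: "t = 1/2 \<or> t = -1/2" using t by blast
    then have "- t = 1/2 \<or> - t = -1/2" by (elim disjE; hypsubst; simp)
    with T have "bump t = 9/16" "wave t = 0" "bump (- t) = 9/16" "wave (- t) = 0"
      using half_values[of t] half_values[of "- t"] T by blast+
    moreover have "\<bar>u\<bar> \<le> 1 \<Longrightarrow> bump u = 9/16 \<Longrightarrow> t \<noteq> u \<Longrightarrow> u = - t" using t bump_eq_iff[of u] by auto
    moreover have "t \<noteq> - t" "\<bar>- t\<bar> \<le> 1" using t by auto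
    ultimately show ?thesis using assms(1) by (auto simp: kink_def)
  qed
  let ?T = "\<lparr>strands = [kink \<sigma>], tovers = {(0, s)}, tbars = B\<rparr>"
  have "tcross ?T = {((0, s), (0, - s)), ((0, - s), (0, s))}" (is "_ = ?R")
  proof (intro equalityI subsetI)
    fix x assume "x \<in> tcross ?T"
    then obtain k t l u where x: "x = ((k, t), (l, u))" "k = 0" "l = 0" "\<bar>t\<bar> \<le> 1" "\<bar>u\<bar> \<le> 1"
      "t \<noteq> u" "kink \<sigma> t = kink \<sigma> u" "t = s \<or> u = s"
      by (cases x) (auto simp: tcross_def)
    then have "u = s \<and> t = - s \<or> t = s \<and> u = - s"
      using *[of t u] *[of u t] assms(2) by metis
    then show "x \<in> ?R" using x(1-3) by auto
  next
    have s: "s \<noteq> - s" "\<bar>s\<bar> \<le> 1" "kink \<sigma> s = kink \<sigma> (- s)" using assms(2) *[OF assms(2), of "- s"] by auto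
    fix x assume "x \<in> ?R"
    then show "x \<in> tcross ?T" using s by (auto simp: tcross_def)
  qed
  also have "?R = {((0, 1/2), (0, -1/2)), ((0, -1/2), (0, 1/2))}"
    using assms(2) by (elim insertE emptyE; hypsubst) auto
  finally show ?thesis .
qed

text \<open>Strands that are graphs over the real part can meet only at equal parameters, so a set
  of parameters describes the crossings.\<close>

lemma tcross_two:
  assumes "strands T = [f, g]" "\<And>t. Re (f t) = t" "\<And>t. Re (g t) = t"
    and Z: "\<And>t. t \<in> Z \<longleftrightarrow> \<bar>t\<bar> \<le> 1 \<and> f t = g t \<and> ((0, t) \<in> tovers T \<or> (1, t) \<in> tovers T)"
  shows "tcross T = (\<lambda>t. ((0::nat, t), (1::nat, t))) ` Z \<union> (\<lambda>t. ((1::nat, t), (0::nat, t))) ` Z"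
proof (intro equalityI subsetI)
  fix x assume "x \<in> tcross T"
  then obtain k t l u where x: "x = ((k, t), (l, u))" "k < 2" "l < 2" "\<bar>t\<bar> \<le> 1" "\<bar>u\<bar> \<le> 1" "(k, t) \<noteq> (l, u)"
    "([f, g] ! k) t = ([f, g] ! l) u" "(k, t) \<in> tovers T \<or> (l, u) \<in> tovers T"
    using assms(1) by (cases x) (auto simp: tcross_def numeral_2_eq_2)
  have kl: "k = 0 \<or> k = 1" "l = 0 \<or> l = 1" using x by auto
  have "Re (([f, g] ! k) t) = t" "Re (([f, g] ! l) u) = u" using kl assms(2,3) by auto
  then have "u = t" using x(7) by simp
  then show "x \<in> (\<lambda>t. ((0::nat, t), (1::nat, t))) ` Z \<union> (\<lambda>t. ((1::nat, t), (0::nat, t))) ` Z"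
    using x kl unfolding image_iff Un_iff Bex_def Z by auto
next
  fix x assume "x \<in> (\<lambda>t. ((0::nat, t), (1::nat, t))) ` Z \<union> (\<lambda>t. ((1::nat, t), (0::nat, t))) ` Z"
  then show "x \<in> tcross T" using assms(1) Z by (auto simp: tcross_def)
qed

lemma tcross_three:
  assumes "strands T = [f, g, h]" "\<And>t. Re (f t) = t" "\<And>t. Re (g t) = t" "\<And>t. Re (h t) = t"
    and X: "\<And>t. t \<in> X \<longleftrightarrow> \<bar>t\<bar> \<le> 1 \<and> f t = g t \<and> ((0, t) \<in> tovers T \<or> (1, t) \<in> tovers T)"
    and Y: "\<And>t. t \<in> Y \<longleftrightarrow> \<bar>t\<bar> \<le> 1 \<and> f t = h t \<and> ((0, t) \<in> tovers T \<or> (2, t) \<in> tovers T)"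
    and Z: "\<And>t. t \<in> Z \<longleftrightarrow> \<bar>t\<bar> \<le> 1 \<and> g t = h t \<and> ((1, t) \<in> tovers T \<or> (2, t) \<in> tovers T)"
  shows "tcross T = (\<lambda>t. ((0::nat, t), (1::nat, t))) ` X \<union> (\<lambda>t. ((1::nat, t), (0::nat, t))) ` X \<union>
    (\<lambda>t. ((0::nat, t), (2::nat, t))) ` Y \<union> (\<lambda>t. ((2::nat, t), (0::nat, t))) ` Y \<union>
    (\<lambda>t. ((1::nat, t), (2::nat, t))) ` Z \<union> (\<lambda>t. ((2::nat, t), (1::nat, t))) ` Z" (is "_ = ?R")
proof (intro equalityI subsetI)
  fix x assume "x \<in> tcross T"
  then obtain k t l u where x: "x = ((k, t), (l, u))" "k < 3" "l < 3" "\<bar>t\<bar> \<le> 1" "\<bar>u\<bar> \<le> 1" "(k, t) \<noteq> (l, u)"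
    "([f, g, h] ! k) t = ([f, g, h] ! l) u" "(k, t) \<in> tovers T \<or> (l, u) \<in> tovers T"
    using assms(1) by (cases x) (auto simp: tcross_def numeral_3_eq_3)
  have kl: "k = 0 \<or> k = 1 \<or> k = 2" "l = 0 \<or> l = 1 \<or> l = 2" using x by auto
  have "Re (([f, g, h] ! k) t) = t" "Re (([f, g, h] ! l) u) = u" using kl assms(2-4) by auto
  then have "u = t" using x(7) by simp
  then show "x \<in> ?R"
    using x kl unfolding image_iff Un_iff Bex_def X Y Z by (elim disjE; simp; metis?)
next
  fix x assume "x \<in> ?R"
  then show "x \<in> tcross T" using assms(1) X Y Z by (auto simp: tcross_def numeral_2_eq_2)
qed

lemma tcross_bigon:
  assumes "k \<in> {0, 1}"
  shows "tcross \<lparr>strands = bigon2, tovers = {(k, -1/2), (k, 1/2)}, tbars = B\<rparr> =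
    {((0, -1/2), (1, -1/2)), ((0, 1/2), (1, 1/2)), ((1, -1/2), (0, -1/2)), ((1, 1/2), (0, 1/2))}"
proof -
  let ?T = "\<lparr>strands = bigon2, tovers = {(k, -1/2), (k, 1/2)}, tbars = B\<rparr>"
  have Z: "t \<in> {-1/2, 1/2} \<longleftrightarrow> \<bar>t\<bar> \<le> 1 \<and> straight t = Complex t (9/16 - bump t) \<and>
      ((0, t) \<in> tovers ?T \<or> (1, t) \<in> tovers ?T)" for t
    using assms half_values[of t] by (auto simp: straight_def)
  show ?thesis
    by (subst tcross_two[OF _ _ _ Z]) (auto simp: bigon2_def straight_def)
qed

text \<open>The only over point has parameter 0, so further intersections, such as the virtual ones
  of \<open>braid2\<close>, need not be located.\<close>

lemma tcross_middle:
  assumes "k \<in> {0, 1}" "strands T = [f, g]" "\<And>t. Re (f t) = t" "\<And>t. Re (g t) = t" "f 0 = g 0" "tovers T = {(k, 0)}"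
  shows "tcross T = {((0, 0), (1, 0)), ((1, 0), (0, 0))}"
proof -
  have Z: "t \<in> {0} \<longleftrightarrow> \<bar>t\<bar> \<le> 1 \<and> f t = g t \<and> ((0, t) \<in> tovers T \<or> (1, t) \<in> tovers T)" for t
    using assms by auto
  show ?thesis by (subst tcross_two[OF assms(2-4) Z]) auto
qed

text \<open>Again only the parameter 0 can be classical, and strand 2 avoids the origin because
  \<open>bump 0 = 1\<close>.\<close>

lemma tcross_V4:
  assumes "k \<in> {0, 1}" "\<sigma> \<in> {1, -1}"
  shows "tcross \<lparr>strands = triple3 \<sigma>, tovers = {(k, 0)}, tbars = B\<rparr> = {((0, 0), (1, 0)), ((1, 0), (0, 0))}"
proof -
  let ?T = "\<lparr>strands = triple3 \<sigma>, tovers = {(k, 0)}, tbars = B\<rparr>"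
  have X: "t \<in> {0} \<longleftrightarrow> \<bar>t\<bar> \<le> 1 \<and> Complex t t = Complex t (- t) \<and> ((0, t) \<in> tovers ?T \<or> (1, t) \<in> tovers ?T)" for t
    using assms by auto
  have Y: "t \<in> {} \<longleftrightarrow> \<bar>t\<bar> \<le> 1 \<and> Complex t t = Complex t (\<sigma> * (8/9) * bump t) \<and> ((0, t) \<in> tovers ?T \<or> (2, t) \<in> tovers ?T)" for t
    using assms zero_values by auto
  have Z: "t \<in> {} \<longleftrightarrow> \<bar>t\<bar> \<le> 1 \<and> Complex t (- t) = Complex t (\<sigma> * (8/9) * bump t) \<and> ((1, t) \<in> tovers ?T \<or> (2, t) \<in> tovers ?T)" for t
    using assms zero_values by auto
  show ?thesis
    by (subst tcross_three[OF _ _ _ _ X Y Z]) (auto simp: triple3_def)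
qed

text \<open>As \<open>bump\<close> is even, replacing t by -t reduces all cases to
  \<open>triple_eq_iff\<close>.\<close>

lemma triple_crossing:
  assumes "\<bar>t\<bar> \<le> 1" "\<sigma> \<in> {1, -1}"
  shows "t = \<sigma> * (8/9) * bump t \<longleftrightarrow> t = \<sigma> / 2" "- t = \<sigma> * (8/9) * bump t \<longleftrightarrow> t = - \<sigma> / 2"
proof -
  have m: "bump (- t) = bump t" by (simp add: bump_def)
  have "t = 8/9 * bump t \<longleftrightarrow> t = 1/2" "- t = 8/9 * bump t \<longleftrightarrow> - t = 1/2"
    using triple_eq_iff[of t] triple_eq_iff[of "- t"] assms(1) m by auto
  then show "t = \<sigma> * (8/9) * bump t \<longleftrightarrow> t = \<sigma> / 2" "- t = \<sigma> * (8/9) * bump t \<longleftrightarrow> t = - \<sigma> / 2"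
    using assms(2) by auto
qed

lemma height_overs_iff:
  assumes "\<sigma> \<in> {1, -1}"
  shows "(0, t) \<in> height_overs h \<sigma> \<longleftrightarrow> h 1 < h 0 \<and> t = 0 \<or> h 2 < h 0 \<and> t = \<sigma> / 2"
    and "(1, t) \<in> height_overs h \<sigma> \<longleftrightarrow> h 0 < h 1 \<and> t = 0 \<or> h 2 < h 1 \<and> t = - \<sigma> / 2"
    and "(2, t) \<in> height_overs h \<sigma> \<longleftrightarrow> h 0 < h 2 \<and> t = \<sigma> / 2 \<or> h 1 < h 2 \<and> t = - \<sigma> / 2"
proof -
  have ex: "(\<exists>l<3. P l) \<longleftrightarrow> P 0 \<or> P 1 \<or> P (2::nat)" for P
    by (auto simp: numeral_3_eq_3 numeral_2_eq_2 less_Suc_eq)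
  have c: "\<bar>\<sigma> / 2\<bar> \<le> 1" "\<bar>- \<sigma> / 2\<bar> \<le> 1" using assms by auto
  note eq = triple_crossing[OF _ assms]
  show "(0, t) \<in> height_overs h \<sigma> \<longleftrightarrow> h 1 < h 0 \<and> t = 0 \<or> h 2 < h 0 \<and> t = \<sigma> / 2"
    "(1, t) \<in> height_overs h \<sigma> \<longleftrightarrow> h 0 < h 1 \<and> t = 0 \<or> h 2 < h 1 \<and> t = - \<sigma> / 2"
    "(2, t) \<in> height_overs h \<sigma> \<longleftrightarrow> h 0 < h 2 \<and> t = \<sigma> / 2 \<or> h 1 < h 2 \<and> t = - \<sigma> / 2"
    unfolding height_overs_def mem_Collect_eq case_prod_conv ex
    using eq[of t] c by (auto simp: triple3_def abs_le_iff)
qed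

lemma tcross_R3:
  assumes h: "inj_on h {..<3}" and \<sigma>: "\<sigma> \<in> {1, -1}"
  shows "tcross \<lparr>strands = triple3 \<sigma>, tovers = height_overs h \<sigma>, tbars = B\<rparr> =
    {((0, 0), (1, 0)), ((1, 0), (0, 0)), ((0, \<sigma>/2), (2, \<sigma>/2)), ((2, \<sigma>/2), (0, \<sigma>/2)),
     ((1, -\<sigma>/2), (2, -\<sigma>/2)), ((2, -\<sigma>/2), (1, -\<sigma>/2))}"
proof -
  let ?T = "\<lparr>strands = triple3 \<sigma>, tovers = height_overs h \<sigma>, tbars = B\<rparr>"
  \<comment> \<open>Distinct heights make exactly one of the two strands the upper one, so all three
    crossings are classical.\<close>
  have ne: "h 0 < h 1 \<or> h 1 < h 0" "h 0 < h 2 \<or> h 2 < h 0" "h 1 < h 2 \<or> h 2 < h 1"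
    using inj_onD[OF h, of 0 1] inj_onD[OF h, of 0 2] inj_onD[OF h, of 1 2] by (auto simp: neq_iff[symmetric])
  have c: "\<bar>\<sigma> / 2\<bar> \<le> 1" "\<bar>- \<sigma> / 2\<bar> \<le> 1" "\<sigma> / 2 \<noteq> - \<sigma> / 2" "\<sigma> / 2 \<noteq> 0" using \<sigma> by auto
  note eq = triple_crossing[OF _ \<sigma>] and ov = height_overs_iff[OF \<sigma>] height_overs_iff(2)[OF \<sigma>, unfolded One_nat_def]
  have X: "t \<in> {0} \<longleftrightarrow> \<bar>t\<bar> \<le> 1 \<and> Complex t t = Complex t (- t) \<and> ((0, t) \<in> tovers ?T \<or> (1, t) \<in> tovers ?T)" for t
    using ne(1) by (auto simp: ov)
  have Y: "t \<in> {\<sigma> / 2} \<longleftrightarrow> \<bar>t\<bar> \<le> 1 \<and> Complex t t = Complex t (\<sigma> * (8/9) * bump t) \<and> ((0, t) \<in> tovers ?T \<or> (2, t) \<in> tovers ?T)" (is "_ \<longleftrightarrow> ?R t") for t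
  proof
    assume "t \<in> {\<sigma> / 2}"
    then have t: "t = \<sigma> / 2" by blast
    then have "\<bar>t\<bar> \<le> 1" using c by blast
    then show "?R t" using ne(2) eq(1)[of t] t unfolding tangle.select_convs ov complex.inject by blast
  next
    assume "?R t"
    then show "t \<in> {\<sigma> / 2}" using eq(1)[of t] unfolding complex.inject by blast
  qed
  have Z: "t \<in> {- \<sigma> / 2} \<longleftrightarrow> \<bar>t\<bar> \<le> 1 \<and> Complex t (- t) = Complex t (\<sigma> * (8/9) * bump t) \<and> ((1, t) \<in> tovers ?T \<or> (2, t) \<in> tovers ?T)" (is "_ \<longleftrightarrow> ?R t") for t
  proof
    assume "t \<in> {- \<sigma> / 2}"
    then have t: "t = - \<sigma> / 2" by blast
    then have "\<bar>t\<bar> \<le> 1" using c by blast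
    then show "?R t" using ne(3) eq(2)[of t] t unfolding tangle.select_convs ov complex.inject by blast
  next
    assume "?R t"
    then show "t \<in> {- \<sigma> / 2}" using eq(2)[of t] unfolding complex.inject by blast
  qed
  show ?thesis
    by (subst tcross_three[OF _ _ _ _ X Y Z]) (auto simp: triple3_def)
qed

section \<open>Compatibility of the individual moves\<close>

lemma compatible_R1:
  assumes "\<sigma> \<in> {1, -1}" "s \<in> {1/2, -1/2}"
  shows "compatible \<lparr>strands = [straight], tovers = {}, tbars = {}\<rparr>
    \<lparr>strands = [kink \<sigma>], tovers = {(0, s)}, tbars = {}\<rparr>" (is "compatible ?T _")
proof -
  define T' where "T' = \<lparr>strands = [kink \<sigma>], tovers = {(0, s)}, tbars = {}\<rparr>"
  have T: "tcross ?T = {}" by (rule tcross_no_overs) simp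
  have T': "tcross T' = {((0, 1/2), (0, - (1/2))), ((0, - (1/2)), (0, 1/2))}" "tbars T' = {}" "tovers T' = {(0, s)}"
    unfolding T'_def using tcross_kink[OF assms, of "{}"] by simp_all
  define c where "c = tsgn T' (0, 1/2) (0, - (1/2))"
  \<comment> \<open>At -1/2 and 1/2 the slope of \<open>wave\<close> is 4/3 and that of
    \<open>bump\<close> is 3/2 and -3/2, so the determinant is 4 * \<sigma> up to order.\<close>
  have v: "tvel T' (0, 1/2) = Complex (4/3) (- 3/2 * \<sigma>)" "tvel T' (0, - (1/2)) = Complex (4/3) (3/2 * \<sigma>)"
    using half_values[of "1/2"] half_values[of "- (1/2)"]
    by (auto simp: tvel_def strand_vels power2_eq_square T'_def)
  have c: "tsgn T' (0, - (1/2)) (0, 1/2) = - c" "c = 1 \<or> c = -1"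
    using assms(1) unfolding c_def tsgn_def v det2_def by auto
  note defs = tjump_def c(1) c_def[symmetric] tsign_no_bars tsum_def tvalue_def
  have s: "s = 1/2 \<or> s = - (1/2)" using assms(2) by auto
  have "compatible ?T T'"
  proof (rule compatibleI, goal_cases)
    case (1 r k)
    then show ?case by (simp add: T T' defs)
  next
    case (2 r n \<phi> K a e)
    have r0: "r 0 = 1 \<or> r 0 = -1" using 2(1) by blast+
    \<comment> \<open>The two passages have opposite jumps, so the larger of the values before and
      after is the same at both: the weight is 0 and the signs agree.\<close>
    have "\<phi> 0 (e 0) (e 0) = 0" using 2(2) 2(3)[of 0] unfolding admissible_def by blast
    then show "tangle_sum \<phi> r ?T K a e = tangle_sum \<phi> r T' K a e"
      using s r0 c(2) by (elim disjE; simp add: tangle_sum_def tangle_term_def T T' defs)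
  qed
  then show ?thesis unfolding T'_def .
qed

text \<open>The two crossings have opposite signs. On each strand the second jump undoes the first,
  so the larger value is the same at both crossings; the weights agree and the terms cancel.\<close>

lemma compatible_R2:
  assumes "k \<in> {0, 1}"
  shows "compatible \<lparr>strands = parallel2, tovers = {}, tbars = {}\<rparr>
    \<lparr>strands = bigon2, tovers = {(k, -1/2), (k, 1/2)}, tbars = {}\<rparr>" (is "compatible ?T _")
proof -
  define T' where "T' = \<lparr>strands = bigon2, tovers = {(k, -1/2), (k, 1/2)}, tbars = {}\<rparr>"
  have T: "tcross ?T = {}" by (rule tcross_no_overs) simp
  have T': "tcross T' = {((0, - (1/2)), (Suc 0, - (1/2))), ((0, 1/2), (Suc 0, 1/2)),
      ((Suc 0, - (1/2)), (0, - (1/2))), ((Suc 0, 1/2), (0, 1/2))}" "tbars T' = {}" "tovers T' = {(k, - (1/2)), (k, 1/2)}"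
    unfolding T'_def using tcross_bigon[OF assms, of "{}"] by simp_all
  have v: "tvel T' (0, t) = Complex 1 0" "tvel T' (Suc 0, t) = Complex 1 (4 * t * (1 - t\<^sup>2))" for t
    by (auto simp: tvel_def bigon2_def strand_vels T'_def)
  have c: "tsgn T' (0, - (1/2)) (Suc 0, - (1/2)) = -1" "tsgn T' (Suc 0, - (1/2)) (0, - (1/2)) = 1"
    "tsgn T' (0, 1/2) (Suc 0, 1/2) = 1" "tsgn T' (Suc 0, 1/2) (0, 1/2) = -1"
    unfolding tsgn_def v det2_def by (auto simp: power2_eq_square)
  note defs = tjump_def c tsign_no_bars tsum_def tvalue_def
  have k: "k = 0 \<or> k = Suc 0" using assms by auto
  have "compatible ?T T'"
  proof (rule compatibleI, goal_cases)
    case (1 r k')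
    then have "k' = 0 \<or> k' = Suc 0" by (auto simp: parallel2_def)
    then show ?case by (elim disjE; simp add: T T' defs)
  next
    case (2 r n \<phi> K a e)
    have r0: "r 0 = 1 \<or> r 0 = -1" "r (Suc 0) = 1 \<or> r (Suc 0) = -1" using 2(1) by blast+
    show "tangle_sum \<phi> r ?T K a e = tangle_sum \<phi> r T' K a e"
      using k r0 by (elim disjE; simp add: tangle_sum_def tangle_term_def T T' defs)
  qed
  then show ?thesis unfolding T'_def .
qed

lemma tvel_triple:
  "tvel \<lparr>strands = triple3 \<sigma>, tovers = X, tbars = Y\<rparr> (0, t) = Complex 1 1"
  "tvel \<lparr>strands = triple3 \<sigma>, tovers = X, tbars = Y\<rparr> (Suc 0, t) = Complex 1 (-1)"
  "tvel \<lparr>strands = triple3 \<sigma>, tovers = X, tbars = Y\<rparr> (2, t) = Complex 1 (\<sigma> * (8/9) * (- 4 * t * (1 - t\<^sup>2)))"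
  using strand_vels(7)[of "\<sigma> * (8/9)" t] by (simp_all add: tvel_def triple3_def strand_vels)

text \<open>Strand 2 meets the others only virtually, so the classical crossing and all data
  attached to it coincide.\<close>

lemma compatible_V4:
  assumes "k \<in> {0, 1}"
  shows "compatible \<lparr>strands = triple3 1, tovers = {(k, 0)}, tbars = {}\<rparr>
             \<lparr>strands = triple3 (-1), tovers = {(k, 0)}, tbars = {}\<rparr>"
proof (rule compatible_cong)
  show "tcross \<lparr>strands = triple3 1, tovers = {(k, 0)}, tbars = {}\<rparr> =
      tcross \<lparr>strands = triple3 (-1), tovers = {(k, 0)}, tbars = {}\<rparr>"
    using tcross_V4[OF assms] by simp
qed (use tcross_V4[OF assms, of 1] in \<open>auto simp: tsign_no_bars tsgn_def tvel_triple\<close>)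

lemma compatible_trivial:
  assumes "tovers T = {}" "tovers T' = {}" "\<And>k. k < length (strands T) \<Longrightarrow> tsign T k UNIV = tsign T' k UNIV"
  shows "compatible T T'"
  by (rule compatible_cong) (use assms in \<open>auto simp: tcross_no_overs\<close>)

text \<open>The crossings correspond by their pair of strands, with the same sign. At each one the
  move carries the third strand from one side to the other, which shifts the values on both strands
  by the same amount; the weight is unchanged.\<close>

lemma compatible_R3:
  assumes "inj_on h {..<3}"
  shows "compatible \<lparr>strands = triple3 1, tovers = height_overs h 1, tbars = {}\<rparr>
             \<lparr>strands = triple3 (-1), tovers = height_overs h (-1), tbars = {}\<rparr>"
proof -
  define T where "T = \<lparr>strands = triple3 1, tovers = height_overs h 1, tbars = {}\<rparr>"
  define T' where "T' = \<lparr>strands = triple3 (-1), tovers = height_overs h (-1), tbars = {}\<rparr>"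
  have T: "tcross T = {((0, 0), (Suc 0, 0)), ((Suc 0, 0), (0, 0)), ((0, 1/2), (2, 1/2)), ((2, 1/2), (0, 1/2)),
     ((Suc 0, - (1/2)), (2, - (1/2))), ((2, - (1/2)), (Suc 0, - (1/2)))}" "tbars T = {}"
    unfolding T_def using tcross_R3[OF assms, of 1 "{}"] by simp_all
  have T': "tcross T' = {((0, 0), (Suc 0, 0)), ((Suc 0, 0), (0, 0)), ((0, - (1/2)), (2, - (1/2))), ((2, - (1/2)), (0, - (1/2))),
     ((Suc 0, 1/2), (2, 1/2)), ((2, 1/2), (Suc 0, 1/2))}" "tbars T' = {}"
    unfolding T'_def using tcross_R3[OF assms, of "-1" "{}"] by simp_all
  have c: "tsgn T (0, 0) (Suc 0, 0) = -1" "tsgn T (Suc 0, 0) (0, 0) = 1"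
    "tsgn T (0, 1/2) (2, 1/2) = -1" "tsgn T (2, 1/2) (0, 1/2) = 1"
    "tsgn T (Suc 0, - (1/2)) (2, - (1/2)) = 1" "tsgn T (2, - (1/2)) (Suc 0, - (1/2)) = -1"
    "tsgn T' (0, 0) (Suc 0, 0) = -1" "tsgn T' (Suc 0, 0) (0, 0) = 1"
    "tsgn T' (0, - (1/2)) (2, - (1/2)) = -1" "tsgn T' (2, - (1/2)) (0, - (1/2)) = 1"
    "tsgn T' (Suc 0, 1/2) (2, 1/2) = 1" "tsgn T' (2, 1/2) (Suc 0, 1/2) = -1"
    unfolding T_def T'_def tsgn_def tvel_triple det2_def by (auto simp: power2_eq_square)
  note o1 = height_overs_iff[of 1 _ h, unfolded One_nat_def] and o2 = height_overs_iff[of "-1" _ h, unfolded One_nat_def]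
  have ov: "(0, 0) \<in> tovers T \<longleftrightarrow> h (Suc 0) < h 0" "(Suc 0, 0) \<in> tovers T \<longleftrightarrow> h 0 < h (Suc 0)"
    "(0, 1/2) \<in> tovers T \<longleftrightarrow> h 2 < h 0" "(2, 1/2) \<in> tovers T \<longleftrightarrow> h 0 < h 2"
    "(Suc 0, - (1/2)) \<in> tovers T \<longleftrightarrow> h 2 < h (Suc 0)" "(2, - (1/2)) \<in> tovers T \<longleftrightarrow> h (Suc 0) < h 2"
    "(0, 0) \<in> tovers T' \<longleftrightarrow> h (Suc 0) < h 0" "(Suc 0, 0) \<in> tovers T' \<longleftrightarrow> h 0 < h (Suc 0)"
    "(0, - (1/2)) \<in> tovers T' \<longleftrightarrow> h 2 < h 0" "(2, - (1/2)) \<in> tovers T' \<longleftrightarrow> h 0 < h 2"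
    "(Suc 0, 1/2) \<in> tovers T' \<longleftrightarrow> h 2 < h (Suc 0)" "(2, 1/2) \<in> tovers T' \<longleftrightarrow> h (Suc 0) < h 2"
    unfolding T_def T'_def by (simp_all add: o1 o2)
  note defs = tjump_def c tsign_no_bars tsum_def
  have "compatible T T'"
  proof (rule compatibleI, goal_cases)
    case (1 r k')
    then have "k' = 0 \<or> k' = Suc 0 \<or> k' = 2" by (auto simp: T_def triple3_def)
    then show ?case by (elim disjE; simp add: T T' defs)
  next
    case (2 r n \<phi> K a e)
    have r0: "r 0 = 1 \<or> r 0 = -1" "r (Suc 0) = 1 \<or> r (Suc 0) = -1" "r 2 = 1 \<or> r 2 = -1" using 2(1) by blast+
    have sums: "tsum r T 0 {..<0} = 0" "tsum r T (Suc 0) {..<0} = - r 2" "tsum r T 0 {..<1/2} = r (Suc 0)"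
      "tsum r T 2 {..<1/2} = r (Suc 0)" "tsum r T (Suc 0) {..<- (1/2)} = 0" "tsum r T 2 {..<- (1/2)} = 0"
      "tsum r T' 0 {..<0} = r 2" "tsum r T' (Suc 0) {..<0} = 0" "tsum r T' 0 {..<- (1/2)} = 0"
      "tsum r T' 2 {..<- (1/2)} = 0" "tsum r T' (Suc 0) {..<1/2} = - r 0" "tsum r T' 2 {..<1/2} = - r 0"
      by (simp_all add: tsum_def T T' tjump_def c tsign_no_bars)
    have "tvalue r T a (0, 0) (Suc 0, 0) - tvalue r T a (Suc 0, 0) (0, 0) =
        tvalue r T' a (0, 0) (Suc 0, 0) - tvalue r T' a (Suc 0, 0) (0, 0)"
      "tvalue r T a (0, 1/2) (2, 1/2) - tvalue r T a (2, 1/2) (0, 1/2) =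
        tvalue r T' a (0, - (1/2)) (2, - (1/2)) - tvalue r T' a (2, - (1/2)) (0, - (1/2))"
      "tvalue r T a (Suc 0, - (1/2)) (2, - (1/2)) - tvalue r T a (2, - (1/2)) (Suc 0, - (1/2)) =
        tvalue r T' a (Suc 0, 1/2) (2, 1/2) - tvalue r T' a (2, 1/2) (Suc 0, 1/2)"
      using r0 by (auto simp: tvalue_def sums tjump_def c tsign_no_bars T(2) T'(2))
    \<comment> \<open>The negated equations serve the cases in which the other strand of the
      crossing is the upper one.\<close>
    note tv = this this[THEN arg_cong[of _ _ uminus], unfolded minus_diff_eq]
    show "tangle_sum \<phi> r T K a e = tangle_sum \<phi> r T' K a e"
      by (simp add: tangle_sum_def tangle_term_def T T' tv ov c tsign_no_bars)
  qed
  then show ?thesis unfolding T_def T'_def .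
qed

text \<open>The bars negate both values at the crossing, and over and under are exchanged, so the
  weight survives: negation swaps larger and smaller value on each strand, and these shifts by 1
  cancel in the difference. The crossing sign is unchanged, since exchanging the strands and
  exchanging over and under each reverse it.\<close>

lemma compatible_T3:
  assumes "k \<in> {0, 1}"
  shows "compatible \<lparr>strands = cross2, tovers = {(k, 0)}, tbars = {(0, -1/2), (0, 1/2), (1, -1/2), (1, 1/2)}\<rparr>
             \<lparr>strands = braid2, tovers = {(1 - k, 0)}, tbars = {}\<rparr>"
proof -
  define T where "T = \<lparr>strands = cross2, tovers = {(k, 0)}, tbars = {(0, -1/2), (0, 1/2), (1, -1/2), (1, 1/2)}\<rparr>"
  define T' where "T' = \<lparr>strands = braid2, tovers = {(1 - k, 0)}, tbars = {}\<rparr>"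
  have k: "k = 0 \<or> k = Suc 0" using assms by auto
  have T: "tcross T = {((0, 0), (Suc 0, 0)), ((Suc 0, 0), (0, 0))}" "tovers T = {(k, 0)}"
    using tcross_middle[OF assms, of T "\<lambda>t. Complex t t" "\<lambda>t. Complex t (- t)"] by (auto simp: cross2_def T_def)
  have T': "tcross T' = {((0, 0), (Suc 0, 0)), ((Suc 0, 0), (0, 0))}" "tovers T' = {(1 - k, 0)}" "tbars T' = {}"
    using k zero_values tcross_middle[of "1 - k" T' "\<lambda>t. Complex t (wave t)" "\<lambda>t. Complex t (- wave t)"]
    by (auto simp: braid2_def T'_def)
  \<comment> \<open>The slope of \<open>wave\<close> at 0 is 1 - 16/9 = -7/9, so in the middle of
    \<open>braid2\<close> the strands cross in the opposite direction.\<close>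
  have v: "tvel T (0, 0) = Complex 1 1" "tvel T (Suc 0, 0) = Complex 1 (-1)"
    "tvel T' (0, 0) = Complex 1 (-7/9)" "tvel T' (Suc 0, 0) = Complex 1 (7/9)"
    by (auto simp: tvel_def cross2_def braid2_def strand_vels zero_values T_def T'_def)
  have c: "tsgn T (0, 0) (Suc 0, 0) = -1" "tsgn T (Suc 0, 0) (0, 0) = 1"
    "tsgn T' (0, 0) (Suc 0, 0) = 1" "tsgn T' (Suc 0, 0) (0, 0) = -1"
    unfolding tsgn_def v det2_def by auto
  have sg: "tsign T 0 {..<0} = -1" "tsign T (Suc 0) {..<0} = -1" "tsign T 0 UNIV = 1" "tsign T (Suc 0) UNIV = 1"
    by (simp_all add: tsign_def T_def)
  note defs = tjump_def c tsign_no_bars tsum_def tvalue_def sg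
  have "compatible T T'"
  proof (rule compatibleI, goal_cases)
    case (1 r k')
    then have "k' = 0 \<or> k' = Suc 0" by (auto simp: cross2_def T_def)
    then show ?case by (elim disjE; simp add: T T' defs)
  next
    case (2 r n \<phi> K a e)
    have r0: "r 0 = 1 \<or> r 0 = -1" "r (Suc 0) = 1 \<or> r (Suc 0) = -1" using 2(1) by blast+
    have e0: "e 0 = 1 \<or> e 0 = -1" "e (Suc 0) = 1 \<or> e (Suc 0) = -1" using 2(3) by blast+
    have \<phi>1: "\<phi> x (-1) (-1) = \<phi> x 1 1" for x using 2(2) unfolding admissible_def by blast
    have sums: "tsum r T 0 {..<0} = 0" "tsum r T (Suc 0) {..<0} = 0" "tsum r T' 0 {..<0} = 0" "tsum r T' (Suc 0) {..<0} = 0"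
      by (simp_all add: tsum_def T T')
    have tv: "tvalue r T a (0, 0) (Suc 0, 0) - tvalue r T a (Suc 0, 0) (0, 0) =
        tvalue r T' a (Suc 0, 0) (0, 0) - tvalue r T' a (0, 0) (Suc 0, 0)"
      "tvalue r T a (Suc 0, 0) (0, 0) - tvalue r T a (0, 0) (Suc 0, 0) =
        tvalue r T' a (0, 0) (Suc 0, 0) - tvalue r T' a (Suc 0, 0) (0, 0)"
      using r0 by (auto simp: tvalue_def sums tjump_def c sg tsign_no_bars T'(3))
    \<comment> \<open>If the two signs differ, negating both is the same as exchanging them; if they
      agree, admissibility applies.\<close>
    have flip: "\<phi> x (- e 0) (- e (Suc 0)) = \<phi> x (e (Suc 0)) (e 0)" "\<phi> x (- e (Suc 0)) (- e 0) = \<phi> x (e 0) (e (Suc 0))" for x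
      by (rule disjE[OF e0(1)]; rule disjE[OF e0(2)]; simp add: \<phi>1)+
    show "tangle_sum \<phi> r T K a e = tangle_sum \<phi> r T' K a e"
      using k by (elim disjE; simp add: tangle_sum_def tangle_term_def T T' tv flip c sg tsign_no_bars mult.commute)
  qed
  then show ?thesis unfolding T_def T'_def .
qed

section \<open>Tameness of the explicit tangles\<close>

definition tame_strand :: "(real \<Rightarrow> complex) \<Rightarrow> bool" where
  "tame_strand f \<longleftrightarrow> (\<forall>t. f differentiable at t) \<and> (\<forall>t. \<bar>t\<bar> \<le> 1 \<longrightarrow> f t \<in> rect)"

lemma tame_strands:
  assumes "\<sigma> \<in> {1, -1}"
  shows "tame_strand straight" "tame_strand (kink \<sigma>)" "tame_strand (\<lambda>t. Complex t (9/16))"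
    "tame_strand (\<lambda>t. Complex t (9/16 - bump t))" "tame_strand (\<lambda>t. Complex t t)" "tame_strand (\<lambda>t. Complex t (- t))"
    "tame_strand (\<lambda>t. Complex t (\<sigma> * (8/9) * bump t))" "tame_strand (\<lambda>t. Complex t (wave t))"
    "tame_strand (\<lambda>t. Complex t (- wave t))"
  unfolding tame_strand_def using strand_diff strands_in_rect[OF _ assms] by blast+

lemma tame_tangles:
  assumes "\<sigma> \<in> {1, -1}"
  shows "\<forall>f\<in>set [straight]. tame_strand f" "\<forall>f\<in>set [kink \<sigma>]. tame_strand f" "\<forall>f\<in>set parallel2. tame_strand f"
    "\<forall>f\<in>set bigon2. tame_strand f" "\<forall>f\<in>set (triple3 \<sigma>). tame_strand f" "\<forall>f\<in>set cross2. tame_strand f"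
    "\<forall>f\<in>set braid2. tame_strand f"
  unfolding parallel2_def bigon2_def triple3_def cross2_def braid2_def list.set
  using tame_strands[OF assms] by blast+

lemmas tame_tangles1 = tame_tangles[OF insertI1]

lemma standard_tame:
  assumes "tcross T = X" "\<forall>f\<in>set (strands T). tame_strand f" "finite X" "finite (tbars T)"
    "\<And>p q. (p, q) \<in> X \<Longrightarrow> snd p \<in> {-1<..<1}" "\<And>p. p \<in> tbars T \<Longrightarrow> snd p \<in> {-1<..<1}"
  shows "tame T"
  by (rule tameI) (use assms in \<open>auto simp: tame_strand_def\<close>)

lemmas tame_no_overs = standard_tame[OF tcross_no_overs]

lemma ext_move_compatible:
  assumes "ext_move T T'"
  shows "tame T \<and> tame T' \<and> length (strands T) = length (strands T') \<and> compatible T T'"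
  using assms
proof cases
  case (R1 \<sigma> s)
  have "tame T" unfolding R1(1) by (rule tame_no_overs) (use tame_tangles1 in auto)
  moreover have "tame T'" unfolding R1(2)
    by (rule standard_tame[OF tcross_kink[OF R1(3,4)]]) (use tame_tangles[OF R1(3)] in auto)
  ultimately show ?thesis using compatible_R1[OF R1(3,4)] unfolding R1(1,2) by simp
next
  case (R2 k)
  have "tame T" unfolding R2(1) by (rule tame_no_overs) (use tame_tangles1 in auto)
  moreover have "tame T'" unfolding R2(2)
    by (rule standard_tame[OF tcross_bigon[OF R2(3)]]) (use tame_tangles1 in auto)
  ultimately show ?thesis using compatible_R2[OF R2(3)] unfolding R2(1,2)
    by (simp add: parallel2_def bigon2_def)
next
  case (R3 h)
  have "tame T" unfolding R3(1)
    by (rule standard_tame[OF tcross_R3[OF R3(3)]]) (use tame_tangles[of 1] in auto)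
  moreover have "tame T'" unfolding R3(2)
    by (rule standard_tame[OF tcross_R3[OF R3(3)]]) (use tame_tangles[of "-1"] in auto)
  ultimately show ?thesis using compatible_R3[OF R3(3)] unfolding R3(1,2) by (simp add: triple3_def)
next
  case (V1 \<sigma>)
  have "tame T" "tame T'" unfolding V1 by (rule tame_no_overs; use tame_tangles[OF V1(3)] in auto)+
  moreover have "compatible T T'" unfolding V1 by (rule compatible_trivial) (auto simp: tsign_no_bars)
  ultimately show ?thesis unfolding V1 by simp
next
  case V2
  have "tame T" "tame T'" unfolding V2 by (rule tame_no_overs; use tame_tangles1 in auto)+
  moreover have "compatible T T'" unfolding V2 by (rule compatible_trivial) (auto simp: tsign_no_bars)
  ultimately show ?thesis unfolding V2 by (simp add: parallel2_def bigon2_def)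
next
  case V3
  have "tame T" "tame T'" unfolding V3 by (rule tame_no_overs; use tame_tangles[of 1] tame_tangles[of "-1"] in auto)+
  moreover have "compatible T T'" unfolding V3 by (rule compatible_trivial) (auto simp: tsign_no_bars)
  ultimately show ?thesis unfolding V3 by (simp add: triple3_def)
next
  case (V4 k)
  have "tame T" unfolding V4(1)
    by (rule standard_tame[OF tcross_V4[OF V4(3)]]) (use tame_tangles[of 1] in auto)
  moreover have "tame T'" unfolding V4(2)
    by (rule standard_tame[OF tcross_V4[OF V4(3)]]) (use tame_tangles[of "-1"] in auto)
  ultimately show ?thesis using compatible_V4[OF V4(3)] unfolding V4(1,2) by (simp add: triple3_def)
next
  case T1
  have "tame T" "tame T'" unfolding T1 by (rule tame_no_overs; use tame_tangles1 in auto)+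
  moreover have "compatible T T'" unfolding T1 by (rule compatible_trivial) (auto simp: tsign_def)
  ultimately show ?thesis unfolding T1 by simp
next
  case T2
  have "tame T" "tame T'" unfolding T2 by (rule tame_no_overs; use tame_tangles1 in auto)+
  moreover have "compatible T T'" unfolding T2 by (rule compatible_trivial) (auto simp: tsign_def)
  ultimately show ?thesis unfolding T2 by simp
next
  case (T3 k)
  have k: "1 - k \<in> {0, 1}" using T3(3) by auto
  have "tame T" unfolding T3(1)
    by (rule standard_tame[OF tcross_middle[OF T3(3), where f = "\<lambda>t. Complex t t" and g = "\<lambda>t. Complex t (- t)"]])
      (use tame_tangles1 in \<open>auto simp: cross2_def\<close>)
  moreover have "tame T'" unfolding T3(2)
    by (rule standard_tame[OF tcross_middle[OF k, where f = "\<lambda>t. Complex t (wave t)" and g = "\<lambda>t. Complex t (- wave t)"]])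
      (use tame_tangles1 in \<open>auto simp: braid2_def zero_values\<close>)
  ultimately show ?thesis using compatible_T3[OF T3(3)] unfolding T3(1,2) by (simp add: cross2_def braid2_def)
qed

section \<open>Colorings along a chain of moves\<close>

lemma step_colors:
  assumes "twisted_step D D' \<or> twisted_step D' D" and "i \<in> {1..ncomp D}" "colors n D i l r"
  shows "ncomp D' = ncomp D \<and> (\<exists>l' r'. colors n D' i l' r' \<and>
    defect_sum D' i (\<lambda>z. snd (l' z)) = defect_sum D i (\<lambda>z. snd (l z)) \<and>
    (\<forall>\<phi>. admissible n \<phi> \<longrightarrow> crossing_sum \<phi> D' i l' = crossing_sum \<phi> D i l))"
proof -
  have D: "twisted_diagram D" "twisted_diagram D'" using assms(1) by (auto simp: twisted_step_def)
  consider "isotopic D D'" | "isotopic D' D" | T T' where "ext_move T T'" "replaces T T' D D'"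
    | T T' where "ext_move T T'" "replaces T T' D' D"
    using assms(1) unfolding twisted_step_def by blast
  then show ?thesis
  proof cases
    case 1
    then obtain \<phi> where iso: "combinatorial_iso \<phi> D D'" using isotopic_combinatorial_iso[OF D] by blast
    show ?thesis using combinatorial_iso_colors[OF iso D(2) assms(2,3)] iso
      unfolding combinatorial_iso_def by blast
  next
    case 2
    then obtain \<phi> where "combinatorial_iso \<phi> D' D" using isotopic_combinatorial_iso[OF D(2,1)] by blast
    \<comment> \<open>A reversed isotopy is available only in its combinatorial form, where
      inversion is elementary.\<close>
    from combinatorial_iso_sym[OF this] have iso: "combinatorial_iso (\<lambda>i. inv (\<phi> i)) D D'" .
    show ?thesis using combinatorial_iso_colors[OF iso D(2) assms(2,3)] iso
      unfolding combinatorial_iso_def by blast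
  next
    case (3 T T')
    have "ncomp D' = ncomp D" using 3(2) by (simp add: replaces_def)
    then show ?thesis
      using replaces_colors[OF D 3(2) _ _ _ assms(2,3)] ext_move_compatible[OF 3(1)] by blast
  next
    case (4 T T')
    have "ncomp D' = ncomp D" using 4(2) by (simp add: replaces_def)
    moreover have "compatible T' T" using ext_move_compatible[OF 4(1)] compatible_sym by blast
    ultimately show ?thesis
      using replaces_colors[OF D replaces_sym[OF 4(2)] _ _ _ assms(2,3)] ext_move_compatible[OF 4(1)] by blast
  qed
qed

text \<open>The modulus n and the defect sum of D are carried unchanged through all intermediate
  diagrams, so each step needs only the germ coloring produced by the previous one.\<close>

lemma equivalent_colors:
  assumes "twisted_equivalent D D'" and i: "i \<in> {1..ncomp D}" and c: "colors n D i l r"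
  shows "ncomp D' = ncomp D \<and> (\<exists>l' r'. colors n D' i l' r' \<and>
    defect_sum D' i (\<lambda>z. snd (l' z)) = defect_sum D i (\<lambda>z. snd (l z)) \<and>
    (\<forall>\<phi>. admissible n \<phi> \<longrightarrow> crossing_sum \<phi> D' i l' = crossing_sum \<phi> D i l))"
  using assms(1) unfolding twisted_equivalent_def
proof (induction rule: equivclp_induct)
  case base
  then show ?case using c by blast
next
  case (step E E')
  then obtain l' r' where IH: "ncomp E = ncomp D" "colors n E i l' r'"
    "defect_sum E i (\<lambda>z. snd (l' z)) = defect_sum D i (\<lambda>z. snd (l z))"
    "\<forall>\<phi>. admissible n \<phi> \<longrightarrow> crossing_sum \<phi> E i l' = crossing_sum \<phi> D i l" by blast
  have "i \<in> {1..ncomp E}" using i IH(1) by simp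
  from step_colors[OF step.hyps(2) this IH(2)] show ?case using IH by metis
qed

theorem theorem4p6:
  fixes D D' :: diagram and i m :: nat and C C' :: coloring
  assumes "twisted_diagram D" and "twisted_diagram D'"
    and "ncomp D = m" and "ncomp D' = m" and "i \<in> {1..m}"
    and "even_type D i" and "even_type D' i"
    and "twisted_coloring (twisted_defect D i) D i C"
    and "twisted_coloring (twisted_defect D' i) D' i C'"
    and "twisted_equivalent D D'"
  shows "index_poly D i C = index_poly D' i C' \<and>
    two_equivalent (signed_index_poly 1 D i C, signed_index_poly (-1) D i C)
                   (signed_index_poly 1 D' i C', signed_index_poly (-1) D' i C')"
proof -
  define n where "n = twisted_defect D i"
  let ?l = "\<lambda>z. C (arc_in D (i, z))" and ?l' = "\<lambda>z. C' (arc_in D' (i, z))"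
  have c: "colors n D i ?l (\<lambda>z. C (arc_out D (i, z)))"
    unfolding n_def by (rule colors_of_coloring[OF assms(1,8)])
  have "i \<in> {1..ncomp D}" using assms(3,5) by simp
  from equivalent_colors[OF assms(10) this c] obtain l r where lr: "colors n D' i l r"
    "defect_sum D' i (\<lambda>z. snd (l z)) = defect_sum D i (\<lambda>z. snd (?l z))"
    "\<And>\<phi>. admissible n \<phi> \<Longrightarrow> crossing_sum \<phi> D' i l = crossing_sum \<phi> D i ?l" by blast
  \<comment> \<open>The transported signs form a sign function on D' with the defect sum of D, so
    the two moduli coincide and both colorings live in the same ring.\<close>
  have "int (twisted_defect D' i) = int n"
    using twisted_defect_defect_sum[OF assms(2,9) signs_of_colors[OF lr(1)]]
      twisted_defect_defect_sum[OF assms(1,8) signs_of_colors[OF c]] lr(2) by (simp add: n_def)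
  then have n': "twisted_defect D' i = n" by simp
  have c': "colors n D' i ?l' (\<lambda>z. C' (arc_out D' (i, z)))"
    using colors_of_coloring[OF assms(2,9)] n' by simp
  \<comment> \<open>The polynomials of D are now expressed on D' through the transported coloring;
    only two colorings of one diagram remain to be compared.\<close>
  have P: "index_poly D i C = residue_class n (crossing_sum (phi_same n) D' i l)"
    "signed_index_poly 1 D i C = residue_class n (crossing_sum (phi_signed 1 n) D' i l)"
    "signed_index_poly (-1) D i C = residue_class n (crossing_sum (phi_signed (-1) n) D' i l)"
    using index_poly_crossing_sum[OF assms(1,8)] lr(3) admissible_phi by (simp_all flip: n_def)
  have P': "index_poly D' i C' = residue_class n (crossing_sum (phi_same n) D' i ?l')"
    "signed_index_poly s D' i C' = residue_class n (crossing_sum (phi_signed s n) D' i ?l')" for s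
    using index_poly_crossing_sum[OF assms(2,9)] n' by simp_all
  show ?thesis
    unfolding P P' using two_equivalent_change[OF assms(2) c' lr(1)] by simp
qed

end
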